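(* There is a minimizer of $\mathrm{TV}$ over $\mathrm{BV}_\diamond$ that attains only two non-zero values.
   Context: Setting: $\Omega_s\subset\Omega\subset\mathbb{R}^2$ are bounded, open and strongly Lipschitz, $\partial\Omega_s\cap\partial\Omega=\emptyset$, and $\Omega_s$ has finitely many connected components. For $v\in L^1(\mathbb{R}^2)$, $\mathrm{TV}(v)$ denotes the total mass of the distributional gradient $\nabla v$ on $\mathbb{R}^2$ (total variation), and $$\mathrm{BV}_\diamond:=\Big\{v\in\mathrm{BV}(\mathbb{R}^2)\ :\ \int_\Omega v=0,\ \frac{1}{|\Omega_s|}\int_{\Omega_s}v=1,\ \nabla v=0\text{ on }\Omega_s,\ v=0\text{ on }\mathbb{R}^2\setminus\Omega\Big\}.$$ (Thus $v\in\mathrm{BV}_\diamond$ is constant on each connected component of $\Omega_s$, with possibly different constants.) Functions are identified when equal almost everywhere, and the values attained are understood for a suitable representative. *)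

theory Defs
  imports "HOL-Analysis.Analysis"
begin

text \<open>
  Strongly Lipschitz: near each boundary point, after a rigid change of coordinates, the set is
  the strict subgraph of a Lipschitz function. A translation of the coordinates is absorbed in
  \<open>g\<close>, so an orthogonal map suffices.
\<close>

definition strongly_lipschitz :: "(real ^ 2) set \<Rightarrow> bool" where
  "strongly_lipschitz S \<longleftrightarrow>
     (\<forall>p \<in> frontier S. \<exists>U (T :: real ^ 2 \<Rightarrow> real ^ 2) (g :: real \<Rightarrow> real) L.
        open U \<and> p \<in> U \<and> orthogonal_transformation T \<and> L-lipschitz_on UNIV g \<and>
        S \<inter> U = {x \<in> U. T x $ 2 < g (T x $ 1)})"

text \<open>
  Compactly supported \<open>C\<^sup>1\<close> vector fields. As the dimension is finite, continuity of the derivative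
  in the operator norm amounts to continuity of all directional derivatives. The distributional
  gradient of an \<open>L\<^sup>1\<close> function has order at most one, so it may be tested against \<open>C\<^sup>1\<close> fields.
\<close>

definition test_fields :: "(real ^ 2) set \<Rightarrow> (real ^ 2 \<Rightarrow> real ^ 2) set" where
  "test_fields U = {\<phi>. \<phi> differentiable_on UNIV \<and>
     (\<forall>h. continuous_on UNIV (\<lambda>x. frechet_derivative \<phi> (at x) h)) \<and>
     compact (closure {x. \<phi> x \<noteq> 0}) \<and> closure {x. \<phi> x \<noteq> 0} \<subseteq> U}"

definition divergence :: "(real ^ 2 \<Rightarrow> real ^ 2) \<Rightarrow> real ^ 2 \<Rightarrow> real" where
  "divergence \<phi> x = (\<Sum>i\<in>UNIV. frechet_derivative \<phi> (at x) (axis i 1) $ i)"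

definition dist_grad :: "(real ^ 2 \<Rightarrow> real) \<Rightarrow> (real ^ 2 \<Rightarrow> real ^ 2) \<Rightarrow> real" where
  "dist_grad v \<phi> = - (LINT x|lebesgue. v x * divergence \<phi> x)"

definition TV :: "(real ^ 2 \<Rightarrow> real) \<Rightarrow> ereal" where
  "TV v = (SUP \<phi> \<in> {\<phi> \<in> test_fields UNIV. \<forall>x. norm (\<phi> x) \<le> 1}. ereal (dist_grad v \<phi>))"

definition BV :: "(real ^ 2 \<Rightarrow> real) set" where
  "BV = {v. integrable lebesgue v \<and> TV v < \<infinity>}"

text \<open>
  Elements of \<open>BV\<close> are individual functions rather than classes; \<open>BV\<close>, \<open>BV_diamond\<close> and \<open>TV\<close> are
  invariant under changes on null sets.
\<close>

definition BV_diamond :: "(real ^ 2) set \<Rightarrow> (real ^ 2) set \<Rightarrow> (real ^ 2 \<Rightarrow> real) set" where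
  "BV_diamond \<Omega> \<Omega>\<^sub>s = {v \<in> BV.
     (LINT x:\<Omega>|lebesgue. v x) = 0 \<and>
     1 / measure lebesgue \<Omega>\<^sub>s * (LINT x:\<Omega>\<^sub>s|lebesgue. v x) = 1 \<and>
     (\<forall>\<phi> \<in> test_fields \<Omega>\<^sub>s. dist_grad v \<phi> = 0) \<and>
     (AE x in lebesgue. x \<notin> \<Omega> \<longrightarrow> v x = 0)}"

end

theory Submission
  imports Defs
begin

text \<open>
  The functional and the constraints are compatible with the decomposition of a function into its
  layers. Write \<open>v\<close> as the integral over \<open>t\<close> of \<open>1\<^sub>E\<close> with \<open>E = {v > t}\<close> for \<open>t \<ge> 0\<close> and of \<open>- 1\<^sub>F\<close> with
  \<open>F = {v \<le> t}\<close> for \<open>t < 0\<close>. By the coarea inequality (lemma \<open>coarea\<close>) the perimeters of the layers add up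
  to at most the total variation of \<open>v\<close>; every layer inherits a vanishing gradient on \<open>\<Omega>\<^sub>s\<close>
  (\<open>dist_grad_layer_zero\<close>) and vanishes off \<open>\<Omega>\<close>. What is left are two linear constraints, the integrals over
  \<open>\<Omega>\<close> and over \<open>\<Omega>\<^sub>s\<close>. As in a linear program with two constraints, two layers suffice: averaging over the
  heights selects one layer of each sign whose suitable combination is admissible and has total
  variation at most that of \<open>v\<close> (\<open>two_level_competitor\<close>). Layers of opposite sign live on disjoint
  sets, so the combination attains exactly two non-zero values.

  It remains to find some minimizer (\<open>minimizer_exists\<close>). The isoperimetric inequality bounds the \<open>L\<^sup>2\<close>
  norm of the two-valued competitors by their total variation. Hence the convex sets of near-minimizers
  contain elements of bounded \<open>L\<^sup>2\<close> norm, and elements of almost least norm form a Cauchy sequence by the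
  parallelogram law. Its limit is a minimizer by lower semicontinuity.

  The analysis rests on one estimate: for \<open>v\<close> of bounded support, \<open>|v * \<rho>\<^sub>r - v|\<close> has integral at most
  \<open>r * TV v\<close> (\<open>integral_mollify_diff_le\<close>), where the gradient of \<open>v * \<rho>\<^sub>r\<close> has \<open>L\<^sup>1\<close> norm at most \<open>TV v\<close>. It yields the
  isoperimetric inequality at the right scale, and the convergence of the smoothed layers in the
  coarea inequality.
\<close>

section \<open>Lebesgue integrals under translation and reflection\<close>

lemma nn_integral_lborel_shift:
  fixes f :: "'a::euclidean_space \<Rightarrow> ennreal"
  assumes [measurable]: "f \<in> borel_measurable borel"
  shows "(\<integral>\<^sup>+x. f (h + x) \<partial>lborel) = (\<integral>\<^sup>+x. f x \<partial>lborel)"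
proof -
  have "(\<integral>\<^sup>+x. f x \<partial>lborel) = (\<integral>\<^sup>+x. f x \<partial>distr lborel borel ((+) h))"
    by (simp add: lborel_distr_plus)
  also have "\<dots> = (\<integral>\<^sup>+x. f (h + x) \<partial>lborel)"
    by (simp add: nn_integral_distr)
  finally show ?thesis ..
qed

lemma integral_lborel_shift:
  fixes f :: "'a::euclidean_space \<Rightarrow> 'b::{banach, second_countable_topology}"
  assumes [measurable]: "f \<in> borel_measurable borel"
  shows "(\<integral>x. f (h + x) \<partial>lborel) = (\<integral>x. f x \<partial>lborel)"
proof -
  have "(\<integral>x. f x \<partial>lborel) = (\<integral>x. f x \<partial>distr lborel borel ((+) h))"
    by (simp add: lborel_distr_plus)
  also have "\<dots> = (\<integral>x. f (h + x) \<partial>lborel)"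
    by (simp add: integral_distr)
  finally show ?thesis ..
qed

lemma integrable_lborel_shift:
  fixes f :: "'a::euclidean_space \<Rightarrow> 'b::{banach, second_countable_topology}"
  assumes "integrable lborel f"
  shows "integrable lborel (\<lambda>x. f (h + x))"
proof -
  have "integrable (distr lborel borel ((+) h)) f"
    using assms by (simp add: lborel_distr_plus)
  then show ?thesis
    by (rule integrable_distr[rotated]) simp
qed

lemma lborel_distr_reflect:
  fixes c :: "'a::euclidean_space"
  shows "distr lborel borel (\<lambda>x. c - x) = lborel"
  by (subst (2) lborel_affine[of "-1" c]) (auto simp: density_1)

lemma nn_integral_lborel_reflect:
  fixes f :: "'a::euclidean_space \<Rightarrow> ennreal"
  assumes [measurable]: "f \<in> borel_measurable borel"
  shows "(\<integral>\<^sup>+x. f (c - x) \<partial>lborel) = (\<integral>\<^sup>+x. f x \<partial>lborel)"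
proof -
  have "(\<integral>\<^sup>+x. f x \<partial>lborel) = (\<integral>\<^sup>+x. f x \<partial>distr lborel borel (\<lambda>x. c - x))"
    by (simp add: lborel_distr_reflect)
  also have "\<dots> = (\<integral>\<^sup>+x. f (c - x) \<partial>lborel)"
    by (simp add: nn_integral_distr)
  finally show ?thesis ..
qed

lemma integral_lborel_reflect:
  fixes f :: "'a::euclidean_space \<Rightarrow> 'b::{banach, second_countable_topology}"
  assumes [measurable]: "f \<in> borel_measurable borel"
  shows "(\<integral>x. f (c - x) \<partial>lborel) = (\<integral>x. f x \<partial>lborel)"
proof -
  have "(\<integral>x. f x \<partial>lborel) = (\<integral>x. f x \<partial>distr lborel borel (\<lambda>x. c - x))"
    by (simp add: lborel_distr_reflect)
  also have "\<dots> = (\<integral>x. f (c - x) \<partial>lborel)"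
    by (simp add: integral_distr)
  finally show ?thesis ..
qed

lemma integrable_lborel_reflect:
  fixes f :: "'a::euclidean_space \<Rightarrow> 'b::{banach, second_countable_topology}"
  assumes "integrable lborel f"
  shows "integrable lborel (\<lambda>x. f (c - x))"
proof -
  have "integrable (distr lborel borel (\<lambda>x. c - x)) f"
    using assms by (simp add: lborel_distr_reflect)
  then show ?thesis
    by (rule integrable_distr[rotated]) simp
qed

section \<open>Test fields and integration by parts\<close>

lemma has_derivative_zero_off_closed:
  fixes f :: "'a::real_normed_vector \<Rightarrow> 'b::real_normed_vector"
  assumes "(f has_derivative D) (at x)" and "closed K" and "\<And>y. y \<notin> K \<Longrightarrow> f y = 0" and "x \<notin> K"
  shows "D = (\<lambda>h. 0)"
proof -
  have "((\<lambda>y. 0) has_derivative D) (at x)"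
    using assms by (intro has_derivative_transform_within_open[OF assms(1), of "- K"]) auto
  then show ?thesis
    using has_derivative_unique[OF _ has_derivative_const] by blast
qed

lemma continuous_compact_support_bounded:
  fixes f :: "'a::euclidean_space \<Rightarrow> 'b::real_normed_vector"
  assumes "continuous_on UNIV f" and "compact K" and "\<And>y. y \<notin> K \<Longrightarrow> f y = 0"
  obtains B where "B > 0" and "\<And>x. norm (f x) \<le> B"
proof -
  have "compact (f ` K)"
    using assms continuous_on_subset[of UNIV f K] by (intro compact_continuous_image) auto
  then obtain B where "B > 0" and B: "\<And>y. y \<in> f ` K \<Longrightarrow> norm y \<le> B"
    using compact_imp_bounded bounded_pos by metis
  have "norm (f x) \<le> B" for x
    using assms(3)[of x] B[of "f x"] \<open>B > 0\<close> by (cases "x \<in> K") auto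
  with \<open>B > 0\<close> that show thesis by blast
qed

lemma continuous_compact_support_integrable:
  fixes f :: "'a::euclidean_space \<Rightarrow> 'b::{banach, second_countable_topology}"
  assumes "continuous_on UNIV f" and "compact K" and "\<And>y. y \<notin> K \<Longrightarrow> f y = 0"
  shows "integrable lborel f"
proof -
  have "integrable lborel (\<lambda>x. indicator K x *\<^sub>R f x)"
    using assms continuous_on_subset[of UNIV f K] by (intro borel_integrable_compact) auto
  moreover have "(\<lambda>x. indicator K x *\<^sub>R f x) = f"
    using assms(3) by (auto simp: indicator_def fun_eq_iff)
  ultimately show ?thesis by simp
qed

text \<open>
  The divergence theorem for compactly supported functions, one direction at a time: the integral of
  a difference quotient vanishes by translation invariance, and the difference quotients converge
  boundedly to the directional derivative.
\<close>

lemma integral_directional_derivative_eq_0: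
  fixes f :: "'a::euclidean_space \<Rightarrow> real"
  assumes D: "\<And>x. (f has_derivative D x) (at x)"
    and cont: "continuous_on UNIV (\<lambda>x. D x h)"
    and K: "compact K" and f0: "\<And>x. x \<notin> K \<Longrightarrow> f x = 0"
  shows "(\<integral>x. D x h \<partial>lborel) = 0"
proof -
  have D0: "D x h = 0" if "x \<notin> K" for x
    using has_derivative_zero_off_closed[OF D compact_imp_closed[OF K] f0 that] by simp
  obtain B where "B > 0" and B: "\<And>x. norm (D x h) \<le> B"
    using continuous_compact_support_bounded[OF cont K D0] by blast
  obtain R where R: "\<And>x. x \<in> K \<Longrightarrow> norm x \<le> R"
    using compact_imp_bounded[OF K] bounded_iff by metis
  have contf: "continuous_on UNIV f"
    using D by (meson continuous_at_imp_continuous_on has_derivative_continuous)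
  then have mf[measurable]: "f \<in> borel_measurable borel"
    by (rule borel_measurable_continuous_onI)
  have intf: "integrable lborel f"
    by (rule continuous_compact_support_integrable[OF contf K f0])
  have [measurable]: "(\<lambda>x. D x h) \<in> borel_measurable borel"
    by (rule borel_measurable_continuous_onI[OF cont])
  define q where "q n x = real (Suc n) * (f (inverse (real (Suc n)) *\<^sub>R h + x) - f x)" for n x
  have lin: "D x (c *\<^sub>R h) = c * D x h" for x c
    using linear_scale[OF bounded_linear.linear[OF has_derivative_bounded_linear[OF D]]] by simp
  have lim: "(\<lambda>n. q n x) \<longlonglongrightarrow> D x h" for x
  proof -
    have "((\<lambda>t. f (x + t *\<^sub>R h)) has_derivative (\<lambda>t. D x (t *\<^sub>R h))) (at 0)"
      by (rule has_derivative_compose[of "\<lambda>t. x + t *\<^sub>R h" _ 0 UNIV f, simplified])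
        (auto intro!: derivative_eq_intros D)
    then have "((\<lambda>t. f (x + t *\<^sub>R h)) has_real_derivative D x h) (at 0)"
      by (simp add: has_field_derivative_def lin mult_commute_abs)
    then have "((\<lambda>t. (f (x + t *\<^sub>R h) - f x) / t) \<longlongrightarrow> D x h) (at 0)"
      by (simp add: DERIV_def)
    moreover have "filterlim (\<lambda>n. inverse (real (Suc n))) (at 0) sequentially"
      using LIMSEQ_inverse_real_of_nat by (simp add: filterlim_at del: of_nat_Suc)
    ultimately have "(\<lambda>n. (f (x + inverse (real (Suc n)) *\<^sub>R h) - f x) / inverse (real (Suc n)))
        \<longlonglongrightarrow> D x h"
      by (rule filterlim_compose)
    moreover have "(f (x + inverse (real (Suc n)) *\<^sub>R h) - f x) / inverse (real (Suc n)) = q n x" for n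
      unfolding q_def by (simp add: divide_inverse add.commute mult.commute del: of_nat_Suc)
    ultimately show ?thesis by simp
  qed
  \<comment> \<open>The mean value theorem along the segment bounds the quotients by \<open>B\<close>; the support grows by at
    most \<open>norm h\<close>.\<close>
  have bound: "norm (q n x) \<le> B * indicator (cball 0 (R + norm h)) x" for n x
  proof -
    define s where "s = inverse (real (Suc n))"
    have s: "0 < s" "s \<le> 1" "real (Suc n) * s = 1"
      unfolding s_def by (auto simp: field_simps)
    have "\<exists>t>0. t < s \<and> f (x + s *\<^sub>R h) - f (x + 0 *\<^sub>R h) = (s - 0) * D (x + t *\<^sub>R h) h"
    proof (rule MVT2[OF s(1), of "\<lambda>t. f (x + t *\<^sub>R h)" "\<lambda>t. D (x + t *\<^sub>R h) h"])
      fix t :: real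
      have "((\<lambda>t. f (x + t *\<^sub>R h)) has_derivative (\<lambda>u. D (x + t *\<^sub>R h) (u *\<^sub>R h))) (at t)"
        by (rule has_derivative_compose[of "\<lambda>t. x + t *\<^sub>R h" _ t UNIV f, simplified])
          (auto intro!: derivative_eq_intros D)
      then show "((\<lambda>t. f (x + t *\<^sub>R h)) has_real_derivative D (x + t *\<^sub>R h) h) (at t)"
        by (simp add: has_field_derivative_def lin mult_commute_abs)
    qed
    then obtain t where "f (s *\<^sub>R h + x) - f x = s * D (x + t *\<^sub>R h) h"
      by (auto simp: add.commute)
    then have "q n x = real (Suc n) * s * D (x + t *\<^sub>R h) h"
      unfolding q_def s_def[symmetric] by simp
    then have *: "norm (q n x) \<le> B"
      using B s(3) by simp
    show ?thesis
    proof (cases "norm x \<le> R + norm h")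
      case True then show ?thesis using * by simp
    next
      case False
      have "norm (s *\<^sub>R h) \<le> norm h"
        using s mult_right_mono[of s 1 "norm h"] by simp
      moreover have "norm x \<le> norm (s *\<^sub>R h + x) + norm (s *\<^sub>R h)"
        using norm_triangle_ineq4[of "s *\<^sub>R h + x" "s *\<^sub>R h"] by simp
      ultimately have "norm (s *\<^sub>R h + x) > R"
        using False by simp
      moreover have "norm x > R" using False norm_ge_zero[of h] by linarith
      ultimately have "f (s *\<^sub>R h + x) = 0" "f x = 0"
        using R f0 by (meson not_less)+
      then show ?thesis using \<open>B > 0\<close> by (simp add: q_def s_def del: of_nat_Suc)
    qed
  qed
  have "(\<lambda>n. \<integral>x. q n x \<partial>lborel) \<longlonglongrightarrow> (\<integral>x. D x h \<partial>lborel)"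
  proof (rule integral_dominated_convergence)
    show "integrable lborel (\<lambda>x. B * indicator (cball 0 (R + norm h)) x)"
      by (intro integrable_mult_right integrable_real_indicator emeasure_lborel_cball_finite) simp
  qed (use lim bound in \<open>auto simp: q_def\<close>)
  moreover have "(\<integral>x. q n x \<partial>lborel) = 0" for n
    unfolding q_def
    by (simp add: Bochner_Integration.integral_diff integrable_lborel_shift intf integral_lborel_shift)
  ultimately show ?thesis
    by (simp add: LIMSEQ_const_iff)
qed

lemma test_fieldsI:
  assumes D: "\<And>x. (\<phi> has_derivative D x) (at x)"
    and cont: "\<And>h. continuous_on UNIV (\<lambda>x. D x h)"
    and K: "compact K" "K \<subseteq> U" and \<phi>0: "\<And>x. x \<notin> K \<Longrightarrow> \<phi> x = 0"
  shows "\<phi> \<in> test_fields U"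
proof -
  have "frechet_derivative \<phi> (at x) = D x" for x
    using frechet_derivative_at[OF D] by simp
  moreover have "closure {x. \<phi> x \<noteq> 0} \<subseteq> K"
    using \<phi>0 by (intro closure_minimal compact_imp_closed K) auto
  moreover have "compact (closure {x. \<phi> x \<noteq> 0})"
    using \<open>closure {x. \<phi> x \<noteq> 0} \<subseteq> K\<close> K by (metis closed_closure compact_Int_closed inf.absorb2)
  ultimately show ?thesis
    using D cont K unfolding test_fields_def differentiable_on_def differentiable_def
    by auto
qed

lemma test_fieldsD:
  assumes "\<phi> \<in> test_fields U"
  shows "(\<phi> has_derivative frechet_derivative \<phi> (at x)) (at x)"
    and "continuous_on UNIV (\<lambda>x. frechet_derivative \<phi> (at x) h)"
    and "continuous_on UNIV \<phi>"
    and "\<exists>K. compact K \<and> K \<subseteq> U \<and> (\<forall>x. x \<notin> K \<longrightarrow> \<phi> x = 0)"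
proof -
  have d: "\<phi> differentiable (at x)" for x
    using assms unfolding test_fields_def differentiable_on_def by simp
  show *: "(\<phi> has_derivative frechet_derivative \<phi> (at x)) (at x)" for x
    using d by (simp add: frechet_derivative_works)
  show "continuous_on UNIV (\<lambda>x. frechet_derivative \<phi> (at x) h)"
    using assms by (auto simp: test_fields_def)
  show "continuous_on UNIV \<phi>"
    using assms unfolding test_fields_def by (simp add: differentiable_imp_continuous_on)
  have "\<phi> x = 0" if "x \<notin> closure {x. \<phi> x \<noteq> 0}" for x
    using that closure_subset[of "{x. \<phi> x \<noteq> 0}"] by auto
  then show "\<exists>K. compact K \<and> K \<subseteq> U \<and> (\<forall>x. x \<notin> K \<longrightarrow> \<phi> x = 0)"
    using assms unfolding test_fields_def by blast
qed

lemma divergence_eq: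
  assumes "(\<phi> has_derivative D) (at x)"
  shows "divergence \<phi> x = (\<Sum>i\<in>UNIV. D (axis i 1) $ i)"
  using frechet_derivative_at[OF assms] by (simp add: divergence_def)

lemma continuous_divergence:
  assumes "\<phi> \<in> test_fields U"
  shows "continuous_on UNIV (divergence \<phi>)"
  unfolding divergence_def using test_fieldsD(2)[OF assms]
  by (intro continuous_on_sum continuous_on_component) auto

lemma borel_measurable_divergence:
  assumes "\<phi> \<in> test_fields U"
  shows "divergence \<phi> \<in> borel_measurable borel"
  using continuous_divergence[OF assms] by (rule borel_measurable_continuous_onI)

lemma divergence_zero_off:
  assumes "\<phi> \<in> test_fields U" and "closed K" and "\<And>y. y \<notin> K \<Longrightarrow> \<phi> y = 0" and "x \<notin> K"
  shows "divergence \<phi> x = 0"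
  using has_derivative_zero_off_closed[OF test_fieldsD(1)[OF assms(1)] assms(2,3,4)]
  by (simp add: divergence_def)

lemma divergence_bounded:
  assumes "\<phi> \<in> test_fields U"
  obtains B where "B > 0" and "\<And>x. \<bar>divergence \<phi> x\<bar> \<le> B"
proof -
  obtain K where K: "compact K" "\<And>x. x \<notin> K \<Longrightarrow> \<phi> x = 0"
    using test_fieldsD(4)[OF assms] by blast
  show thesis
    using continuous_compact_support_bounded[OF continuous_divergence[OF assms] K(1)
        divergence_zero_off[OF assms compact_imp_closed[OF K(1)] K(2)]] that
    by (metis real_norm_def)
qed

lemma divergence_integrable:
  assumes "\<phi> \<in> test_fields U"
  shows "integrable lborel (divergence \<phi>)"
proof -
  obtain K where K: "compact K" "\<And>x. x \<notin> K \<Longrightarrow> \<phi> x = 0"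
    using test_fieldsD(4)[OF assms] by blast
  show ?thesis
    by (rule continuous_compact_support_integrable[OF continuous_divergence[OF assms] K(1)
        divergence_zero_off[OF assms compact_imp_closed[OF K(1)] K(2)]])
qed

lemma integral_divergence_eq_0:
  assumes \<phi>: "\<phi> \<in> test_fields U"
  shows "(\<integral>x. divergence \<phi> x \<partial>lborel) = 0"
proof -
  obtain K where K: "compact K" "\<And>x. x \<notin> K \<Longrightarrow> \<phi> x = 0"
    using test_fieldsD(4)[OF \<phi>] by blast
  let ?D = "\<lambda>x. frechet_derivative \<phi> (at x)"
  have d: "((\<lambda>y. \<phi> y $ i) has_derivative (\<lambda>h. ?D x h $ i)) (at x)" for i x
    by (rule bounded_linear.has_derivative[OF bounded_linear_vec_nth test_fieldsD(1)[OF \<phi>]])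
  have c: "continuous_on UNIV (\<lambda>x. ?D x h $ i)" for i h
    using test_fieldsD(2)[OF \<phi>] by (intro continuous_on_component) auto
  have "(\<integral>x. ?D x (axis i 1) $ i \<partial>lborel) = 0" for i
    by (rule integral_directional_derivative_eq_0[OF d c K(1)]) (simp add: K(2))
  moreover have "integrable lborel (\<lambda>x. ?D x (axis i 1) $ i)" for i
    by (rule continuous_compact_support_integrable[OF c K(1)])
      (simp add: has_derivative_zero_off_closed[OF test_fieldsD(1)[OF \<phi>] compact_imp_closed[OF K(1)] K(2)])
  ultimately show ?thesis
    unfolding divergence_def by (subst Bochner_Integration.integral_sum) auto
qed

lemma dist_grad_lborel:
  assumes "v \<in> borel_measurable borel" and "\<phi> \<in> test_fields U"
  shows "dist_grad v \<phi> = - (\<integral>x. v x * divergence \<phi> x \<partial>lborel)"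
proof -
  have "(\<lambda>x. v x * divergence \<phi> x) \<in> borel_measurable lborel"
    using assms(1) borel_measurable_divergence[OF assms(2)] by simp
  then show ?thesis
    unfolding dist_grad_def by (simp add: integral_completion)
qed

text \<open>
  For a \<open>C\<^sup>1\<close> function with gradient \<open>G\<close> the distributional gradient is integration against \<open>G\<close>.
\<close>

lemma dist_grad_eq_integral_grad:
  fixes G :: "real^2 \<Rightarrow> real^2"
  assumes u: "\<And>x. (u has_derivative (\<lambda>h. G x \<bullet> h)) (at x)"
    and G: "continuous_on UNIV G" and \<phi>: "\<phi> \<in> test_fields U"
  shows "dist_grad u \<phi> = (\<integral>x. G x \<bullet> \<phi> x \<partial>lborel)"
proof -
  obtain K where K: "compact K" "K \<subseteq> U" "\<And>x. x \<notin> K \<Longrightarrow> \<phi> x = 0"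
    using test_fieldsD(4)[OF \<phi>] by blast
  have contu: "continuous_on UNIV u"
    using u by (meson continuous_at_imp_continuous_on has_derivative_continuous)
  let ?D = "\<lambda>x. frechet_derivative \<phi> (at x)"
  have d: "((\<lambda>y. u y *\<^sub>R \<phi> y) has_derivative (\<lambda>h. u x *\<^sub>R ?D x h + (G x \<bullet> h) *\<^sub>R \<phi> x)) (at x)" for x
    by (rule has_derivative_scaleR[OF u test_fieldsD(1)[OF \<phi>]])
  have t: "(\<lambda>y. u y *\<^sub>R \<phi> y) \<in> test_fields U"
    using K contu G test_fieldsD[OF \<phi>]
    by (intro test_fieldsI[OF d _ K(1,2)]) (auto intro!: continuous_intros)
  have div: "divergence (\<lambda>y. u y *\<^sub>R \<phi> y) x = G x \<bullet> \<phi> x + u x * divergence \<phi> x" for x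
    using divergence_eq[OF d, of x] divergence_eq[OF test_fieldsD(1)[OF \<phi>], of x]
    by (simp add: sum.distrib sum_distrib_left inner_vec_def[of "G x" "\<phi> x"] inner_axis algebra_simps)
  have i1: "integrable lborel (\<lambda>x. G x \<bullet> \<phi> x)"
    using K test_fieldsD(3)[OF \<phi>] G
    by (intro continuous_compact_support_integrable[OF _ K(1)] continuous_intros) auto
  have i2: "integrable lborel (\<lambda>x. u x * divergence \<phi> x)"
    using K continuous_divergence[OF \<phi>] contu divergence_zero_off[OF \<phi> compact_imp_closed[OF K(1)] K(3)]
    by (intro continuous_compact_support_integrable[OF _ K(1)] continuous_intros) auto
  have "0 = (\<integral>x. G x \<bullet> \<phi> x \<partial>lborel) + (\<integral>x. u x * divergence \<phi> x \<partial>lborel)"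
    using integral_divergence_eq_0[OF t] i1 i2 by (simp add: div)
  then show ?thesis
    using dist_grad_lborel[OF borel_measurable_continuous_onI[OF contu] \<phi>] by simp
qed

lemma dist_grad_le_integral_norm:
  fixes G :: "real^2 \<Rightarrow> real^2"
  assumes u: "\<And>x. (u has_derivative (\<lambda>h. G x \<bullet> h)) (at x)"
    and G: "continuous_on UNIV G" and intG: "integrable lborel G"
    and \<phi>: "\<phi> \<in> test_fields U" "\<And>x. norm (\<phi> x) \<le> 1"
  shows "dist_grad u \<phi> \<le> (\<integral>x. norm (G x) \<partial>lborel)"
  unfolding dist_grad_eq_integral_grad[OF u G \<phi>(1)]
proof (rule integral_mono)
  have [measurable]: "\<phi> \<in> borel_measurable borel" "G \<in> borel_measurable borel"
    using test_fieldsD(3)[OF \<phi>(1)] G by (auto intro: borel_measurable_continuous_onI)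
  have *: "\<bar>G x \<bullet> \<phi> x\<bar> \<le> norm (G x)" for x
    using Cauchy_Schwarz_ineq2[of "G x" "\<phi> x"] mult_left_mono[OF \<phi>(2)[of x], of "norm (G x)"]
    by simp
  then show "integrable lborel (\<lambda>x. G x \<bullet> \<phi> x)"
    by (intro Bochner_Integration.integrable_bound[OF intG]) auto
  show "integrable lborel (\<lambda>x. norm (G x))" using intG by simp
  show "G x \<bullet> \<phi> x \<le> norm (G x)" for x using *[of x] by simp
qed

section \<open>Mollification\<close>

text \<open>
  The unnormalised kernel \<open>(r\<^sup>2 - |z|\<^sup>2)\<^sub>+\<^sup>2\<close>, a function of class \<open>C\<^sup>1\<close> with Lipschitz gradient
  that is supported in the closed disc of radius \<open>r\<close>.
\<close>

definition bump :: "real \<Rightarrow> real^2 \<Rightarrow> real" where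
  "bump r z = (max 0 (r\<^sup>2 - z \<bullet> z))\<^sup>2"

text \<open>
  The kernel normalised to integral one, for \<open>r > 0\<close>.
\<close>

definition mollifier :: "real \<Rightarrow> real^2 \<Rightarrow> real" where
  "mollifier r z = bump r z / (\<integral>y. bump r y \<partial>lborel)"

text \<open>
  The gradient of the normalised kernel.
\<close>

definition mollifier_grad :: "real \<Rightarrow> real^2 \<Rightarrow> real^2" where
  "mollifier_grad r z = (- 4 * max 0 (r\<^sup>2 - z \<bullet> z) / (\<integral>y. bump r y \<partial>lborel)) *\<^sub>R z"

text \<open>
  Convolution with the kernel, for scalar functions and for vector fields.
\<close>

definition mollify :: "real \<Rightarrow> (real^2 \<Rightarrow> 'b::{banach, second_countable_topology}) \<Rightarrow> real^2 \<Rightarrow> 'b" where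
  "mollify r f x = (\<integral>y. mollifier r (x - y) *\<^sub>R f y \<partial>lborel)"

text \<open>
  The gradient of the mollification of a scalar function.
\<close>

definition mollify_grad :: "real \<Rightarrow> (real^2 \<Rightarrow> real) \<Rightarrow> real^2 \<Rightarrow> real^2" where
  "mollify_grad r f x = (\<integral>y. f y *\<^sub>R mollifier_grad r (x - y) \<partial>lborel)"

lemma bump_nonneg: "0 \<le> bump r z"
  by (simp add: bump_def)

lemma sq_less_of_norm: "0 < r \<Longrightarrow> r \<le> norm z \<Longrightarrow> r\<^sup>2 \<le> z \<bullet> z"
  by (simp add: dot_square_norm power_mono)

lemma bump_zero: "0 < r \<Longrightarrow> r \<le> norm z \<Longrightarrow> bump r z = 0"
  using sq_less_of_norm[of r z] by (simp add: bump_def)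

lemma continuous_bump: "continuous_on UNIV (bump r)"
  unfolding bump_def[abs_def] by (intro continuous_intros)

lemma integrable_bump:
  assumes "0 < r" shows "integrable lborel (bump r)"
  by (rule continuous_compact_support_integrable[OF continuous_bump compact_cball[of 0 r]])
    (use assms in \<open>auto intro!: bump_zero\<close>)

text \<open>
  On the disc of radius \<open>r/2\<close> the kernel is at least \<open>(3r\<^sup>2/4)\<^sup>2\<close>; the constant below uses \<open>pi > 3\<close>.
\<close>

lemma bump_integral_ge:
  assumes r: "0 < r"
  shows "(\<integral>y. bump r y \<partial>lborel) \<ge> 27/64 * r^6"
proof -
  have "27/64 * r^6 \<le> (3/4 * r\<^sup>2)\<^sup>2 * (pi * (r/2)\<^sup>2)"
    using pi_gt3 r by (simp add: power2_eq_square power_def field_simps numeral_eq_Suc)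
  also have "pi * (r/2)\<^sup>2 = measure lborel (cball (0::real^2) (r/2))"
    using content_cball[of "r/2" "0::real^2"] r by (simp add: unit_ball_vol_2)
  also have "(3/4 * r\<^sup>2)\<^sup>2 * measure lborel (cball (0::real^2) (r/2)) =
      (\<integral>y. (3/4 * r\<^sup>2)\<^sup>2 * indicator (cball (0::real^2) (r/2)) y \<partial>lborel)"
    by simp
  also have "\<dots> \<le> (\<integral>y. bump r y \<partial>lborel)"
  proof (rule integral_mono[OF _ integrable_bump[OF r]])
    show "integrable lborel (\<lambda>y. (3/4 * r\<^sup>2)\<^sup>2 * indicator (cball (0::real^2) (r/2)) y)"
      by (intro integrable_mult_right integrable_real_indicator emeasure_lborel_cball_finite) simp
    fix y :: "real^2"
    show "(3/4 * r\<^sup>2)\<^sup>2 * indicator (cball 0 (r/2)) y \<le> bump r y"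
    proof (cases "norm y \<le> r/2")
      case True
      then have "y \<bullet> y \<le> (r/2)\<^sup>2"
        by (simp add: dot_square_norm power_mono)
      then have "3/4 * r\<^sup>2 \<le> max 0 (r\<^sup>2 - y \<bullet> y)"
        by (simp add: power2_eq_square field_simps max_def)
      then show ?thesis
        using True by (simp add: bump_def power_mono)
    qed (simp add: bump_nonneg)
  qed
  finally show ?thesis .
qed

lemma bump_integral_pos: "0 < r \<Longrightarrow> 0 < (\<integral>y. bump r y \<partial>lborel)"
  using bump_integral_ge[of r] zero_less_power[of r 6] by linarith

lemma mollifier_nonneg: "0 \<le> mollifier r z"
  unfolding mollifier_def by (intro divide_nonneg_nonneg bump_nonneg Bochner_Integration.integral_nonneg) 

lemma mollifier_zero: "0 < r \<Longrightarrow> r \<le> norm z \<Longrightarrow> mollifier r z = 0"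
  by (simp add: mollifier_def bump_zero)

text \<open>
  The bound of order \<open>1 / r\<^sup>2\<close> on the kernel gives the scaling in the isoperimetric inequality.
\<close>

lemma mollifier_le:
  assumes r: "0 < r" shows "mollifier r z \<le> 3 / r\<^sup>2"
proof -
  have "0 \<le> max 0 (r\<^sup>2 - z \<bullet> z)" "max 0 (r\<^sup>2 - z \<bullet> z) \<le> r\<^sup>2" by auto
  then have "bump r z \<le> (r\<^sup>2)\<^sup>2"
    unfolding bump_def by (rule power_mono[rotated])
  then have "mollifier r z \<le> (r\<^sup>2)\<^sup>2 / (27/64 * r^6)"
    unfolding mollifier_def using bump_integral_ge[OF r] r
    by (intro frac_le) auto
  also have "\<dots> \<le> 3 / r\<^sup>2"
    using r by (simp add: field_simps power2_eq_square power_def numeral_eq_Suc)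
  finally show ?thesis .
qed

lemma continuous_mollifier: "continuous_on UNIV (mollifier r)"
  unfolding mollifier_def[abs_def] divide_inverse
  using continuous_bump by (intro continuous_intros)

lemma integrable_mollifier: "0 < r \<Longrightarrow> integrable lborel (mollifier r)"
  unfolding mollifier_def[abs_def] using integrable_bump by simp

lemma integral_mollifier: "0 < r \<Longrightarrow> (\<integral>z. mollifier r z \<partial>lborel) = 1"
  unfolding mollifier_def[abs_def] using bump_integral_pos[of r] by simp

lemma mollifier_minus_commute: "mollifier r (x - y) = mollifier r (y - x)"
  unfolding mollifier_def bump_def by (simp add: inner_diff inner_commute algebra_simps)

lemma mollifier_grad_minus_commute: "mollifier_grad r (x - y) = - mollifier_grad r (y - x)"
proof -
  have "(x - y) \<bullet> (x - y) = (y - x) \<bullet> (y - x)"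
    by (simp add: inner_diff inner_commute algebra_simps)
  then show ?thesis
    unfolding mollifier_grad_def by (simp add: algebra_simps)
qed

lemma mollifier_grad_zero: "0 < r \<Longrightarrow> r \<le> norm z \<Longrightarrow> mollifier_grad r z = 0"
  using sq_less_of_norm[of r z] by (simp add: mollifier_grad_def)

lemma continuous_mollifier_grad: "continuous_on UNIV (mollifier_grad r)"
  unfolding mollifier_grad_def[abs_def] divide_inverse by (intro continuous_intros)

lemma mollifier_bounded:
  assumes "0 < r" obtains B where "B > 0" "\<And>z. \<bar>mollifier r z\<bar> \<le> B"
  using mollifier_le[OF assms] mollifier_nonneg[of r] assms that[of "3 / r\<^sup>2"] by auto

lemma mollifier_grad_bounded:
  assumes "0 < r" obtains B where "B > 0" "\<And>z. norm (mollifier_grad r z) \<le> B"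
  by (rule continuous_compact_support_bounded[OF continuous_mollifier_grad[of r] compact_cball[of 0 r]])
    (use assms in \<open>auto intro!: mollifier_grad_zero\<close>)

lemma borel_measurable_mollifier[measurable]: "mollifier r \<in> borel_measurable borel"
  by (rule borel_measurable_continuous_onI[OF continuous_mollifier])

lemma borel_measurable_mollifier_grad[measurable]: "mollifier_grad r \<in> borel_measurable borel"
  by (rule borel_measurable_continuous_onI[OF continuous_mollifier_grad])

text \<open>
  The positive part squared is \<open>C\<^sup>1\<close> with Lipschitz derivative, so the first-order Taylor remainder
  of the kernel is uniformly quadratic; this makes differentiation under the convolution
  integral immediate.
\<close>

lemma pos_part_square_remainder:
  fixes a b :: real
  shows "\<bar>(max 0 b)\<^sup>2 - (max 0 a)\<^sup>2 - 2 * max 0 a * (b - a)\<bar> \<le> (b - a)\<^sup>2"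
proof -
  consider "a \<ge> 0" "b \<ge> 0" | "a \<ge> 0" "b < 0" | "a < 0" "b \<ge> 0" | "a < 0" "b < 0" by linarith
  then show ?thesis
  proof cases
    case 1
    then have "(max 0 b)\<^sup>2 - (max 0 a)\<^sup>2 - 2 * max 0 a * (b - a) = (b - a)\<^sup>2"
      by (simp add: power2_eq_square algebra_simps)
    then show ?thesis by simp
  next
    case 2
    then have "a * b \<le> 0" "0 \<le> b * b" "0 \<le> a * a" by (auto simp: mult_nonneg_nonpos)
    moreover have "0 \<le> a * (a - 2 * b)" using 2 by (intro mult_nonneg_nonneg) auto
    ultimately show ?thesis using 2 by (simp add: power2_eq_square algebra_simps abs_le_iff)
  next
    case 3
    then have "a * b \<le> 0" "0 \<le> a * a" by (auto simp: mult_nonpos_nonneg)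
    then show ?thesis using 3 by (simp add: power2_eq_square algebra_simps abs_le_iff)
  qed simp
qed

lemma mollifier_remainder:
  assumes r: "0 < r"
  obtains C where "C \<ge> 0" and
    "\<And>z h. norm h \<le> 1 \<Longrightarrow>
       \<bar>mollifier r (z + h) - mollifier r z - mollifier_grad r z \<bullet> h\<bar> \<le> C * (norm h)\<^sup>2"
proof -
  define c where "c = (\<integral>y. bump r y \<partial>lborel)"
  have c: "c > 0" unfolding c_def by (rule bump_integral_pos[OF r])
  define C where "C = ((2 * r + 3)\<^sup>2 + 2 * r\<^sup>2) / c"
  have C0: "C \<ge> 0" using c by (simp add: C_def)
  have "\<bar>mollifier r (z + h) - mollifier r z - mollifier_grad r z \<bullet> h\<bar> \<le> C * (norm h)\<^sup>2"
    if h: "norm h \<le> 1" for z h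
  proof (cases "norm z \<le> r + 1")
    case False
    then have "norm (z + h) \<ge> r" using h norm_triangle_ineq4[of "z + h" h] by simp
    then have "mollifier r (z + h) - mollifier r z - mollifier_grad r z \<bullet> h = 0"
      using False r by (simp add: mollifier_zero mollifier_grad_zero)
    then show ?thesis using C0 by simp
  next
    case True
    define a b where "a = r\<^sup>2 - z \<bullet> z" and "b = r\<^sup>2 - (z + h) \<bullet> (z + h)"
    have ba: "b - a = - 2 * (z \<bullet> h) - (norm h)\<^sup>2"
      by (simp add: a_def b_def inner_add inner_commute power2_norm_eq_inner)
    have "\<bar>z \<bullet> h\<bar> \<le> (r + 1) * norm h"
      using Cauchy_Schwarz_ineq2[of z h] mult_right_mono[OF True norm_ge_zero[of h]] by linarith
    moreover have "(norm h)\<^sup>2 \<le> norm h"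
      using h by (simp add: power2_eq_square mult_left_le)
    moreover have "\<bar>b - a\<bar> \<le> 2 * \<bar>z \<bullet> h\<bar> + (norm h)\<^sup>2"
      unfolding ba using abs_triangle_ineq4[of "- 2 * (z \<bullet> h)" "(norm h)\<^sup>2"] by (simp add: abs_mult)
    ultimately have "\<bar>b - a\<bar> \<le> (2 * r + 3) * norm h"
      by (simp add: algebra_simps)
    then have "(b - a)\<^sup>2 \<le> ((2 * r + 3) * norm h)\<^sup>2"
      using r by (intro abs_le_square_iff[THEN iffD1]) auto
    then have 1: "(b - a)\<^sup>2 \<le> (2 * r + 3)\<^sup>2 * (norm h)\<^sup>2"
      by (simp add: power_mult_distrib)
    have "max 0 a \<le> r\<^sup>2" "0 \<le> max 0 a" by (auto simp: a_def)
    then have 2: "2 * max 0 a * (norm h)\<^sup>2 \<le> 2 * r\<^sup>2 * (norm h)\<^sup>2"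
      by (intro mult_right_mono) auto
    let ?m = "max 0 a"
    have "mollifier r (z + h) - mollifier r z - mollifier_grad r z \<bullet> h =
        ((max 0 b)\<^sup>2 - ?m\<^sup>2 + 4 * ?m * (z \<bullet> h)) / c"
      unfolding mollifier_def mollifier_grad_def bump_def c_def[symmetric] a_def[symmetric] b_def[symmetric]
      by (simp add: diff_divide_distrib add_divide_distrib)
    also have "(max 0 b)\<^sup>2 - ?m\<^sup>2 + 4 * ?m * (z \<bullet> h) =
        ((max 0 b)\<^sup>2 - ?m\<^sup>2 - 2 * ?m * (b - a)) - 2 * ?m * (norm h)\<^sup>2"
      unfolding ba by (simp add: algebra_simps)
    finally have "\<bar>mollifier r (z + h) - mollifier r z - mollifier_grad r z \<bullet> h\<bar> =
        \<bar>((max 0 b)\<^sup>2 - ?m\<^sup>2 - 2 * ?m * (b - a)) - 2 * ?m * (norm h)\<^sup>2\<bar> / c"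
      using c by simp
    also have "\<dots> \<le> ((2 * r + 3)\<^sup>2 * (norm h)\<^sup>2 + 2 * r\<^sup>2 * (norm h)\<^sup>2) / c"
    proof (intro divide_right_mono)
      have "\<bar>2 * ?m * (norm h)\<^sup>2\<bar> \<le> 2 * r\<^sup>2 * (norm h)\<^sup>2"
        using 2 by simp
      then show "\<bar>((max 0 b)\<^sup>2 - ?m\<^sup>2 - 2 * ?m * (b - a)) - 2 * ?m * (norm h)\<^sup>2\<bar>
          \<le> (2 * r + 3)\<^sup>2 * (norm h)\<^sup>2 + 2 * r\<^sup>2 * (norm h)\<^sup>2"
        using pos_part_square_remainder[of b a] 1 by linarith
    qed (use c in simp)
    also have "\<dots> = C * (norm h)\<^sup>2" by (simp add: C_def algebra_simps)
    finally show ?thesis .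
  qed
  with C0 that show thesis by blast
qed

lemma continuous_on_convolution:
  fixes f :: "'a::euclidean_space \<Rightarrow> 'b::{banach, second_countable_topology}" and k :: "'a \<Rightarrow> real"
  assumes f: "integrable lborel f" and k: "continuous_on UNIV k" "\<And>z. \<bar>k z\<bar> \<le> B"
  shows "continuous_on UNIV (\<lambda>x. \<integral>y. k (x - y) *\<^sub>R f y \<partial>lborel)"
  unfolding continuous_on_sequentially comp_def
proof (intro allI ballI impI, elim conjE)
  fix x :: 'a and X :: "nat \<Rightarrow> 'a" assume X: "X \<longlonglongrightarrow> x"
  have [measurable]: "k \<in> borel_measurable borel" by (rule borel_measurable_continuous_onI[OF k(1)])
  show "(\<lambda>n. \<integral>y. k (X n - y) *\<^sub>R f y \<partial>lborel) \<longlonglongrightarrow> (\<integral>y. k (x - y) *\<^sub>R f y \<partial>lborel)"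
  proof (rule integral_dominated_convergence[where w = "\<lambda>y. B * norm (f y)"])
    show "AE y in lborel. (\<lambda>n. k (X n - y) *\<^sub>R f y) \<longlonglongrightarrow> k (x - y) *\<^sub>R f y"
      using k(1) X by (intro AE_I2 tendsto_scaleR tendsto_const
          isCont_tendsto_compose[of _ k] tendsto_diff) (auto simp: continuous_on_eq_continuous_at)
    show "AE y in lborel. norm (k (X n - y) *\<^sub>R f y) \<le> B * norm (f y)" for n
      using k(2) by (auto intro!: mult_right_mono)
  qed (use f in auto)
qed

lemma integrable_convolution:
  fixes f :: "'a::euclidean_space \<Rightarrow> 'b::{banach, second_countable_topology}" and k :: "'a \<Rightarrow> real"
  assumes f: "integrable lborel f" and [measurable]: "k \<in> borel_measurable borel" and k: "\<And>z. \<bar>k z\<bar> \<le> B"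
  shows "integrable lborel (\<lambda>y. k (x - y) *\<^sub>R f y)"
proof (rule Bochner_Integration.integrable_bound)
  show "integrable lborel (\<lambda>y. B *\<^sub>R f y)" using f by simp
  show "AE y in lborel. norm (k (x - y) *\<^sub>R f y) \<le> norm (B *\<^sub>R f y)"
  proof (intro AE_I2)
    fix y show "norm (k (x - y) *\<^sub>R f y) \<le> norm (B *\<^sub>R f y)"
      using k[of "x - y"] by (auto intro!: mult_right_mono)
  qed
qed (use f in measurable)

lemma mollifier_grad_inner_bounded:
  assumes "0 < r" obtains B where "\<And>z. \<bar>mollifier_grad r z \<bullet> h\<bar> \<le> B"
proof -
  obtain B where B: "B > 0" "\<And>z. norm (mollifier_grad r z) \<le> B"
    using mollifier_grad_bounded[OF assms] by blast
  have "\<bar>mollifier_grad r z \<bullet> h\<bar> \<le> B * norm h" for z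
    using Cauchy_Schwarz_ineq2[of "mollifier_grad r z" h]
      mult_right_mono[OF B(2)[of z] norm_ge_zero[of h]] by linarith
  with that show thesis by blast
qed

lemma integrable_mollify:
  fixes f :: "real^2 \<Rightarrow> 'b::{banach, second_countable_topology}"
  assumes "0 < r" "integrable lborel f"
  shows "integrable lborel (\<lambda>y. mollifier r (x - y) *\<^sub>R f y)"
proof -
  obtain B where "B > 0" "\<And>z. \<bar>mollifier r z\<bar> \<le> B" using mollifier_bounded[OF assms(1)] by blast
  then show ?thesis by (intro integrable_convolution[OF assms(2) borel_measurable_mollifier])
qed

lemma integrable_mollify_grad:
  fixes f :: "real^2 \<Rightarrow> 'b::{banach, second_countable_topology}"
  assumes "0 < r" "integrable lborel f"
  shows "integrable lborel (\<lambda>y. (mollifier_grad r (x - y) \<bullet> h) *\<^sub>R f y)"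
proof -
  obtain B where "\<And>z. \<bar>mollifier_grad r z \<bullet> h\<bar> \<le> B" using mollifier_grad_inner_bounded[OF assms(1)] by blast
  then show ?thesis
    by (intro integrable_convolution[where k = "\<lambda>z. mollifier_grad r z \<bullet> h", OF assms(2)]) auto
qed

lemma continuous_mollify:
  fixes f :: "real^2 \<Rightarrow> 'b::{banach, second_countable_topology}"
  assumes "0 < r" "integrable lborel f"
  shows "continuous_on UNIV (mollify r f)"
proof -
  obtain B where "B > 0" "\<And>z. \<bar>mollifier r z\<bar> \<le> B" using mollifier_bounded[OF assms(1)] by blast
  then show ?thesis
    unfolding mollify_def[abs_def]
    using continuous_on_convolution[OF assms(2) continuous_mollifier] by auto
qed

lemma continuous_mollify_derivative:
  fixes f :: "real^2 \<Rightarrow> 'b::{banach, second_countable_topology}"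
  assumes "0 < r" "integrable lborel f"
  shows "continuous_on UNIV (\<lambda>x. \<integral>y. (mollifier_grad r (x - y) \<bullet> h) *\<^sub>R f y \<partial>lborel)"
proof -
  obtain B where B: "\<And>z. \<bar>mollifier_grad r z \<bullet> h\<bar> \<le> B" using mollifier_grad_inner_bounded[OF assms(1)] by blast
  have "continuous_on UNIV (\<lambda>z. mollifier_grad r z \<bullet> h)"
    by (intro continuous_intros continuous_mollifier_grad)
  then show ?thesis
    using B by (rule continuous_on_convolution[OF assms(2)])
qed

lemma mollify_has_derivative:
  fixes f :: "real^2 \<Rightarrow> 'b::{banach, second_countable_topology}"
  assumes r: "0 < r" and f: "integrable lborel f"
  shows "(mollify r f has_derivative (\<lambda>h. \<integral>y. (mollifier_grad r (x - y) \<bullet> h) *\<^sub>R f y \<partial>lborel)) (at x)"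
proof -
  let ?D = "\<lambda>h. \<integral>y. (mollifier_grad r (x - y) \<bullet> h) *\<^sub>R f y \<partial>lborel"
  obtain C where C: "C \<ge> 0" "\<And>z h. norm h \<le> 1 \<Longrightarrow>
       \<bar>mollifier r (z + h) - mollifier r z - mollifier_grad r z \<bullet> h\<bar> \<le> C * (norm h)\<^sup>2"
    using mollifier_remainder[OF r] by blast
  obtain B where B: "B > 0" "\<And>z. norm (mollifier_grad r z) \<le> B"
    using mollifier_grad_bounded[OF r] by blast
  have [measurable]: "f \<in> borel_measurable borel" using f by auto
  define N where "N = (\<integral>y. norm (f y) \<partial>lborel)"
  have ig: "integrable lborel (\<lambda>y. (mollifier_grad r (x - y) \<bullet> h) *\<^sub>R f y)" for h
    by (rule integrable_mollify_grad[OF r f])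
  show ?thesis
  proof (rule has_derivativeI_sandwich[of 1 _ _ _ _ "\<lambda>y. C * N * norm (y - x)"])
    show "bounded_linear ?D"
    proof (rule bounded_linear_intro[where K = "B * N"])
      show "?D (h + k) = ?D h + ?D k" for h k
        using ig by (simp add: inner_add_right scaleR_add_left)
      show "?D (c *\<^sub>R h) = c *\<^sub>R ?D h" for c h
        by (simp flip: integral_scaleR_right add: mult.commute)
      show "norm (?D h) \<le> norm h * (B * N)" for h
      proof -
        have "norm (?D h) \<le> (\<integral>y. norm ((mollifier_grad r (x - y) \<bullet> h) *\<^sub>R f y) \<partial>lborel)"
          by (rule integral_norm_bound)
        also have "\<dots> \<le> (\<integral>y. (norm h * B) * norm (f y) \<partial>lborel)"
        proof (rule integral_mono)
          fix y
          have "\<bar>mollifier_grad r (x - y) \<bullet> h\<bar> \<le> norm h * B"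
            using Cauchy_Schwarz_ineq2[of "mollifier_grad r (x - y)" h]
              mult_right_mono[OF B(2)[of "x - y"] norm_ge_zero[of h]] by (simp add: mult.commute)
          then show "norm ((mollifier_grad r (x - y) \<bullet> h) *\<^sub>R f y) \<le> (norm h * B) * norm (f y)"
            by (simp add: mult_right_mono)
        qed (use ig[THEN integrable_norm] f in auto)
        also have "\<dots> = norm h * (B * N)" by (simp add: N_def)
        finally show ?thesis .
      qed
    qed
  next
    fix y :: "real^2" assume "y \<noteq> x" "dist y x < 1"
    define h where "h = y - x"
    have h: "norm h \<le> 1" "norm h > 0" using \<open>y \<noteq> x\<close> \<open>dist y x < 1\<close> by (auto simp: h_def dist_norm)
    have eq1: "mollify r f y - mollify r f x - ?D h =
        (\<integral>w. (mollifier r ((x - w) + h) - mollifier r (x - w) - mollifier_grad r (x - w) \<bullet> h) *\<^sub>R f w \<partial>lborel)"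
    proof -
      have eq: "x - w + h = y - w" for w by (simp add: h_def)
      show ?thesis
        unfolding mollify_def eq using integrable_mollify[OF r f] ig by (simp add: scaleR_diff_left)
    qed
    have "norm (mollify r f y - mollify r f x - ?D h) \<le> (\<integral>w. norm ((mollifier r ((x - w) + h) - mollifier r (x - w) - mollifier_grad r (x - w) \<bullet> h) *\<^sub>R f w) \<partial>lborel)"
      unfolding eq1 by (rule integral_norm_bound)
    also have "\<dots> \<le> (\<integral>w. (C * (norm h)\<^sup>2) * norm (f w) \<partial>lborel)"
    proof (rule Bochner_Integration.integral_mono')
      show "norm ((mollifier r ((x - w) + h) - mollifier r (x - w) - mollifier_grad r (x - w) \<bullet> h) *\<^sub>R f w)
          \<le> (C * (norm h)\<^sup>2) * norm (f w)" for w
        using C(2)[OF h(1), of "x - w"] by (auto intro!: mult_right_mono)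
    qed (use f C(1) in auto)
    also have "\<dots> = C * N * (norm h)\<^sup>2" by (simp add: N_def)
    finally show "norm (mollify r f y - mollify r f x - ?D (y - x)) / norm (y - x) \<le> C * N * norm (y - x)"
      using h(2) by (simp add: h_def[symmetric] divide_le_eq power2_eq_square mult.assoc)
  next
    have "((\<lambda>y. C * N * norm (y - x)) \<longlongrightarrow> C * N * norm (x - x)) (at x)"
      by (intro tendsto_intros)
    then show "((\<lambda>y. C * N * norm (y - x)) \<longlongrightarrow> 0) (at x)" by simp
  qed simp
qed

lemma mollify_grad_inner:
  assumes r: "0 < r" and f: "integrable lborel f"
  shows "integrable lborel (\<lambda>y. f y *\<^sub>R mollifier_grad r (x - y))"
    and "mollify_grad r f x \<bullet> h = (\<integral>y. f y * (mollifier_grad r (x - y) \<bullet> h) \<partial>lborel)"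
proof -
  obtain B where B: "B > 0" "\<And>z. norm (mollifier_grad r z) \<le> B"
    using mollifier_grad_bounded[OF r] by blast
  have [measurable]: "f \<in> borel_measurable borel" using f by auto
  show *: "integrable lborel (\<lambda>y. f y *\<^sub>R mollifier_grad r (x - y))"
  proof (rule Bochner_Integration.integrable_bound)
    show "integrable lborel (\<lambda>y. B * f y)" using f by simp
    show "AE y in lborel. norm (f y *\<^sub>R mollifier_grad r (x - y)) \<le> norm (B * f y)"
      using B by (intro AE_I2) (simp add: abs_mult mult.commute[of "\<bar>f _\<bar>"] mult_right_mono)
  qed measurable
  show "mollify_grad r f x \<bullet> h = (\<integral>y. f y * (mollifier_grad r (x - y) \<bullet> h) \<partial>lborel)"
    unfolding mollify_grad_def
    by (cases "h = 0") (simp_all add: integral_inner_left[OF *, symmetric])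
qed

lemma mollify_has_grad:
  assumes "0 < r" "integrable lborel f"
  shows "(mollify r f has_derivative (\<lambda>h. mollify_grad r f x \<bullet> h)) (at x)"
  using mollify_has_derivative[OF assms, of x]
  by (simp add: mollify_grad_inner[OF assms] mult.commute)

lemma continuous_mollify_grad:
  assumes "0 < r" "integrable lborel f"
  shows "continuous_on UNIV (mollify_grad r f)"
proof -
  have "continuous_on UNIV (\<lambda>x. \<Sum>i\<in>Basis. (mollify_grad r f x \<bullet> i) *\<^sub>R i)"
    unfolding mollify_grad_inner[OF assms] using continuous_mollify_derivative[OF assms]
    by (intro continuous_intros) (simp add: mult.commute)
  then show ?thesis by (simp add: euclidean_representation)
qed

lemma mollify_zero:
  fixes f :: "real^2 \<Rightarrow> 'b::{banach, second_countable_topology}"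
  assumes "0 < r" "\<And>y. y \<in> ball x r \<Longrightarrow> f y = 0"
  shows "mollify r f x = 0"
proof -
  have "mollifier r (x - y) *\<^sub>R f y = 0" for y
    using assms mollifier_zero[of r "x - y"] by (cases "y \<in> ball x r") (auto simp: dist_norm)
  then show ?thesis unfolding mollify_def by (simp del: scaleR_eq_0_iff)
qed

lemma mollify_grad_zero:
  assumes "0 < r" "\<And>y. y \<in> ball x r \<Longrightarrow> f y = 0"
  shows "mollify_grad r f x = 0"
proof -
  have "f y *\<^sub>R mollifier_grad r (x - y) = 0" for y
    using assms mollifier_grad_zero[of r "x - y"] by (cases "y \<in> ball x r") (auto simp: dist_norm)
  then show ?thesis unfolding mollify_grad_def by (simp del: scaleR_eq_0_iff)
qed

lemma ball_far:
  fixes x y :: "'a::real_normed_vector"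
  assumes "norm x > R + r" "y \<in> ball x r"
  shows "norm y > R"
  using assms norm_triangle_ineq[of y "x - y"] by (simp add: dist_norm)

lemma mollify_zero_far:
  fixes f :: "real^2 \<Rightarrow> 'b::{banach, second_countable_topology}"
  assumes "0 < r" "\<And>y. norm y > R \<Longrightarrow> f y = 0" "norm x > R + r"
  shows "mollify r f x = 0"
  using assms ball_far by (intro mollify_zero) blast+

lemma mollify_grad_zero_far:
  assumes "0 < r" "\<And>y. norm y > R \<Longrightarrow> f y = 0" "norm x > R + r"
  shows "mollify_grad r f x = 0"
  using assms ball_far by (intro mollify_grad_zero) blast+

lemma integral_mollifier_shift:
  assumes "0 < r"
  shows "(\<integral>y. mollifier r (x - y) \<partial>lborel) = 1" "integrable lborel (\<lambda>y. mollifier r (x - y))"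
  using integral_lborel_reflect[of "mollifier r" x] integral_mollifier[OF assms]
    integrable_lborel_reflect[OF integrable_mollifier[OF assms], of x] by auto

lemma norm_mollify_le:
  fixes f :: "real^2 \<Rightarrow> 'b::{banach, second_countable_topology}"
  assumes r: "0 < r" and f: "integrable lborel f" and b: "\<And>y. norm (f y) \<le> b"
  shows "norm (mollify r f x) \<le> b"
proof -
  have "norm (mollify r f x) \<le> (\<integral>y. norm (mollifier r (x - y) *\<^sub>R f y) \<partial>lborel)"
    unfolding mollify_def by (rule integral_norm_bound)
  also have "\<dots> \<le> (\<integral>y. b * mollifier r (x - y) \<partial>lborel)"
    using integrable_mollify[OF r f, of x, THEN integrable_norm] integral_mollifier_shift[OF r, of x] b
    by (intro integral_mono) (auto simp: mollifier_nonneg mult.commute intro!: mult_right_mono)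
  also have "\<dots> = b" using integral_mollifier_shift[OF r, of x] by simp
  finally show ?thesis .
qed

text \<open>
  Mollifying a bounded vector field gives an admissible test field, whose divergence is the
  convolution with the gradient of the kernel.
\<close>

lemma mollify_test_field:
  fixes n :: "real^2 \<Rightarrow> real^2"
  assumes r: "0 < r" and n: "integrable lborel n" and n0: "\<And>y. norm y > R \<Longrightarrow> n y = 0"
  shows "mollify r n \<in> test_fields UNIV"
    and "divergence (mollify r n) x = (\<integral>y. mollifier_grad r (x - y) \<bullet> n y \<partial>lborel)"
proof -
  show "mollify r n \<in> test_fields UNIV"
    by (rule test_fieldsI[OF mollify_has_derivative[OF r n] continuous_mollify_derivative[OF r n]
        compact_cball[of 0 "R + r"]]) (auto intro!: mollify_zero_far[OF r n0])
  have i: "integrable lborel (\<lambda>y. (mollifier_grad r (x - y) \<bullet> h) *\<^sub>R n y)" for h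
    by (rule integrable_mollify_grad[OF r n])
  have i': "integrable lborel (\<lambda>y. (mollifier_grad r (x - y) $ k) * (n y $ k))" for k
    using integrable_bounded_linear[OF bounded_linear_vec_nth[of k] i[of "axis k 1"]]
    by (simp add: inner_axis)
  have "divergence (mollify r n) x =
      (\<Sum>k\<in>UNIV. (\<integral>y. (mollifier_grad r (x - y) \<bullet> axis k 1) *\<^sub>R n y \<partial>lborel) $ k)"
    by (rule divergence_eq[OF mollify_has_derivative[OF r n]])
  also have "\<dots> = (\<Sum>k\<in>UNIV. \<integral>y. (mollifier_grad r (x - y) $ k) * (n y $ k) \<partial>lborel)"
    by (subst integral_bounded_linear[OF bounded_linear_vec_nth i, symmetric]) (simp add: inner_axis)
  also have "\<dots> = (\<integral>y. mollifier_grad r (x - y) \<bullet> n y \<partial>lborel)"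
    using i' by (subst Bochner_Integration.integral_sum[symmetric]) (auto simp: inner_vec_def)
  finally show "divergence (mollify r n) x = (\<integral>y. mollifier_grad r (x - y) \<bullet> n y \<partial>lborel)" .
qed

section \<open>Translation and mollification estimates in terms of the total variation\<close>

lemma TV_leI:
  assumes "\<And>\<phi>. \<phi> \<in> test_fields UNIV \<Longrightarrow> (\<And>x. norm (\<phi> x) \<le> 1) \<Longrightarrow> dist_grad v \<phi> \<le> T"
  shows "TV v \<le> ereal T"
  unfolding TV_def by (rule SUP_least) (use assms in auto)

lemma TV_leD:
  assumes "TV v \<le> ereal T" "\<phi> \<in> test_fields UNIV" "\<And>x. norm (\<phi> x) \<le> 1"
  shows "dist_grad v \<phi> \<le> T"
proof -
  have "ereal (dist_grad v \<phi>) \<le> TV v"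
    unfolding TV_def by (rule SUP_upper) (use assms in auto)
  then show ?thesis using assms(1) by (metis ereal_less_eq(3) order_trans)
qed

lemma TV_nonneg: "0 \<le> TV v"
proof -
  have "((\<lambda>x. 0) :: real^2 \<Rightarrow> real^2) \<in> test_fields UNIV"
    by (rule test_fieldsI[of _ "\<lambda>_ _. 0" "{}"]) auto
  then have "ereal (dist_grad v (\<lambda>x. 0)) \<le> TV v"
    unfolding TV_def by (intro SUP_upper) auto
  moreover have "dist_grad v (\<lambda>x. 0) = 0"
    by (simp add: dist_grad_def divergence_def frechet_derivative_const)
  ultimately show ?thesis by (simp add: zero_ereal_def)
qed

lemma TV_bound_nonneg: "TV v \<le> ereal T \<Longrightarrow> 0 \<le> T"
  using TV_nonneg[of v] by (metis ereal_less_eq(5) order_trans)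

lemma integrable_pair_product_bound:
  fixes F :: "'a::euclidean_space \<times> 'b::euclidean_space \<Rightarrow> 'c::{banach, second_countable_topology}"
  assumes F[measurable]: "F \<in> borel_measurable (lborel \<Otimes>\<^sub>M lborel)"
    and a: "integrable lborel a" and b: "integrable lborel b"
    and le: "\<And>x y. norm (F (x, y)) \<le> a x * b y"
  shows "integrable (lborel \<Otimes>\<^sub>M lborel) F"
proof -
  have [measurable]: "a \<in> borel_measurable borel" "b \<in> borel_measurable borel" using a b by auto
  have "integrable (lborel \<Otimes>\<^sub>M lborel) (\<lambda>(x, y). a x * b y)"
  proof (rule lborel_pair.Fubini_integrable)
    show "integrable lborel (\<lambda>x. \<integral>y. norm (case (x, y) of (x, y) \<Rightarrow> a x * b y) \<partial>lborel)"
      using a b by (simp add: abs_mult)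
    show "AE x in lborel. integrable lborel (\<lambda>y. case (x, y) of (x, y) \<Rightarrow> a x * b y)"
      using b by simp
  qed measurable
  then show ?thesis
  proof (rule Bochner_Integration.integrable_bound)
    have "norm (F p) \<le> norm (case p of (x, y) \<Rightarrow> a x * b y)" for p
      using le[of "fst p" "snd p"] abs_ge_self[of "a (fst p) * b (snd p)"]
      by (auto simp: case_prod_beta intro: order_trans)
    then show "AE p in lborel \<Otimes>\<^sub>M lborel. norm (F p) \<le> norm (case p of (x, y) \<Rightarrow> a x * b y)"
      by simp
  qed measurable
qed

lemma mollify_grad_integrable:
  assumes r: "0 < r" and v: "integrable lborel v" and v0: "\<And>y. norm y > R \<Longrightarrow> v y = 0"
  shows "integrable lborel (mollify_grad r v)"
  by (rule continuous_compact_support_integrable[OF continuous_mollify_grad[OF r v] compact_cball[of 0 "R + r"]])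
    (auto intro!: mollify_grad_zero_far[OF r v0])

text \<open>
  Testing \<open>v\<close> against the mollified direction field of \<open>\<nabla>(v * \<rho>\<^sub>r)\<close> shows that mollification does
  not increase the total variation.
\<close>

lemma integral_norm_mollify_grad_le:
  assumes r: "0 < r" and v: "integrable lborel v" and v0: "\<And>y. norm y > R \<Longrightarrow> v y = 0"
    and T: "TV v \<le> ereal T"
  shows "(\<integral>x. norm (mollify_grad r v x) \<partial>lborel) \<le> T"
proof -
  let ?G = "mollify_grad r v"
  let ?K = "cball (0::real^2) (R + r)"
  \<comment> \<open>The optimal direction field; it is merely measurable, and is smoothed before it is used.\<close>
  define n where "n x = sgn (?G x)" for x
  have [measurable]: "v \<in> borel_measurable borel" using v by auto
  have [measurable]: "?G \<in> borel_measurable borel"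
    by (rule borel_measurable_continuous_onI[OF continuous_mollify_grad[OF r v]])
  have [measurable]: "n \<in> borel_measurable borel"
    unfolding n_def[abs_def] sgn_div_norm[abs_def] by measurable
  have n1: "norm (n x) \<le> 1" for x by (simp add: n_def norm_sgn)
  have n0: "n y = 0" if "norm y > R + r" for y
    using mollify_grad_zero_far[OF r v0 that] by (simp add: n_def)
  have ik: "integrable lborel (\<lambda>x. indicator ?K x :: real)"
    by (intro integrable_real_indicator emeasure_lborel_cball_finite) simp
  have nle: "norm (n x) \<le> indicator ?K x" for x
    using n1[of x] n0[of x] by (auto simp: indicator_def)
  have n: "integrable lborel n"
    by (rule Bochner_Integration.integrable_bound[OF ik]) (use nle in auto)
  have tf: "mollify r n \<in> test_fields UNIV"
    by (rule mollify_test_field(1)[OF r n n0])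
  obtain B where B: "B > 0" "\<And>z. norm (mollifier_grad r z) \<le> B"
    using mollifier_grad_bounded[OF r] by blast
  have intF: "integrable (lborel \<Otimes>\<^sub>M lborel) (\<lambda>(x, y). v y * (mollifier_grad r (x - y) \<bullet> n x))"
  proof (rule integrable_pair_product_bound[where a = "\<lambda>x. B * indicator ?K x" and b = "\<lambda>y. norm (v y)"])
    fix x y :: "real^2"
    have "\<bar>mollifier_grad r (x - y) \<bullet> n x\<bar> \<le> B * indicator ?K x"
      using Cauchy_Schwarz_ineq2[of "mollifier_grad r (x - y)" "n x"]
        mult_mono[OF B(2)[of "x - y"] nle[of x]] B(1) by simp
    then show "norm (case (x, y) of (x, y) \<Rightarrow> v y * (mollifier_grad r (x - y) \<bullet> n x))
        \<le> B * indicator ?K x * norm (v y)"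
      by (simp add: abs_mult mult.commute[of "\<bar>v y\<bar>"] mult_right_mono)
  qed (use v ik in auto)
  have "dist_grad v (mollify r n) = - (\<integral>y. v y * (\<integral>x. mollifier_grad r (y - x) \<bullet> n x \<partial>lborel) \<partial>lborel)"
    using dist_grad_lborel[OF _ tf, of v] mollify_test_field(2)[OF r n n0] by simp
  also have "\<dots> = (\<integral>y. (\<integral>x. v y * (mollifier_grad r (x - y) \<bullet> n x) \<partial>lborel) \<partial>lborel)"
    by (subst mollifier_grad_minus_commute) simp
  also have "\<dots> = (\<integral>x. (\<integral>y. v y * (mollifier_grad r (x - y) \<bullet> n x) \<partial>lborel) \<partial>lborel)"
    by (rule lborel_pair.Fubini_integral[OF intF])
  also have "\<dots> = (\<integral>x. ?G x \<bullet> n x \<partial>lborel)"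
    by (simp add: mollify_grad_inner[OF r v])
  also have "\<dots> = (\<integral>x. norm (?G x) \<partial>lborel)"
  proof (rule Bochner_Integration.integral_cong[OF refl])
    show "?G x \<bullet> n x = norm (?G x)" for x
      by (cases "?G x = 0") (simp_all add: n_def sgn_div_norm power2_norm_eq_inner[symmetric] power2_eq_square)
  qed
  finally show ?thesis
    using TV_leD[OF T tf] norm_mollify_le[OF r n n1] by simp
qed

text \<open>
  The fundamental theorem of calculus along the segment from \<open>x\<close> to \<open>h + x\<close>, integrated over \<open>x\<close>.
\<close>

lemma nn_integral_translate_diff_le:
  fixes u :: "'a::euclidean_space \<Rightarrow> real" and G :: "'a \<Rightarrow> 'a"
  assumes u: "\<And>x. (u has_derivative (\<lambda>h. G x \<bullet> h)) (at x)" and G: "continuous_on UNIV G"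
  shows "(\<integral>\<^sup>+x. ennreal \<bar>u (h + x) - u x\<bar> \<partial>lborel) \<le> ennreal (norm h) * (\<integral>\<^sup>+x. ennreal (norm (G x)) \<partial>lborel)"
proof -
  have [measurable]: "G \<in> borel_measurable borel" by (rule borel_measurable_continuous_onI[OF G])
  have *: "ennreal \<bar>u (h + x) - u x\<bar> \<le>
      (\<integral>\<^sup>+s. indicator {0..1} s * (ennreal (norm h) * ennreal (norm (G (s *\<^sub>R h + x)))) \<partial>lborel)" for x
  proof -
    have d: "((\<lambda>s. u (s *\<^sub>R h + x)) has_vector_derivative G (s *\<^sub>R h + x) \<bullet> h) (at s within {0..1})" for s
    proof -
      have "((\<lambda>s. u (s *\<^sub>R h + x)) has_derivative (\<lambda>t. G (s *\<^sub>R h + x) \<bullet> (t *\<^sub>R h))) (at s within {0..1})"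
        by (rule has_derivative_compose[of "\<lambda>s. s *\<^sub>R h + x" _ s "{0..1}" u, simplified])
          (auto intro!: derivative_eq_intros u)
      then show ?thesis by (simp add: has_vector_derivative_def)
    qed
    have "continuous_on UNIV (\<lambda>s. G (s *\<^sub>R h + x))"
      by (rule continuous_on_compose2[OF G]) (auto intro!: continuous_intros)
    then have c: "continuous_on {0..1} (\<lambda>s. G (s *\<^sub>R h + x) \<bullet> h)"
      by (intro continuous_intros) (auto intro: continuous_on_subset)
    have "u (h + x) - u x = (\<integral>s. indicator {0..1} s *\<^sub>R (G (s *\<^sub>R h + x) \<bullet> h) \<partial>lborel)"
      using integral_FTC_atLeastAtMost[OF zero_le_one d c] by simp
    also have "ennreal \<bar>\<dots>\<bar> \<le> (\<integral>\<^sup>+s. norm (indicator {0..1} s *\<^sub>R (G (s *\<^sub>R h + x) \<bullet> h)) \<partial>lborel)"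
      using integral_norm_bound_ennreal[OF borel_integrable_atLeastAtMost'[OF c, unfolded set_integrable_def]]
      by simp
    also have "\<dots> \<le> (\<integral>\<^sup>+s. indicator {0..1} s * (ennreal (norm h) * ennreal (norm (G (s *\<^sub>R h + x)))) \<partial>lborel)"
    proof (rule nn_integral_mono)
      fix s :: real
      have "\<bar>G (s *\<^sub>R h + x) \<bullet> h\<bar> \<le> norm h * norm (G (s *\<^sub>R h + x))"
        using Cauchy_Schwarz_ineq2 by (metis mult.commute)
      then show "ennreal (norm (indicator {0..1} s *\<^sub>R (G (s *\<^sub>R h + x) \<bullet> h)))
          \<le> indicator {0..1} s * (ennreal (norm h) * ennreal (norm (G (s *\<^sub>R h + x))))"
        by (auto simp: indicator_def simp flip: ennreal_mult intro!: ennreal_leI)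
    qed
    finally show ?thesis .
  qed
  have "(\<integral>\<^sup>+x. ennreal \<bar>u (h + x) - u x\<bar> \<partial>lborel) \<le>
      (\<integral>\<^sup>+x. (\<integral>\<^sup>+s. indicator {0..1} s * (ennreal (norm h) * ennreal (norm (G (s *\<^sub>R h + x)))) \<partial>lborel) \<partial>lborel)"
    by (intro nn_integral_mono *)
  also have "\<dots> = (\<integral>\<^sup>+s. (\<integral>\<^sup>+x. indicator {0..1} s * (ennreal (norm h) * ennreal (norm (G (s *\<^sub>R h + x)))) \<partial>lborel) \<partial>lborel)"
    by (rule lborel_pair.Fubini'[symmetric]) measurable
  also have "\<dots> = (\<integral>\<^sup>+s. indicator {0..1::real} s * (ennreal (norm h) * (\<integral>\<^sup>+x. ennreal (norm (G x)) \<partial>lborel)) \<partial>lborel)"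
    by (simp add: nn_integral_cmult nn_integral_lborel_shift[of "\<lambda>x. ennreal (norm (G x))"])
  also have "\<dots> = ennreal (norm h) * (\<integral>\<^sup>+x. ennreal (norm (G x)) \<partial>lborel)"
    by (simp add: nn_integral_multc)
  finally show ?thesis .
qed

lemma integrable_mollify_pair:
  assumes r: "0 < r" and v: "integrable lborel v"
    and [measurable]: "\<psi> \<in> borel_measurable borel" and b: "\<And>x. \<bar>\<psi> x\<bar> \<le> b"
  shows "integrable (lborel \<Otimes>\<^sub>M lborel) (\<lambda>(y, x). mollifier r (x - y) * v y * \<psi> x)"
proof (rule lborel_pair.Fubini_integrable)
  have [measurable]: "v \<in> borel_measurable borel" using v by auto
  have i: "integrable lborel (\<lambda>x. mollifier r (x - y) * \<psi> x)" for y
  proof (rule Bochner_Integration.integrable_bound[where f = "\<lambda>x. b * mollifier r (y - x)"])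
    show "integrable lborel (\<lambda>x. b * mollifier r (y - x))"
      using integral_mollifier_shift[OF r] by simp
    have "norm (mollifier r (x - y) * \<psi> x) \<le> norm (b * mollifier r (y - x))" for x
      using mult_right_mono[OF order_trans[OF b[of x] abs_ge_self], of "\<bar>mollifier r (y - x)\<bar>"]
      by (simp add: abs_mult mollifier_minus_commute[of r x y] mult.commute)
    then show "AE x in lborel. norm (mollifier r (x - y) * \<psi> x) \<le> norm (b * mollifier r (y - x))"
      by simp
  qed measurable
  have le: "(\<integral>x. \<bar>mollifier r (x - y) * \<psi> x\<bar> \<partial>lborel) \<le> b" for y
  proof -
    have "(\<integral>x. \<bar>mollifier r (x - y) * \<psi> x\<bar> \<partial>lborel) \<le> (\<integral>x. b * mollifier r (y - x) \<partial>lborel)"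
    proof (rule integral_mono)
      show "\<bar>mollifier r (x - y) * \<psi> x\<bar> \<le> b * mollifier r (y - x)" for x
        using b[of x] mollifier_nonneg[of r "y - x"]
        by (simp add: abs_mult mollifier_minus_commute[of r x y] mult.commute[of _ "mollifier r _"] mult_left_mono)
    qed (use i integral_mollifier_shift[OF r] in auto)
    also have "\<dots> = b" using integral_mollifier_shift[OF r, of y] by simp
    finally show ?thesis .
  qed
  have eq: "(\<integral>x. norm (case (y, x) of (y, x) \<Rightarrow> mollifier r (x - y) * v y * \<psi> x) \<partial>lborel)
      = \<bar>v y\<bar> * (\<integral>x. \<bar>mollifier r (x - y) * \<psi> x\<bar> \<partial>lborel)" for y
    by (simp add: abs_mult mult.assoc mult.left_commute[of _ "\<bar>v y\<bar>"])
  show "integrable lborel (\<lambda>y. \<integral>x. norm (case (y, x) of (y, x) \<Rightarrow> mollifier r (x - y) * v y * \<psi> x) \<partial>lborel)"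
    unfolding eq
  proof (rule Bochner_Integration.integrable_bound[where f = "\<lambda>y. b * v y"])
    have "norm (\<bar>v y\<bar> * (\<integral>x. \<bar>mollifier r (x - y) * \<psi> x\<bar> \<partial>lborel)) \<le> norm (b * v y)" for y
      using mult_left_mono[OF le[of y] abs_ge_zero[of "v y"]] b[of 0] abs_ge_zero[of "\<psi> 0"]
      by (simp add: abs_mult mult.commute)
    then show "AE y in lborel. norm (\<bar>v y\<bar> * (\<integral>x. \<bar>mollifier r (x - y) * \<psi> x\<bar> \<partial>lborel)) \<le> norm (b * v y)"
      by simp
  qed (use v in auto)
  have "integrable lborel (\<lambda>x. v y * (mollifier r (x - y) * \<psi> x))" for y
    using i by simp
  then show "AE y in lborel. integrable lborel (\<lambda>x. case (y, x) of (y, x) \<Rightarrow> mollifier r (x - y) * v y * \<psi> x)"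
    by (simp add: mult_ac)
qed (use v in measurable)

text \<open>
  Fubini moves the mollification from \<open>v\<close> to the function it is paired with.
\<close>

lemma integral_mollify_mult:
  assumes r: "0 < r" and v: "integrable lborel v"
    and \<psi>: "\<psi> \<in> borel_measurable borel" "\<And>x. \<bar>\<psi> x\<bar> \<le> b"
  shows "integrable lborel (\<lambda>x. mollify r v x * \<psi> x)"
    and "(\<integral>x. mollify r v x * \<psi> x \<partial>lborel) = (\<integral>y. v y * (\<integral>x. mollifier r (x - y) * \<psi> x \<partial>lborel) \<partial>lborel)"
proof -
  note i = integrable_mollify_pair[OF r v \<psi>]
  have eq: "mollify r v x * \<psi> x = (\<integral>y. mollifier r (x - y) * v y * \<psi> x \<partial>lborel)" for x
    by (simp add: mollify_def)
  have "integrable (lborel \<Otimes>\<^sub>M lborel) (\<lambda>(x, y). mollifier r (x - y) * v y * \<psi> x)"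
    using lborel_pair.integrable_product_swap[OF i] by (simp add: case_prod_beta)
  from lborel_pair.integrable_fst'[OF this] show "integrable lborel (\<lambda>x. mollify r v x * \<psi> x)"
    unfolding eq by simp
  have "(\<integral>x. mollify r v x * \<psi> x \<partial>lborel) = (\<integral>y. (\<integral>x. mollifier r (x - y) * v y * \<psi> x \<partial>lborel) \<partial>lborel)"
    unfolding eq by (rule lborel_pair.Fubini_integral[OF i])
  also have "\<dots> = (\<integral>y. v y * (\<integral>x. mollifier r (x - y) * \<psi> x \<partial>lborel) \<partial>lborel)"
    by (simp flip: integral_mult_right_zero add: mult_ac)
  finally show "(\<integral>x. mollify r v x * \<psi> x \<partial>lborel) = (\<integral>y. v y * (\<integral>x. mollifier r (x - y) * \<psi> x \<partial>lborel) \<partial>lborel)" .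
qed

lemma mollify_integrable:
  fixes v :: "real^2 \<Rightarrow> real"
  assumes r: "0 < r" and v: "integrable lborel v"
  shows "integrable lborel (mollify r v)" "(\<integral>x. mollify r v x \<partial>lborel) = (\<integral>x. v x \<partial>lborel)"
  using integral_mollify_mult[OF r v, of "\<lambda>_. 1" 1] integral_mollifier_shift(1)[OF r]
  by (simp_all add: mollifier_minus_commute[of r _ "_::real^2"])

text \<open>
  Against bounded continuous functions, mollifications converge weakly.
\<close>

lemma mollify_weak_limit:
  assumes v: "integrable lborel v"
    and \<psi>: "continuous_on UNIV (\<psi> :: real^2 \<Rightarrow> real)" "\<And>x. \<bar>\<psi> x\<bar> \<le> b"
  shows "(\<lambda>k. \<integral>x. mollify (inverse (real (Suc k))) v x * \<psi> x \<partial>lborel) \<longlonglongrightarrow> (\<integral>x. v x * \<psi> x \<partial>lborel)"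
proof -
  let ?r = "\<lambda>k. inverse (real (Suc k))"
  have r: "0 < ?r k" for k by simp
  have [measurable]: "\<psi> \<in> borel_measurable borel" by (rule borel_measurable_continuous_onI[OF \<psi>(1)])
  have [measurable]: "v \<in> borel_measurable borel" using v by auto
  define \<Psi> where "\<Psi> k y = (\<integral>x. mollifier (?r k) (x - y) * \<psi> x \<partial>lborel)" for k y
  have eq: "(\<integral>x. mollify (?r k) v x * \<psi> x \<partial>lborel) = (\<integral>y. v y * \<Psi> k y \<partial>lborel)" for k
    unfolding \<Psi>_def by (rule integral_mollify_mult(2)[OF r v _ \<psi>(2)]) simp
  have im: "integrable lborel (\<lambda>x. mollifier (?r k) (x - y))" "(\<integral>x. mollifier (?r k) (x - y) \<partial>lborel) = 1" for k y
    using integral_mollifier_shift[OF r, of k y] by (simp_all only: mollifier_minus_commute[of _ y])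
  have ip: "integrable lborel (\<lambda>x. mollifier (?r k) (x - y) * \<psi> x)" for k y
  proof (rule Bochner_Integration.integrable_bound[where f = "\<lambda>x. b * mollifier (?r k) (x - y)"])
    have "norm (mollifier (?r k) (x - y) * \<psi> x) \<le> norm (b * mollifier (?r k) (x - y))" for x
      using mult_right_mono[OF order_trans[OF \<psi>(2)[of x] abs_ge_self], of "\<bar>mollifier (?r k) (x - y)\<bar>"]
      by (simp add: abs_mult mult.commute)
    then show "AE x in lborel. norm (mollifier (?r k) (x - y) * \<psi> x) \<le> norm (b * mollifier (?r k) (x - y))"
      by simp
  qed (use im in auto)
  have close: "\<bar>\<Psi> k y - c\<bar> \<le> e" if e: "\<And>x. dist x y < ?r k \<Longrightarrow> \<bar>\<psi> x - c\<bar> \<le> e" for k y c e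
  proof -
    have "\<Psi> k y - c = (\<integral>x. mollifier (?r k) (x - y) * (\<psi> x - c) \<partial>lborel)"
      using im[of k y] ip[of k y] by (simp add: \<Psi>_def right_diff_distrib)
    also have "\<bar>\<dots>\<bar> \<le> (\<integral>x. \<bar>mollifier (?r k) (x - y) * (\<psi> x - c)\<bar> \<partial>lborel)"
      by (rule integral_abs_bound)
    also have "\<dots> \<le> (\<integral>x. e * mollifier (?r k) (x - y) \<partial>lborel)"
    proof (rule integral_mono)
      show "integrable lborel (\<lambda>x. \<bar>mollifier (?r k) (x - y) * (\<psi> x - c)\<bar>)"
        using im[of k y] ip[of k y] by (simp add: right_diff_distrib)
      fix x
      show "\<bar>mollifier (?r k) (x - y) * (\<psi> x - c)\<bar> \<le> e * mollifier (?r k) (x - y)"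
      proof (cases "dist x y < ?r k")
        case True
        then show ?thesis
          using mult_left_mono[OF e[OF True] mollifier_nonneg[of "?r k" "x - y"]]
            mollifier_nonneg[of "?r k" "x - y"] by (simp add: abs_mult mult.commute)
      qed (use mollifier_zero[OF r] in \<open>simp add: dist_norm\<close>)
    qed (use im in simp)
    also have "\<dots> = e" using im(2) by simp
    finally show ?thesis .
  qed
  have lim: "(\<lambda>k. \<Psi> k y) \<longlonglongrightarrow> \<psi> y" for y
  proof (rule LIMSEQ_I)
    fix e :: real assume "e > 0"
    then obtain d where d: "d > 0" "\<And>x. dist x y < d \<Longrightarrow> dist (\<psi> x) (\<psi> y) < e/2"
      using \<psi>(1) unfolding continuous_on_iff by (metis UNIV_I half_gt_zero)
    obtain K where K: "inverse (real (Suc K)) < d"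
      using reals_Archimedean[OF d(1)] by blast
    have "\<bar>\<Psi> k y - \<psi> y\<bar> \<le> e/2" if "k \<ge> K" for k
    proof (rule close)
      fix x assume "dist x y < ?r k"
      moreover have "?r k \<le> ?r K" using that by (simp add: le_imp_inverse_le)
      ultimately have "dist x y < d" using K by linarith
      then show "\<bar>\<psi> x - \<psi> y\<bar> \<le> e/2" using d(2)[of x] by (simp add: dist_real_def)
    qed
    then show "\<exists>K. \<forall>k\<ge>K. norm (\<Psi> k y - \<psi> y) < e"
      using \<open>e > 0\<close> by (intro exI[of _ K]) fastforce
  qed
  show ?thesis
    unfolding eq
  proof (rule integral_dominated_convergence[where w = "\<lambda>y. b * \<bar>v y\<bar>"])
    show "AE y in lborel. (\<lambda>k. v y * \<Psi> k y) \<longlonglongrightarrow> v y * \<psi> y"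
      using lim by (auto intro!: tendsto_intros)
    have "\<bar>\<Psi> k y\<bar> \<le> b" for k y
      using close[of y k 0 b] \<psi>(2) by simp
    then show "AE y in lborel. norm (v y * \<Psi> k y) \<le> b * \<bar>v y\<bar>" for k
      by (auto simp: abs_mult mult.commute[of b] intro!: mult_left_mono)
    have "(\<lambda>(y, x). mollifier (?r k) (x - y) * \<psi> x) \<in> borel_measurable (borel \<Otimes>\<^sub>M lborel)" for k
      by measurable
    then show "(\<lambda>y. v y * \<Psi> k y) \<in> borel_measurable lborel" for k
      unfolding \<Psi>_def by measurable
  qed (use v in \<open>auto simp: integrable_abs_iff\<close>)
qed

text \<open>
  The \<open>L\<^sup>1\<close> norm is the supremum of the pairings with continuous functions bounded by one.
\<close>

lemma integral_abs_le_dual: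
  fixes w :: "'a::euclidean_space \<Rightarrow> real"
  assumes w: "integrable lborel w"
    and dual: "\<And>\<psi>. continuous_on UNIV \<psi> \<Longrightarrow> (\<And>x. \<bar>\<psi> x\<bar> \<le> 1) \<Longrightarrow> (\<integral>x. w x * \<psi> x \<partial>lborel) \<le> c"
  shows "(\<integral>x. \<bar>w x\<bar> \<partial>lborel) \<le> c"
proof -
  have [measurable]: "w \<in> borel_measurable borel" using w by auto
  have "(\<lambda>x. sgn (w x)) \<in> borel_measurable borel" by measurable
  then have "(\<lambda>x. sgn (w x)) measurable_on UNIV"
    by (intro lebesgue_measurable_imp_measurable_on) (auto intro: measurable_completion)
  then obtain N g where N: "negligible N" and g: "\<And>n. continuous_on UNIV (g n)"
    and lim: "\<And>x. x \<notin> N \<Longrightarrow> (\<lambda>n. g n x) \<longlonglongrightarrow> sgn (w x)"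
    unfolding measurable_on_def by auto
  define \<psi> where "\<psi> n x = max (- 1) (min 1 (g n x))" for n x
  have c: "continuous_on UNIV (\<psi> n)" for n
    unfolding \<psi>_def[abs_def] using g by (intro continuous_intros)
  then have [measurable]: "\<psi> n \<in> borel_measurable borel" for n
    by (rule borel_measurable_continuous_onI)
  have b: "\<bar>\<psi> n x\<bar> \<le> 1" for n x by (auto simp: \<psi>_def)
  have "(\<lambda>n. \<integral>x. w x * \<psi> n x \<partial>lborel) \<longlonglongrightarrow> (\<integral>x. \<bar>w x\<bar> \<partial>lborel)"
  proof (rule integral_dominated_convergence[where w = "\<lambda>x. \<bar>w x\<bar>"])
    have "(\<lambda>n. w x * \<psi> n x) \<longlonglongrightarrow> \<bar>w x\<bar>" if "x \<notin> N" for x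
    proof -
      have "(\<lambda>n. w x * \<psi> n x) \<longlonglongrightarrow> w x * max (- 1) (min 1 (sgn (w x)))"
        unfolding \<psi>_def using lim[OF that] by (intro tendsto_intros)
      also have "w x * max (- 1) (min 1 (sgn (w x))) = \<bar>w x\<bar>"
        by (auto simp: sgn_real_def)
      finally show ?thesis .
    qed
    moreover have "AE x in lebesgue. x \<notin> N"
      using N by (metis AE_not_in negligible_iff_null_sets)
    ultimately have "AE x in lebesgue. (\<lambda>n. w x * \<psi> n x) \<longlonglongrightarrow> \<bar>w x\<bar>" by auto
    then show "AE x in lborel. (\<lambda>n. w x * \<psi> n x) \<longlonglongrightarrow> \<bar>w x\<bar>"
      by (simp add: AE_completion_iff)
    show "AE x in lborel. norm (w x * \<psi> n x) \<le> \<bar>w x\<bar>" for n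
      using b by (auto simp: abs_mult mult_left_le)
  qed (use w in auto)
  then show ?thesis
    by (rule LIMSEQ_le_const2) (use dual[OF c b] in auto)
qed

text \<open>
  Translation estimate for functions of bounded variation. It holds for the mollifications of \<open>v\<close>,
  and passes to \<open>v\<close> by duality, for which their weak convergence is enough.
\<close>

lemma integral_translate_diff_le:
  fixes v :: "real^2 \<Rightarrow> real" and h :: "real^2"
  assumes v: "integrable lborel v" and v0: "\<And>y. norm y > R \<Longrightarrow> v y = 0" and T: "TV v \<le> ereal T"
  shows "(\<integral>x. \<bar>v (h + x) - v x\<bar> \<partial>lborel) \<le> norm h * T"
proof (rule integral_abs_le_dual)
  have [measurable]: "v \<in> borel_measurable borel" using v by auto
  show i: "integrable lborel (\<lambda>x. v (h + x) - v x)"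
    using v by (intro Bochner_Integration.integrable_diff integrable_lborel_shift)
  fix \<psi> :: "real^2 \<Rightarrow> real" assume c: "continuous_on UNIV \<psi>" and b: "\<And>x. \<bar>\<psi> x\<bar> \<le> 1"
  have [measurable]: "\<psi> \<in> borel_measurable borel" by (rule borel_measurable_continuous_onI[OF c])
  have c': "continuous_on UNIV (\<lambda>x. \<psi> (x - h))"
    by (rule continuous_on_compose2[OF c]) (auto intro!: continuous_intros)
  have mult: "integrable lborel (\<lambda>x. f x * \<eta> x)"
    if "integrable lborel f" "\<eta> \<in> borel_measurable borel" "\<And>x. \<bar>\<eta> x\<bar> \<le> 1" for f \<eta> :: "real^2 \<Rightarrow> real"
    using that by (intro Bochner_Integration.integrable_bound[OF that(1)]) (auto simp: abs_mult mult_left_le)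
  have split: "(\<integral>x. (f (h + x) - f x) * \<psi> x \<partial>lborel) = (\<integral>x. f x * \<psi> (x - h) \<partial>lborel) - (\<integral>x. f x * \<psi> x \<partial>lborel)"
    if f: "integrable lborel f" for f :: "real^2 \<Rightarrow> real"
  proof -
    have [measurable]: "f \<in> borel_measurable borel" using f by auto
    have "(\<integral>x. f (h + x) * \<psi> x \<partial>lborel) = (\<integral>x. f x * \<psi> (x - h) \<partial>lborel)"
      using integral_lborel_shift[of "\<lambda>x. f x * \<psi> (x - h)" h] by simp
    moreover have "integrable lborel (\<lambda>x. f (h + x) * \<psi> x)" "integrable lborel (\<lambda>x. f x * \<psi> x)"
      using mult[OF integrable_lborel_shift[OF f, of h] _ b] mult[OF f _ b] by auto
    ultimately show ?thesis by (simp add: left_diff_distrib)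
  qed
  let ?m = "\<lambda>k. mollify (inverse (real (Suc k))) v"
  have im: "integrable lborel (?m k)" for k
    by (rule mollify_integrable(1)[OF _ v]) simp
  have lim: "(\<lambda>k. \<integral>x. (?m k (h + x) - ?m k x) * \<psi> x \<partial>lborel) \<longlonglongrightarrow> (\<integral>x. (v (h + x) - v x) * \<psi> x \<partial>lborel)"
    unfolding split[OF v] split[OF im]
    using mollify_weak_limit[OF v c' b] mollify_weak_limit[OF v c b] by (intro tendsto_diff)
  have "(\<integral>x. (?m k (h + x) - ?m k x) * \<psi> x \<partial>lborel) \<le> norm h * T" for k
  proof -
    have r: "0 < inverse (real (Suc k))" by simp
    note im = mollify_integrable(1)[OF r v]
    note ig = mollify_grad_integrable[OF r v v0]
    have id: "integrable lborel (\<lambda>x. ?m k (h + x) - ?m k x)"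
      using im by (intro Bochner_Integration.integrable_diff integrable_lborel_shift)
    have T0: "0 \<le> T"
      by (rule TV_bound_nonneg[OF T])
    have "ennreal (\<integral>x. \<bar>?m k (h + x) - ?m k x\<bar> \<partial>lborel) = (\<integral>\<^sup>+x. ennreal \<bar>?m k (h + x) - ?m k x\<bar> \<partial>lborel)"
      using id by (subst nn_integral_eq_integral) auto
    also have "\<dots> \<le> ennreal (norm h) * (\<integral>\<^sup>+x. ennreal (norm (mollify_grad (inverse (real (Suc k))) v x)) \<partial>lborel)"
      by (rule nn_integral_translate_diff_le[OF mollify_has_grad[OF r v] continuous_mollify_grad[OF r v]])
    also have "\<dots> = ennreal (norm h) * ennreal (\<integral>x. norm (mollify_grad (inverse (real (Suc k))) v x) \<partial>lborel)"
      using ig by (subst nn_integral_eq_integral) auto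
    also have "\<dots> \<le> ennreal (norm h) * ennreal T"
      using integral_norm_mollify_grad_le[OF r v v0 T] by (auto intro!: mult_left_mono ennreal_leI)
    also have "\<dots> = ennreal (norm h * T)" using T0 by (simp add: ennreal_mult)
    finally have 1: "(\<integral>x. \<bar>?m k (h + x) - ?m k x\<bar> \<partial>lborel) \<le> norm h * T"
      using T0 by (simp add: ennreal_le_iff)
    have "(\<integral>x. (?m k (h + x) - ?m k x) * \<psi> x \<partial>lborel) \<le> (\<integral>x. \<bar>?m k (h + x) - ?m k x\<bar> \<partial>lborel)"
    proof (rule integral_mono)
      show "integrable lborel (\<lambda>x. (?m k (h + x) - ?m k x) * \<psi> x)" by (rule mult[OF id _ b]) simp
      show "integrable lborel (\<lambda>x. \<bar>?m k (h + x) - ?m k x\<bar>)" using id by simp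
      fix x
      have "\<bar>(?m k (h + x) - ?m k x) * \<psi> x\<bar> \<le> \<bar>?m k (h + x) - ?m k x\<bar>"
        using b[of x] by (simp add: abs_mult mult_left_le)
      then show "(?m k (h + x) - ?m k x) * \<psi> x \<le> \<bar>?m k (h + x) - ?m k x\<bar>" by linarith
    qed
    with 1 show ?thesis by linarith
  qed
  then show "(\<integral>x. (v (h + x) - v x) * \<psi> x \<partial>lborel) \<le> norm h * T"
    by (intro LIMSEQ_le_const2[OF lim]) auto
qed

text \<open>
  Averaging the translation estimate over the support of the kernel: mollification at radius \<open>r\<close> moves
  \<open>v\<close> in \<open>L\<^sup>1\<close> by at most \<open>r\<close> times its total variation.
\<close>

lemma integral_mollify_diff_le:
  fixes v :: "real^2 \<Rightarrow> real"
  assumes r: "0 < r" and v: "integrable lborel v" and v0: "\<And>y. norm y > R \<Longrightarrow> v y = 0"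
    and T: "TV v \<le> ereal T"
  shows "(\<integral>x. \<bar>mollify r v x - v x\<bar> \<partial>lborel) \<le> r * T"
proof -
  note T0 = TV_bound_nonneg[OF T]
  have [measurable]: "v \<in> borel_measurable borel" using v by auto
  have pt: "ennreal \<bar>mollify r v x - v x\<bar> \<le> (\<integral>\<^sup>+y. ennreal (mollifier r y * \<bar>v (x - y) - v x\<bar>) \<partial>lborel)" for x
  proof -
    have "mollify r v x = (\<integral>y. mollifier r y * v (x - y) \<partial>lborel)"
      unfolding mollify_def using integral_lborel_reflect[of "\<lambda>y. mollifier r y * v (x - y)" x] by simp
    moreover have i: "integrable lborel (\<lambda>y. mollifier r y * v (x - y))"
      using integrable_lborel_reflect[OF integrable_mollify[OF r v, of x], of x] by simp
    ultimately have "mollify r v x - v x = (\<integral>y. mollifier r y * (v (x - y) - v x) \<partial>lborel)"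
      using integral_mollifier[OF r] integrable_mollifier[OF r] by (simp add: right_diff_distrib)
    moreover have "integrable lborel (\<lambda>y. mollifier r y * (v (x - y) - v x))"
      using i integrable_mollifier[OF r] by (simp add: right_diff_distrib)
    ultimately show ?thesis
      using integral_norm_bound_ennreal[of lborel "\<lambda>y. mollifier r y * (v (x - y) - v x)"]
      by (simp add: abs_mult mollifier_nonneg)
  qed
  have id: "integrable lborel (\<lambda>x. mollify r v x - v x)"
    using mollify_integrable(1)[OF r v] v by simp
  have "ennreal (\<integral>x. \<bar>mollify r v x - v x\<bar> \<partial>lborel) = (\<integral>\<^sup>+x. ennreal \<bar>mollify r v x - v x\<bar> \<partial>lborel)"
    using id by (subst nn_integral_eq_integral) auto
  also have "\<dots> \<le> (\<integral>\<^sup>+x. (\<integral>\<^sup>+y. ennreal (mollifier r y * \<bar>v (x - y) - v x\<bar>) \<partial>lborel) \<partial>lborel)"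
    by (intro nn_integral_mono pt)
  also have "\<dots> = (\<integral>\<^sup>+y. (\<integral>\<^sup>+x. ennreal (mollifier r y * \<bar>v (x - y) - v x\<bar>) \<partial>lborel) \<partial>lborel)"
    by (rule lborel_pair.Fubini'[symmetric]) measurable
  also have "\<dots> \<le> (\<integral>\<^sup>+y. ennreal (mollifier r y) * ennreal (r * T) \<partial>lborel)"
  proof (rule nn_integral_mono)
    fix y :: "real^2"
    have "(\<integral>\<^sup>+x. ennreal (mollifier r y * \<bar>v (x - y) - v x\<bar>) \<partial>lborel) =
        ennreal (mollifier r y) * (\<integral>\<^sup>+x. ennreal \<bar>v (x - y) - v x\<bar> \<partial>lborel)"
      by (simp add: ennreal_mult mollifier_nonneg nn_integral_cmult)
    also have "(\<integral>\<^sup>+x. ennreal \<bar>v (x - y) - v x\<bar> \<partial>lborel) = ennreal (\<integral>x. \<bar>v (- y + x) - v x\<bar> \<partial>lborel)"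
      using integrable_lborel_shift[OF v, of "- y"] v
      by (subst nn_integral_eq_integral) (auto simp: )
    also have "\<dots> \<le> ennreal (norm y * T)"
      using integral_translate_diff_le[OF v v0 T, where h = "- y"] by (intro ennreal_leI) simp
    also have "ennreal (mollifier r y) * ennreal (norm y * T) \<le> ennreal (mollifier r y) * ennreal (r * T)"
    proof (cases "norm y \<le> r")
      case True
      then show ?thesis using T0 by (intro mult_left_mono ennreal_leI mult_right_mono) auto
    qed (use mollifier_zero[OF r, of y] in simp)
    finally show "(\<integral>\<^sup>+x. ennreal (mollifier r y * \<bar>v (x - y) - v x\<bar>) \<partial>lborel)
        \<le> ennreal (mollifier r y) * ennreal (r * T)"
      by (simp add: mult_left_mono)
  qed
  also have "\<dots> = ennreal (r * T)"
    using integral_mollifier[OF r] integrable_mollifier[OF r]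
    by (simp add: nn_integral_multc nn_integral_eq_integral mollifier_nonneg)
  finally show ?thesis using r T0 by (simp add: ennreal_le_iff)
qed

text \<open>
  The isoperimetric inequality in the plane, with a non-sharp constant: at a scale \<open>r\<close> with
  \<open>r\<^sup>2 = 6 |E|\<close> the mollified indicator is at most one half, so half of the area of \<open>E\<close> is
  lost in mollification, which costs at most \<open>r\<close> times the perimeter.
\<close>

lemma isoperimetric:
  assumes E: "E \<in> sets borel" "E \<subseteq> cball 0 R"
    and T: "TV (indicator E) \<le> ereal T"
  shows "measure lborel E \<le> 24 * T\<^sup>2"
proof (cases "measure lborel E = 0")
  case False
  define m where "m = measure lborel E"
  have m: "m > 0" using False by (simp add: m_def order_less_le)
  define r where "r = sqrt (6 * m)"
  have r: "0 < r" "r\<^sup>2 = 6 * m" using m by (auto simp: r_def)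
  have [measurable]: "E \<in> sets borel" by fact
  have fin: "emeasure lborel E < \<infinity>"
    using emeasure_mono[OF E(2), of lborel] emeasure_lborel_cball_finite[of "0::real^2" R]
    by (auto intro: le_less_trans)
  have v: "integrable lborel (indicator E :: real^2 \<Rightarrow> real)"
    using fin by (intro integrable_real_indicator) auto
  have v0: "indicator E y = (0::real)" if "norm y > R" for y
    using that E(2) by (auto simp: indicator_def)
  let ?m = "mollify r (indicator E :: real^2 \<Rightarrow> real)"
  have half: "?m x \<le> 1/2" for x
  proof -
    have "?m x \<le> (\<integral>y. 3 / r\<^sup>2 * indicator E y \<partial>lborel)"
      unfolding mollify_def
      using integrable_mollify[OF r(1) v, of x] v mollifier_le[OF r(1)]
      by (intro integral_mono) (auto simp del: times_divide_eq_left intro!: mult_right_mono)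
    also have "\<dots> = 1/2" using m fin by (simp add: r(2) m_def[symmetric])
    finally show ?thesis .
  qed
  have "m / 2 = (\<integral>x. 1/2 * indicator E x \<partial>lborel)"
    using fin by (simp add: m_def)
  also have "\<dots> \<le> (\<integral>x. \<bar>?m x - indicator E x\<bar> \<partial>lborel)"
  proof (rule integral_mono)
    show "1/2 * indicator E x \<le> \<bar>?m x - indicator E x\<bar>" for x
      using half[of x] by (auto simp: indicator_def)
  qed (use v mollify_integrable(1)[OF r(1) v] in auto)
  also have "\<dots> \<le> r * T"
    by (rule integral_mollify_diff_le[OF r(1) v v0 T])
  finally have "(m / 2)\<^sup>2 \<le> (r * T)\<^sup>2"
    using m by (intro power_mono) auto
  then have "m * m \<le> m * (24 * T\<^sup>2)"
    unfolding power_mult_distrib r(2) by (simp add: power2_eq_square)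
  then show ?thesis using m by (simp add: m_def)
qed simp

section \<open>The coarea inequality\<close>

text \<open>
  The layer of \<open>v\<close> at height \<open>t\<close>: the indicator of \<open>{v > t}\<close> for \<open>t \<ge> 0\<close> and minus the indicator
  of \<open>{v \<le> t}\<close> for \<open>t < 0\<close>, so that \<open>v\<close> is the integral of its layers over all \<open>t\<close>.
\<close>

definition layer :: "real \<Rightarrow> ('a \<Rightarrow> real) \<Rightarrow> 'a \<Rightarrow> real" where
  "layer t v x = (if t < v x then 1 else 0) - (if t < 0 then 1 else 0)"

text \<open>
  For \<open>N > 0\<close>, a smooth increasing function with values in \<open>[0, 1]\<close>, which converges pointwise to the indicator
  of the open half-line as \<open>N\<close> tends to infinity; the shift by \<open>\<surd>N\<close> makes the limit vanish at \<open>0\<close>.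
\<close>

definition smooth_step :: "real \<Rightarrow> real \<Rightarrow> real" where
  "smooth_step N s = arctan (N * s - sqrt N) / pi + 1/2"

text \<open>
  The derivative of the smooth step.
\<close>

definition smooth_step_deriv :: "real \<Rightarrow> real \<Rightarrow> real" where
  "smooth_step_deriv N s = N / (pi * (1 + (N * s - sqrt N)\<^sup>2))"

lemma smooth_step_has_derivative:
  "(smooth_step N has_real_derivative smooth_step_deriv N s) (at s)"
proof -
  have "((\<lambda>s. arctan (N * s - sqrt N)) has_real_derivative inverse (1 + (N * s - sqrt N)\<^sup>2) * N) (at s)"
  proof (rule DERIV_chain2[OF DERIV_arctan])
    have "((\<lambda>s. N * s - sqrt N) has_real_derivative N - 0) (at s)"
      by (intro DERIV_diff DERIV_cmult_Id DERIV_const)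
    then show "((\<lambda>s. N * s - sqrt N) has_real_derivative N) (at s)" by simp
  qed
  then have "(smooth_step N has_real_derivative inverse (1 + (N * s - sqrt N)\<^sup>2) * N / pi + 0) (at s)"
    unfolding smooth_step_def[abs_def] by (intro DERIV_add DERIV_cdivide DERIV_const)
  moreover have "inverse X * N / pi + 0 = N / (pi * X)" for X :: real
    by (simp add: divide_inverse)
  ultimately show ?thesis unfolding smooth_step_deriv_def by simp
qed

lemma smooth_step_deriv_bounds:
  assumes "0 \<le> N" shows "0 \<le> smooth_step_deriv N s" "smooth_step_deriv N s \<le> N"
proof -
  have p: "pi * (1 + (N * s - sqrt N)\<^sup>2) \<ge> 1"
    using mult_mono[of 1 pi 1 "1 + (N * s - sqrt N)\<^sup>2"] pi_gt3 by simp
  then show "0 \<le> smooth_step_deriv N s"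
    using assms unfolding smooth_step_deriv_def by (intro divide_nonneg_nonneg) auto
  show "smooth_step_deriv N s \<le> N"
    unfolding smooth_step_deriv_def using p assms
    by (subst pos_divide_le_eq) (auto simp: mult_left_mono[of 1 _ N, simplified])
qed

lemma continuous_smooth_step_deriv: "continuous_on UNIV (smooth_step_deriv N)"
proof -
  have "pi * (1 + (N * s - sqrt N)\<^sup>2) \<noteq> 0" for s
    using zero_le_power2[of "N * s - sqrt N"] pi_gt_zero by (simp add: add_nonneg_eq_0_iff)
  then show ?thesis
    unfolding smooth_step_deriv_def[abs_def] by (intro continuous_intros) auto
qed

lemma smooth_step_bounds: "0 \<le> smooth_step N s" "smooth_step N s \<le> 1"
  using arctan_bounded[of "N * s - sqrt N"] pi_gt_zero
  by (auto simp: smooth_step_def field_simps)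

lemma borel_measurable_smooth_step[measurable]:
  "smooth_step N \<in> borel_measurable borel" "smooth_step_deriv N \<in> borel_measurable borel"
proof -
  show "smooth_step N \<in> borel_measurable borel"
    using smooth_step_has_derivative
    by (intro borel_measurable_continuous_onI) (meson DERIV_isCont continuous_at_imp_continuous_on)
  show "smooth_step_deriv N \<in> borel_measurable borel"
    by (rule borel_measurable_continuous_onI[OF continuous_smooth_step_deriv])
qed

lemma smooth_step_lipschitz:
  assumes "0 \<le> N" shows "\<bar>smooth_step N a - smooth_step N b\<bar> \<le> N * \<bar>a - b\<bar>"
  using field_differentiable_bound[of UNIV "smooth_step N" "smooth_step_deriv N" N a b]
    smooth_step_has_derivative smooth_step_deriv_bounds[OF assms]
  by simp

lemma smooth_step_tendsto:
  "(\<lambda>k. smooth_step (real (Suc k)) s) \<longlonglongrightarrow> (if 0 < s then 1 else 0)"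
proof -
  have N: "filterlim (\<lambda>k. real (Suc k)) at_top sequentially"
    using filterlim_real_sequentially by (simp add: filterlim_sequentially_Suc del: of_nat_Suc)
  then have sq: "filterlim (\<lambda>k. sqrt (real (Suc k))) at_top sequentially"
    by (rule filterlim_compose[OF sqrt_at_top])
  show ?thesis
  proof (cases "0 < s")
    case True
    have "filterlim (\<lambda>k. - 1 + sqrt (real (Suc k)) * s) at_top sequentially"
      using True sq
      by (intro filterlim_tendsto_add_at_top[OF tendsto_const] filterlim_at_top_mult_tendsto_pos[OF tendsto_const])
         (auto simp: mult.commute)
    then have "filterlim (\<lambda>k. sqrt (real (Suc k)) * (- 1 + sqrt (real (Suc k)) * s)) at_top sequentially"
      by (rule filterlim_at_top_mult_at_top[OF sq])
    moreover have "sqrt (real (Suc k)) * (- 1 + sqrt (real (Suc k)) * s) = real (Suc k) * s - sqrt (real (Suc k))" for k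
      by (simp add: algebra_simps del: of_nat_Suc flip: mult.assoc)
    ultimately have "filterlim (\<lambda>k. real (Suc k) * s - sqrt (real (Suc k))) at_top sequentially"
      by simp
    then have "(\<lambda>k. arctan (real (Suc k) * s - sqrt (real (Suc k))) / pi + 1/2) \<longlonglongrightarrow> (pi/2) / pi + 1/2"
      by (intro tendsto_intros filterlim_compose[OF tendsto_arctan_at_top]) auto
    then show ?thesis using True by (simp add: smooth_step_def)
  next
    case False
    have "filterlim (\<lambda>k. - sqrt (real (Suc k))) at_bot sequentially"
      using sq by (simp add: filterlim_uminus_at_top)
    then have "filterlim (\<lambda>k. real (Suc k) * s - sqrt (real (Suc k))) at_bot sequentially"
      by (rule filterlim_at_bot_mono) (use False in \<open>auto simp: mult_nonneg_nonpos\<close>)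
    then have "(\<lambda>k. arctan (real (Suc k) * s - sqrt (real (Suc k))) / pi + 1/2) \<longlonglongrightarrow> (- (pi/2)) / pi + 1/2"
      by (intro tendsto_intros filterlim_compose[OF tendsto_arctan_at_bot]) auto
    then show ?thesis using False by (simp add: smooth_step_def)
  qed
qed

text \<open>
  The total increase of the smooth step is at most one; this is what bounds the sum of the
  perimeters of the layers by the total variation.
\<close>

lemma nn_integral_smooth_step_deriv_le:
  assumes "0 \<le> N" shows "(\<integral>\<^sup>+t. ennreal (smooth_step_deriv N (a - t)) \<partial>lborel) \<le> 1"
proof -
  let ?f = "\<lambda>n t. ennreal (smooth_step_deriv N t) * indicator {- real n..real n} t"
  have *: "(\<integral>\<^sup>+t. ?f n t \<partial>lborel) \<le> 1" for n
  proof -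
    have "(\<integral>\<^sup>+t. ?f n t \<partial>lborel) = ennreal (smooth_step N (real n) - smooth_step N (- real n))"
      by (rule nn_integral_FTC_Icc)
        (auto intro: smooth_step_has_derivative has_field_derivative_at_within smooth_step_deriv_bounds assms)
    also have "\<dots> \<le> ennreal 1"
      using smooth_step_bounds[of N "real n"] smooth_step_bounds[of N "- real n"] by (intro ennreal_leI) linarith
    finally show ?thesis by simp
  qed
  have "(\<integral>\<^sup>+t. ennreal (smooth_step_deriv N (a - t)) \<partial>lborel) = (\<integral>\<^sup>+t. ennreal (smooth_step_deriv N t) \<partial>lborel)"
    by (rule nn_integral_lborel_reflect[of "\<lambda>t. ennreal (smooth_step_deriv N t)"]) measurable
  also have "\<dots> = (\<integral>\<^sup>+t. liminf (\<lambda>n. ?f n t) \<partial>lborel)"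
  proof (rule nn_integral_cong)
    fix t :: real
    have "eventually (\<lambda>n. ?f n t = ennreal (smooth_step_deriv N t)) sequentially"
    proof (rule eventually_sequentiallyI)
      fix n assume "nat \<lceil>\<bar>t\<bar>\<rceil> \<le> n"
      then have "\<bar>t\<bar> \<le> real n" by linarith
      then show "?f n t = ennreal (smooth_step_deriv N t)" by (auto simp: indicator_def)
    qed
    then have "(\<lambda>n. ?f n t) \<longlonglongrightarrow> ennreal (smooth_step_deriv N t)" by (rule tendsto_eventually)
    then show "ennreal (smooth_step_deriv N t) = liminf (\<lambda>n. ?f n t)"
      by (simp add: lim_imp_Liminf)
  qed
  also have "\<dots> \<le> liminf (\<lambda>n. \<integral>\<^sup>+t. ?f n t \<partial>lborel)"
    by (rule nn_integral_liminf) measurable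
  also have "\<dots> \<le> liminf (\<lambda>n. 1)"
    by (intro Liminf_mono always_eventually allI *)
  finally show ?thesis by (simp add: Liminf_const)
qed

text \<open>
  The smoothed layers. The mollification radius \<open>1/N\<^sup>2\<close> is small compared with the width \<open>1/N\<close> of the
  smooth step, so the smoothed layers converge to the layers.
\<close>

definition layer_scale :: "nat \<Rightarrow> real" where
  "layer_scale k = inverse ((real (Suc k))\<^sup>2)"

definition smooth_layer :: "nat \<Rightarrow> real \<Rightarrow> (real^2 \<Rightarrow> real) \<Rightarrow> real^2 \<Rightarrow> real" where
  "smooth_layer k t v x =
     smooth_step (real (Suc k)) (mollify (layer_scale k) v x - t) - smooth_step (real (Suc k)) (- t)"

text \<open>
  The gradient of the smoothed layer, by the chain rule.
\<close>

definition smooth_layer_grad :: "nat \<Rightarrow> real \<Rightarrow> (real^2 \<Rightarrow> real) \<Rightarrow> real^2 \<Rightarrow> real^2" where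
  "smooth_layer_grad k t v x =
     smooth_step_deriv (real (Suc k)) (mollify (layer_scale k) v x - t) *\<^sub>R mollify_grad (layer_scale k) v x"

lemma layer_scale_pos: "0 < layer_scale k"
  by (simp add: layer_scale_def)

lemma layer_scale_le: "layer_scale k \<le> inverse (real (Suc k))"
  unfolding layer_scale_def by (rule le_imp_inverse_le) (auto simp: power2_eq_square)

lemma smooth_layer_has_grad:
  assumes v: "integrable lborel v"
  shows "(smooth_layer k t v has_derivative (\<lambda>h. smooth_layer_grad k t v x \<bullet> h)) (at x)"
proof -
  let ?u = "mollify (layer_scale k) v"
  have 1: "((\<lambda>y. ?u y - t) has_derivative (\<lambda>h. mollify_grad (layer_scale k) v x \<bullet> h)) (at x)"
    using has_derivative_diff[OF mollify_has_grad[OF layer_scale_pos v] has_derivative_const] by simp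
  have 2: "(smooth_step (real (Suc k)) has_derivative (\<lambda>h. smooth_step_deriv (real (Suc k)) (?u x - t) * h)) (at (?u x - t))"
    using smooth_step_has_derivative by (simp add: has_field_derivative_def)
  have "((\<lambda>y. smooth_step (real (Suc k)) (?u y - t)) has_derivative
      (\<lambda>h. smooth_step_deriv (real (Suc k)) (?u x - t) * (mollify_grad (layer_scale k) v x \<bullet> h))) (at x)"
    by (rule has_derivative_compose[OF 1 2])
  from has_derivative_diff[OF this has_derivative_const] show ?thesis
    by (simp add: smooth_layer_def[abs_def] smooth_layer_grad_def)
qed

lemma continuous_smooth_layer_grad:
  assumes v: "integrable lborel v"
  shows "continuous_on UNIV (smooth_layer_grad k t v)"
  unfolding smooth_layer_grad_def[abs_def]
  by (intro continuous_intros continuous_mollify_grad[OF layer_scale_pos v]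
      continuous_on_compose2[OF continuous_smooth_step_deriv] continuous_mollify[OF layer_scale_pos v]) auto

lemma dist_grad_smooth_layer_tendsto:
  assumes v: "integrable lborel v" and v0: "\<And>y. norm y > R \<Longrightarrow> v y = 0" and T: "TV v \<le> ereal T"
    and \<phi>: "\<phi> \<in> test_fields U"
  shows "(\<lambda>k. dist_grad (smooth_layer k t v) \<phi>) \<longlonglongrightarrow> dist_grad (layer t v) \<phi>"
proof -
  have [measurable]: "v \<in> borel_measurable borel" using v by auto
  have [measurable]: "divergence \<phi> \<in> borel_measurable borel" by (rule borel_measurable_divergence[OF \<phi>])
  have mm[measurable]: "mollify (layer_scale k) v \<in> borel_measurable borel" for k
    by (rule borel_measurable_continuous_onI[OF continuous_mollify[OF layer_scale_pos v]])
  have [measurable]: "smooth_layer k t v \<in> borel_measurable borel" "layer t v \<in> borel_measurable borel" for k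
    unfolding smooth_layer_def[abs_def] layer_def[abs_def] by measurable
  obtain B where B: "B > 0" "\<And>x. \<bar>divergence \<phi> x\<bar> \<le> B" using divergence_bounded[OF \<phi>] by blast
  have id: "integrable lborel (divergence \<phi>)" by (rule divergence_integrable[OF \<phi>])
  let ?N = "\<lambda>k. real (Suc k)"
  \<comment> \<open>The smooth step of \<open>v\<close> itself: dominated convergence takes it to the layer, and the Lipschitz
    bound \<open>N\<close> of the step against the mollification error \<open>T / N\<^sup>2\<close> takes the smoothed layer to it.\<close>
  define P where "P k x = smooth_step (?N k) (v x - t) - smooth_step (?N k) (- t)" for k x
  have [measurable]: "P k \<in> borel_measurable borel" for k unfolding P_def[abs_def] by measurable
  have bd: "\<bar>smooth_layer k t v x\<bar> \<le> 1" "\<bar>P k x\<bar> \<le> 1" for k x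
    unfolding smooth_layer_def P_def
    using smooth_step_bounds[of "?N k" "mollify (layer_scale k) v x - t"] smooth_step_bounds[of "?N k" "v x - t"]
      smooth_step_bounds[of "?N k" "- t"] by linarith+
  have imult: "integrable lborel (\<lambda>x. f x * divergence \<phi> x)"
    if "f \<in> borel_measurable borel" "\<And>x. \<bar>f x\<bar> \<le> 1" for f
    using that by (intro Bochner_Integration.integrable_bound[OF id]) (auto simp: abs_mult mult_left_le_one_le)
  have 1: "(\<lambda>k. \<integral>x. P k x * divergence \<phi> x \<partial>lborel) \<longlonglongrightarrow> (\<integral>x. layer t v x * divergence \<phi> x \<partial>lborel)"
  proof (rule integral_dominated_convergence[where w = "\<lambda>x. \<bar>divergence \<phi> x\<bar>"])
    have "(\<lambda>k. P k x) \<longlonglongrightarrow> layer t v x" for x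
    proof -
      have "(\<lambda>k. P k x) \<longlonglongrightarrow> (if 0 < v x - t then 1 else 0) - (if 0 < - t then 1 else 0)"
        unfolding P_def by (intro tendsto_diff smooth_step_tendsto)
      then show ?thesis by (simp add: layer_def)
    qed
    then show "AE x in lborel. (\<lambda>k. P k x * divergence \<phi> x) \<longlonglongrightarrow> layer t v x * divergence \<phi> x"
      by (intro AE_I2 tendsto_mult tendsto_const)
    show "AE x in lborel. norm (P k x * divergence \<phi> x) \<le> \<bar>divergence \<phi> x\<bar>" for k
      using bd(2) by (auto simp: abs_mult mult_left_le_one_le)
  qed (use id in auto)
  have 2: "(\<lambda>k. (\<integral>x. smooth_layer k t v x * divergence \<phi> x \<partial>lborel) - (\<integral>x. P k x * divergence \<phi> x \<partial>lborel)) \<longlonglongrightarrow> 0"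
  proof (rule Lim_null_comparison)
    have "\<bar>(\<integral>x. smooth_layer k t v x * divergence \<phi> x \<partial>lborel) - (\<integral>x. P k x * divergence \<phi> x \<partial>lborel)\<bar>
        \<le> B * T * inverse (?N k)" for k
    proof -
      have im: "integrable lborel (\<lambda>x. mollify (layer_scale k) v x - v x)"
        using mollify_integrable(1)[OF layer_scale_pos v] v by simp
      have "(\<integral>x. smooth_layer k t v x * divergence \<phi> x \<partial>lborel) - (\<integral>x. P k x * divergence \<phi> x \<partial>lborel)
          = (\<integral>x. (smooth_layer k t v x - P k x) * divergence \<phi> x \<partial>lborel)"
        using imult[OF _ bd(1)[of k]] imult[OF _ bd(2)[of k]] by (simp add: left_diff_distrib)
      also have "\<bar>\<dots>\<bar> \<le> (\<integral>x. \<bar>(smooth_layer k t v x - P k x) * divergence \<phi> x\<bar> \<partial>lborel)"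
        by (rule integral_abs_bound)
      also have "\<dots> \<le> (\<integral>x. (B * ?N k) * \<bar>mollify (layer_scale k) v x - v x\<bar> \<partial>lborel)"
      proof (rule Bochner_Integration.integral_mono')
        show "integrable lborel (\<lambda>x. (B * ?N k) * \<bar>mollify (layer_scale k) v x - v x\<bar>)"
          using im by (simp add: integrable_abs_iff)
        fix x
        have "\<bar>smooth_layer k t v x - P k x\<bar> \<le> ?N k * \<bar>mollify (layer_scale k) v x - v x\<bar>"
          using smooth_step_lipschitz[of "?N k" "mollify (layer_scale k) v x - t" "v x - t"]
          by (simp add: smooth_layer_def P_def)
        then have "\<bar>smooth_layer k t v x - P k x\<bar> * \<bar>divergence \<phi> x\<bar>
            \<le> (?N k * \<bar>mollify (layer_scale k) v x - v x\<bar>) * B"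
          using B by (intro mult_mono) auto
        then show "\<bar>(smooth_layer k t v x - P k x) * divergence \<phi> x\<bar> \<le> (B * ?N k) * \<bar>mollify (layer_scale k) v x - v x\<bar>"
          by (simp only: abs_mult mult_ac)
      qed (use B in simp)
      also have "\<dots> = (B * ?N k) * (\<integral>x. \<bar>mollify (layer_scale k) v x - v x\<bar> \<partial>lborel)" by simp
      also have "\<dots> \<le> (B * ?N k) * (layer_scale k * T)"
        using B by (intro mult_left_mono integral_mollify_diff_le[OF layer_scale_pos v v0 T]) auto
      also have "\<dots> = B * T * inverse (?N k)"
        by (simp add: layer_scale_def power2_eq_square field_simps del: of_nat_Suc)
      finally show ?thesis .
    qed
    then show "\<forall>\<^sub>F k in sequentially. norm ((\<integral>x. smooth_layer k t v x * divergence \<phi> x \<partial>lborel) - (\<integral>x. P k x * divergence \<phi> x \<partial>lborel))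
        \<le> B * T * inverse (?N k)"
      by (intro always_eventually) simp
    show "(\<lambda>k. B * T * inverse (?N k)) \<longlonglongrightarrow> 0"
      using tendsto_mult[OF tendsto_const LIMSEQ_inverse_real_of_nat, of "B * T"] by simp
  qed
  have "(\<lambda>k. \<integral>x. smooth_layer k t v x * divergence \<phi> x \<partial>lborel) \<longlonglongrightarrow> (\<integral>x. layer t v x * divergence \<phi> x \<partial>lborel)"
    using tendsto_add[OF 2 1] by simp
  then show ?thesis
    using dist_grad_lborel[OF _ \<phi>, of "smooth_layer _ t v"] dist_grad_lborel[OF _ \<phi>, of "layer t v"]
    by (simp add: tendsto_minus)
qed

text \<open>
  Coarea inequality: the perimeters of the layers have an integrable majorant whose integral is at
  most the total variation. Passing to a majorant avoids the measurability of \<open>t \<mapsto> TV (layer t v)\<close>.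
\<close>

lemma coarea:
  assumes v: "integrable lborel v" and v0: "\<And>y. norm y > R \<Longrightarrow> v y = 0" and T: "TV v \<le> ereal T"
  obtains g :: "real \<Rightarrow> real" where "integrable lborel g" "\<And>t. 0 \<le> g t" "(\<integral>t. g t \<partial>lborel) \<le> T"
    "AE t in lborel. TV (layer t v) \<le> ereal (g t)"
proof -
  let ?N = "\<lambda>k. real (Suc k)" and ?u = "\<lambda>k. mollify (layer_scale k) v" and ?G = "\<lambda>k. mollify_grad (layer_scale k) v"
  note T0 = TV_bound_nonneg[OF T]
  have [measurable]: "?u k \<in> borel_measurable borel" "?G k \<in> borel_measurable borel" for k
    by (rule borel_measurable_continuous_onI[OF continuous_mollify[OF layer_scale_pos v]],
        rule borel_measurable_continuous_onI[OF continuous_mollify_grad[OF layer_scale_pos v]])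
  define G where "G k t = (\<integral>\<^sup>+x. ennreal (smooth_step_deriv (?N k) (?u k x - t)) * ennreal (norm (?G k x)) \<partial>lborel)" for k t
  define g where "g t = liminf (\<lambda>k. G k t)" for t
  have [measurable]: "G k \<in> borel_measurable lborel" for k unfolding G_def[abs_def] by measurable
  have [measurable]: "g \<in> borel_measurable lborel" unfolding g_def[abs_def] by measurable
  have Gint: "(\<integral>\<^sup>+t. G k t \<partial>lborel) \<le> ennreal T" for k
  proof -
    have "(\<integral>\<^sup>+t. G k t \<partial>lborel) =
        (\<integral>\<^sup>+x. (\<integral>\<^sup>+t. ennreal (smooth_step_deriv (?N k) (?u k x - t)) * ennreal (norm (?G k x)) \<partial>lborel) \<partial>lborel)"
      unfolding G_def by (rule lborel_pair.Fubini'[symmetric]) measurable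
    also have "\<dots> = (\<integral>\<^sup>+x. (\<integral>\<^sup>+t. ennreal (smooth_step_deriv (?N k) (?u k x - t)) \<partial>lborel) * ennreal (norm (?G k x)) \<partial>lborel)"
      by (simp add: nn_integral_multc del: of_nat_Suc)
    also have "\<dots> \<le> (\<integral>\<^sup>+x. 1 * ennreal (norm (?G k x)) \<partial>lborel)"
      by (intro nn_integral_mono mult_right_mono nn_integral_smooth_step_deriv_le) auto
    also have "\<dots> = ennreal (\<integral>x. norm (?G k x) \<partial>lborel)"
      using mollify_grad_integrable[OF layer_scale_pos v v0] by (simp add: nn_integral_eq_integral)
    also have "\<dots> \<le> ennreal T"
      by (intro ennreal_leI integral_norm_mollify_grad_le[OF layer_scale_pos v v0 T])
    finally show ?thesis .
  qed
  have "(\<integral>\<^sup>+t. g t \<partial>lborel) \<le> liminf (\<lambda>k. \<integral>\<^sup>+t. G k t \<partial>lborel)"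
    unfolding g_def by (rule nn_integral_liminf) measurable
  also have "\<dots> \<le> liminf (\<lambda>k. ennreal T)"
    by (intro Liminf_mono always_eventually allI Gint)
  finally have gint: "(\<integral>\<^sup>+t. g t \<partial>lborel) \<le> ennreal T" by (simp add: Liminf_const)
  then have fin: "AE t in lborel. g t \<noteq> \<infinity>"
    by (intro nn_integral_PInf_AE) (auto simp: top_unique)
  have bound: "ennreal (dist_grad (layer t v) \<phi>) \<le> g t"
    if \<phi>: "\<phi> \<in> test_fields UNIV" "\<And>x. norm (\<phi> x) \<le> 1" for t \<phi>
  proof -
    have "ennreal (dist_grad (smooth_layer k t v) \<phi>) \<le> G k t" for k
    proof -
      have ig: "integrable lborel (smooth_layer_grad k t v)"
        by (rule continuous_compact_support_integrable[OF continuous_smooth_layer_grad[OF v] compact_cball[of 0 "R + layer_scale k"]])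
          (auto simp: smooth_layer_grad_def intro!: mollify_grad_zero_far[OF layer_scale_pos v0])
      have "ennreal (dist_grad (smooth_layer k t v) \<phi>) \<le> ennreal (\<integral>x. norm (smooth_layer_grad k t v x) \<partial>lborel)"
        by (intro ennreal_leI dist_grad_le_integral_norm[OF smooth_layer_has_grad[OF v]
            continuous_smooth_layer_grad[OF v] ig \<phi>])
      also have "\<dots> = (\<integral>\<^sup>+x. ennreal (norm (smooth_layer_grad k t v x)) \<partial>lborel)"
        using ig by (simp add: nn_integral_eq_integral)
      also have "\<dots> = G k t"
        unfolding G_def smooth_layer_grad_def
        by (simp add: smooth_step_deriv_bounds ennreal_mult del: of_nat_Suc)
      finally show ?thesis .
    qed
    then have "liminf (\<lambda>k. ennreal (dist_grad (smooth_layer k t v) \<phi>)) \<le> g t"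
      unfolding g_def by (intro Liminf_mono always_eventually allI)
    moreover have "liminf (\<lambda>k. ennreal (dist_grad (smooth_layer k t v) \<phi>)) = ennreal (dist_grad (layer t v) \<phi>)"
      by (intro lim_imp_Liminf tendsto_ennrealI dist_grad_smooth_layer_tendsto[OF v v0 T \<phi>(1)]) simp
    ultimately show ?thesis by simp
  qed
  define g' where "g' t = enn2real (g t)" for t
  have g'_int: "(\<integral>\<^sup>+t. ennreal (g' t) \<partial>lborel) = (\<integral>\<^sup>+t. g t \<partial>lborel)"
    by (rule nn_integral_cong_AE) (use fin in \<open>auto simp: g'_def less_top elim!: eventually_mono\<close>)
  show thesis
  proof (rule that[of g'])
    show i: "integrable lborel g'"
    proof (rule integrableI_bounded)
      show "(\<integral>\<^sup>+t. ennreal (norm (g' t)) \<partial>lborel) < \<infinity>"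
        using g'_int gint by (simp add: g'_def) (metis ennreal_less_top le_less_trans)
    qed (simp add: g'_def[abs_def])
    show "0 \<le> g' t" for t by (simp add: g'_def)
    have "ennreal (\<integral>t. g' t \<partial>lborel) = (\<integral>\<^sup>+t. ennreal (g' t) \<partial>lborel)"
      using i by (subst nn_integral_eq_integral) (auto simp: g'_def)
    also have "\<dots> \<le> ennreal T" using g'_int gint by simp
    finally show "(\<integral>t. g' t \<partial>lborel) \<le> T" using T0 by (simp add: ennreal_le_iff)
    show "AE t in lborel. TV (layer t v) \<le> ereal (g' t)"
      using fin
    proof eventually_elim
      case (elim t)
      show ?case
      proof (rule TV_leI)
        fix \<phi> assume "\<phi> \<in> test_fields UNIV" "\<And>x. norm (\<phi> x) \<le> 1"
        then have "ennreal (dist_grad (layer t v) \<phi>) \<le> ennreal (g' t)"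
          using bound[of \<phi> t] elim by (simp add: g'_def less_top)
        then show "dist_grad (layer t v) \<phi> \<le> g' t"
          by (simp add: g'_def ennreal_le_iff)
      qed
    qed
  qed
qed

lemma mollifier_has_derivative:
  assumes r: "0 < r"
  shows "(mollifier r has_derivative (\<lambda>h. mollifier_grad r z \<bullet> h)) (at z)"
proof -
  obtain C where C: "C \<ge> 0" "\<And>z h. norm h \<le> 1 \<Longrightarrow>
       \<bar>mollifier r (z + h) - mollifier r z - mollifier_grad r z \<bullet> h\<bar> \<le> C * (norm h)\<^sup>2"
    using mollifier_remainder[OF r] by blast
  show ?thesis
  proof (rule has_derivativeI_sandwich[of 1 _ _ _ _ "\<lambda>y. C * norm (y - z)"])
    fix y assume "y \<noteq> z" "dist y z < 1"
    then show "norm (mollifier r y - mollifier r z - mollifier_grad r z \<bullet> (y - z)) / norm (y - z) \<le> C * norm (y - z)"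
      using C(2)[of "y - z" z] by (simp add: divide_le_eq power2_eq_square mult.assoc dist_norm)
  next
    have "((\<lambda>y. C * norm (y - z)) \<longlongrightarrow> C * norm (z - z)) (at z)"
      by (intro tendsto_intros)
    then show "((\<lambda>y. C * norm (y - z)) \<longlongrightarrow> 0) (at z)" by simp
  qed (auto intro: bounded_linear_inner_right)
qed

text \<open>
  Where the distributional gradient of \<open>v\<close> vanishes, so does that of every layer.
\<close>

lemma dist_grad_layer_zero:
  assumes v: "integrable lborel v" and v0: "\<And>y. norm y > R \<Longrightarrow> v y = 0" and T: "TV v \<le> ereal T"
    and U: "open U" and z: "\<And>\<phi>. \<phi> \<in> test_fields U \<Longrightarrow> dist_grad v \<phi> = 0"
    and \<phi>: "\<phi> \<in> test_fields U"
  shows "dist_grad (layer t v) \<phi> = 0"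
proof -
  have [measurable]: "v \<in> borel_measurable borel" using v by auto
  obtain K where K: "compact K" "K \<subseteq> U" "\<And>x. x \<notin> K \<Longrightarrow> \<phi> x = 0"
    using test_fieldsD(4)[OF \<phi>] by blast
  obtain d where d: "d > 0" "(\<Union>x\<in>K. ball x d) \<subseteq> U"
    using compact_subset_open_imp_ball_epsilon_subset[OF K(1) U K(2)] .
  have G0: "mollify_grad r v x = 0" if r: "0 < r" "r < d" and x: "x \<in> K" for r x
  proof -
    have "mollify_grad r v x \<bullet> h = 0" for h
    proof -
      \<comment> \<open>The gradient of the mollification at \<open>x\<close> is the distributional gradient of \<open>v\<close> tested against
        the kernel centred at \<open>x\<close>.\<close>
      let ?\<phi> = "\<lambda>y. mollifier r (x - y) *\<^sub>R h"
      have der: "(?\<phi> has_derivative (\<lambda>k. - (mollifier_grad r (x - y) \<bullet> k) *\<^sub>R h)) (at y)" for y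
      proof -
        have "((\<lambda>y. mollifier r (x - y)) has_derivative (\<lambda>k. mollifier_grad r (x - y) \<bullet> (- k))) (at y)"
          by (rule has_derivative_compose[OF _ mollifier_has_derivative[OF r(1)], of "\<lambda>y. x - y"])
            (auto intro!: derivative_eq_intros)
        from has_derivative_scaleR_left[OF this, of h] show ?thesis by simp
      qed
      have tf: "?\<phi> \<in> test_fields U"
      proof (rule test_fieldsI[OF der _ compact_cball[of x r]])
        show "continuous_on UNIV (\<lambda>y. - (mollifier_grad r (x - y) \<bullet> k) *\<^sub>R h)" for k
          by (intro continuous_intros continuous_on_compose2[OF continuous_mollifier_grad]) auto
        show "cball x r \<subseteq> U" using d(2) x r(2) by force
        show "?\<phi> y = 0" if "y \<notin> cball x r" for y
          using that mollifier_zero[OF r(1), of "x - y"] by (simp add: dist_norm)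
      qed
      have "divergence ?\<phi> y = - (mollifier_grad r (x - y) \<bullet> h)" for y
        using divergence_eq[OF der, of y] by (simp add: inner_vec_def[of _ h] inner_axis sum_negf)
      then have "dist_grad v ?\<phi> = mollify_grad r v x \<bullet> h"
        using dist_grad_lborel[OF _ tf, of v] by (simp add: mollify_grad_inner[OF r(1) v])
      then show ?thesis using z[OF tf] by simp
    qed
    then show ?thesis by (metis inner_eq_zero_iff)
  qed
  have "eventually (\<lambda>k. dist_grad (smooth_layer k t v) \<phi> = 0) sequentially"
  proof -
    obtain k0 where k0: "inverse (real (Suc k0)) < d" using reals_Archimedean[OF d(1)] by blast
    show ?thesis
    proof (rule eventually_sequentiallyI)
      fix k assume "k0 \<le> k"
      then have "inverse (real (Suc k)) \<le> inverse (real (Suc k0))" by (simp add: le_imp_inverse_le)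
      then have "layer_scale k < d" using layer_scale_le[of k] k0 by linarith
      then have "smooth_layer_grad k t v x \<bullet> \<phi> x = 0" for x
        using G0[OF layer_scale_pos, of k x] K(3)[of x] by (cases "x \<in> K") (auto simp: smooth_layer_grad_def)
      then show "dist_grad (smooth_layer k t v) \<phi> = 0"
        by (simp add: dist_grad_eq_integral_grad[OF smooth_layer_has_grad[OF v] continuous_smooth_layer_grad[OF v] \<phi>])
    qed
  qed
  then have "(\<lambda>k. dist_grad (smooth_layer k t v) \<phi>) \<longlonglongrightarrow> 0" by (rule tendsto_eventually)
  with dist_grad_smooth_layer_tendsto[OF v v0 T \<phi>] show ?thesis
    by (rule LIMSEQ_unique)
qed

section \<open>Reduction to two levels\<close>

lemma layer_eq_indicator: "layer t v x = indicator {0..<v x} t - indicator {v x..<0} t"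
  by (auto simp: layer_def indicator_def)

lemma integrable_indicator_Ico: "integrable lborel (indicator {a..<b} :: real \<Rightarrow> real)"
  by (cases "a \<le> b") (auto intro!: integrable_real_indicator)

lemma measure_lborel_Ico_max: "measure lborel {a..<b} = max 0 (b - a :: real)"
  by (cases "a \<le> b") auto

lemma layer_at_zero: "v x = 0 \<Longrightarrow> layer t v x = 0"
  by (simp add: layer_def)

lemma integrable_mult_bounded:
  fixes f h :: "'a::euclidean_space \<Rightarrow> real"
  assumes f: "integrable lborel f" and [measurable]: "h \<in> borel_measurable borel" and b: "\<And>x. \<bar>h x\<bar> \<le> B"
  shows "integrable lborel (\<lambda>x. f x * h x)"
proof (rule Bochner_Integration.integrable_bound[where f = "\<lambda>x. B * f x"])
  have "norm (f x * h x) \<le> norm (B * f x)" for x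
    using mult_right_mono[OF order_trans[OF b[of x] abs_ge_self], of "\<bar>f x\<bar>"]
    by (simp add: abs_mult mult.commute)
  then show "AE x in lborel. norm (f x * h x) \<le> norm (B * f x)" by simp
qed (use f in auto)

lemma dist_grad_linear:
  assumes f: "integrable lborel f" and h: "integrable lborel h" and \<phi>: "\<phi> \<in> test_fields U"
  shows "dist_grad (\<lambda>x. a * f x + b * h x) \<phi> = a * dist_grad f \<phi> + b * dist_grad h \<phi>"
proof -
  obtain B where B: "\<And>x. \<bar>divergence \<phi> x\<bar> \<le> B" using divergence_bounded[OF \<phi>] by blast
  have [measurable]: "f \<in> borel_measurable borel" "h \<in> borel_measurable borel" using f h by auto
  have "integrable lborel (\<lambda>x. f x * divergence \<phi> x)" "integrable lborel (\<lambda>x. h x * divergence \<phi> x)"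
    using integrable_mult_bounded[OF f borel_measurable_divergence[OF \<phi>] B]
      integrable_mult_bounded[OF h borel_measurable_divergence[OF \<phi>] B] by auto
  then have "(\<integral>x. (a * f x + b * h x) * divergence \<phi> x \<partial>lborel) =
      a * (\<integral>x. f x * divergence \<phi> x \<partial>lborel) + b * (\<integral>x. h x * divergence \<phi> x \<partial>lborel)"
    by (simp add: distrib_right mult.assoc)
  then show ?thesis
    using dist_grad_lborel[OF _ \<phi>, of f] dist_grad_lborel[OF _ \<phi>, of h]
      dist_grad_lborel[OF _ \<phi>, of "\<lambda>x. a * f x + b * h x"] by simp
qed

lemma TV_linear_le:
  assumes f: "integrable lborel f" "TV f \<le> ereal A" and h: "integrable lborel h" "TV h \<le> ereal B"
    and "0 \<le> a" "0 \<le> b"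
  shows "TV (\<lambda>x. a * f x + b * h x) \<le> ereal (a * A + b * B)"
proof (rule TV_leI)
  fix \<phi> assume \<phi>: "\<phi> \<in> test_fields UNIV" "\<And>x. norm (\<phi> x) \<le> 1"
  show "dist_grad (\<lambda>x. a * f x + b * h x) \<phi> \<le> a * A + b * B"
    unfolding dist_grad_linear[OF f(1) h(1) \<phi>(1)]
    using TV_leD[OF f(2) \<phi>] TV_leD[OF h(2) \<phi>] assms(5,6) by (intro add_mono mult_left_mono)
qed

lemma TV_uminus_le: 
  assumes f: "integrable lborel f" "TV f \<le> ereal A"
  shows "TV (\<lambda>x. - f x) \<le> ereal A"
proof (rule TV_leI)
  fix \<phi> assume \<phi>: "\<phi> \<in> test_fields UNIV" "\<And>x. norm (\<phi> x) \<le> 1"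
  have m: "(\<lambda>x. - \<phi> x) \<in> test_fields UNIV"
  proof -
    obtain K where K: "compact K" "\<And>x. x \<notin> K \<Longrightarrow> \<phi> x = 0"
      using test_fieldsD(4)[OF \<phi>(1)] by blast
    show ?thesis
      using test_fieldsD(2)[OF \<phi>(1)] K
      by (intro test_fieldsI[OF has_derivative_minus[OF test_fieldsD(1)[OF \<phi>(1)]] _ K(1)])
        (auto intro!: continuous_intros)
  qed
  have "divergence (\<lambda>x. - \<phi> x) x = - divergence \<phi> x" for x
    using divergence_eq[OF has_derivative_minus[OF test_fieldsD(1)[OF \<phi>(1)]], of x]
      divergence_eq[OF test_fieldsD(1)[OF \<phi>(1)], of x] by (simp add: sum_negf)
  then have "dist_grad (\<lambda>x. - f x) \<phi> = dist_grad f (\<lambda>x. - \<phi> x)"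
    by (simp add: dist_grad_def)
  then show "dist_grad (\<lambda>x. - f x) \<phi> \<le> A"
    using TV_leD[OF f(2) m] \<phi>(2) by simp
qed

text \<open>
  By Tonelli the integral of \<open>v\<close> over a set is the integral over \<open>t\<close> of those of its layers.
\<close>

lemma integral_layers:
  fixes v :: "real^2 \<Rightarrow> real"
  assumes v: "integrable lborel v" and [measurable]: "S \<in> sets borel"
  shows "integrable lborel (\<lambda>t. \<integral>x. layer t v x * indicator S x \<partial>lborel)"
    and "(\<integral>t. (\<integral>x. layer t v x * indicator S x \<partial>lborel) \<partial>lborel) = (\<integral>x. v x * indicator S x \<partial>lborel)"
proof -
  have [measurable]: "v \<in> borel_measurable borel" using v by auto
  have m[measurable]: "(\<lambda>(x, t). layer t v x * indicator S x) \<in> borel_measurable (lborel \<Otimes>\<^sub>M lborel)"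
    unfolding layer_def by measurable
  have il: "integrable lborel (\<lambda>t. layer t v x)" "(\<integral>t. layer t v x \<partial>lborel) = v x" for x
  proof -
    show "integrable lborel (\<lambda>t. layer t v x)" "(\<integral>t. layer t v x \<partial>lborel) = v x"
      unfolding layer_eq_indicator by (auto simp: measure_lborel_Ico_max integrable_indicator_Ico)
  qed
  have al: "(\<integral>t. \<bar>layer t v x\<bar> \<partial>lborel) = \<bar>v x\<bar>" for x
  proof -
    have "\<bar>layer t v x\<bar> = indicator {0..<v x} t + indicator {v x..<0} t" for t
      unfolding layer_eq_indicator by (auto simp: indicator_def)
    then show ?thesis by (auto simp: measure_lborel_Ico_max integrable_indicator_Ico)
  qed
  have i: "integrable (lborel \<Otimes>\<^sub>M lborel) (\<lambda>(x, t). layer t v x * indicator S x)"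
  proof (rule lborel_pair.Fubini_integrable[OF m])
    have "integrable lborel (\<lambda>x. \<bar>v x\<bar> * indicator S x)"
      using v by (intro integrable_mult_bounded[where B = 1]) (auto simp: integrable_abs_iff indicator_def)
    then show "integrable lborel (\<lambda>x. \<integral>t. norm (case (x, t) of (x, t) \<Rightarrow> layer t v x * indicator S x) \<partial>lborel)"
      by (simp add: abs_mult al)
    show "AE x in lborel. integrable lborel (\<lambda>t. case (x, t) of (x, t) \<Rightarrow> layer t v x * indicator S x)"
      using il(1) by simp
  qed
  have "integrable (lborel \<Otimes>\<^sub>M lborel) (\<lambda>(t, x). layer t v x * indicator S x)"
    using lborel_pair.integrable_product_swap[OF i] by (simp add: case_prod_beta)
  from lborel_pair.integrable_fst'[OF this]
  show "integrable lborel (\<lambda>t. \<integral>x. layer t v x * indicator S x \<partial>lborel)" by simp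
  show "(\<integral>t. (\<integral>x. layer t v x * indicator S x \<partial>lborel) \<partial>lborel) = (\<integral>x. v x * indicator S x \<partial>lborel)"
    using lborel_pair.Fubini_integral[OF i] by (simp add: il(2))
qed

text \<open>
  Some point at which the weight is positive has a ratio \<open>f / w\<close> at most the ratio of the integrals.
\<close>

lemma exists_le_average:
  fixes f w :: "'a \<Rightarrow> real"
  assumes f: "integrable M f" and w: "integrable M w" and w0: "\<And>t. 0 \<le> w t" and pos: "0 < (\<integral>t. w t \<partial>M)"
    and Q: "AE t in M. Q t" and fw: "\<And>t. w t = 0 \<Longrightarrow> 0 \<le> f t"
  shows "\<exists>t. Q t \<and> 0 < w t \<and> f t * (\<integral>t. w t \<partial>M) \<le> (\<integral>t. f t \<partial>M) * w t"
proof (rule ccontr)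
  assume "\<not> ?thesis"
  then have *: "(\<integral>t. f t \<partial>M) * w t < f t * (\<integral>t. w t \<partial>M)" if "Q t" "0 < w t" for t
    using that by (meson not_less)
  define h where "h t = f t * (\<integral>t. w t \<partial>M) - (\<integral>t. f t \<partial>M) * w t" for t
  have h: "integrable M h" "(\<integral>t. h t \<partial>M) = 0"
    unfolding h_def[abs_def] using f w by simp_all
  have "AE t in M. 0 \<le> h t"
    using Q
  proof eventually_elim
    case (elim t)
    show ?case
    proof (cases "w t = 0")
      case True then show ?thesis using fw[OF True] pos by (simp add: h_def)
    next
      case False then show ?thesis using *[OF elim] w0[of t] by (simp add: h_def)
    qed
  qed
  then have "AE t in M. h t = 0"
    using h integral_nonneg_eq_0_iff_AE[OF h(1)] by simp
  then have "AE t in M. w t = 0"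
    using Q
  proof eventually_elim
    case (elim t)
    then show ?case using *[of t] w0[of t] by (force simp: h_def)
  qed
  then have "(\<integral>t. w t \<partial>M) = 0"
    by (rule integral_eq_zero_AE)
  with pos show False by simp
qed

text \<open>
  The members of \<open>BV_diamond\<close> that are Borel measurable and vanish everywhere, not just almost
  everywhere, off \<open>\<Omega>\<close>; for open \<open>\<Omega>\<close> and open nonempty \<open>\<Omega>s\<close> every
  class of \<open>BV_diamond\<close> has such a representative. As they vanish off \<open>\<Omega>\<close>,
  the first constraint becomes an integral over the plane.
\<close>

definition representatives :: "(real^2) set \<Rightarrow> (real^2) set \<Rightarrow> (real^2 \<Rightarrow> real) set" where
  "representatives \<Omega> \<Omega>s = {v. integrable lborel v \<and> (\<forall>x. x \<notin> \<Omega> \<longrightarrow> v x = 0) \<and> TV v < \<infinity> \<and>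
     (\<integral>x. v x \<partial>lborel) = 0 \<and> (\<integral>x. v x * indicator \<Omega>s x \<partial>lborel) = measure lborel \<Omega>s \<and>
     (\<forall>\<phi> \<in> test_fields \<Omega>s. dist_grad v \<phi> = 0)}"

text \<open>
  The heart of the argument: a suitable combination \<open>a * 1\<^sub>E - b * 1\<^sub>F\<close> of one superlevel set
  \<open>E = {v > t}\<close>, \<open>t \<ge> 0\<close>, and one sublevel set \<open>F = {v \<le> s}\<close>, \<open>s < 0\<close>, is a competitor that is at least
  as good as \<open>v\<close>. Its \<open>L\<^sup>2\<close> norm is controlled by the isoperimetric inequality.
\<close>

lemma two_level_competitor:
  assumes v: "v \<in> representatives \<Omega> \<Omega>s" and T: "TV v \<le> ereal T"
    and \<Omega>: "bounded \<Omega>" and \<Omega>s: "open \<Omega>s" "0 < measure lborel \<Omega>s"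
  shows "\<exists>u \<in> representatives \<Omega> \<Omega>s. TV u \<le> ereal T \<and> card (range u - {0}) = 2 \<and>
    integrable lborel (\<lambda>x. (u x)\<^sup>2) \<and> (\<integral>x. (u x)\<^sup>2 \<partial>lborel) \<le> 24 * T\<^sup>2"
proof -
  have iv: "integrable lborel v" and voff: "\<And>x. x \<notin> \<Omega> \<Longrightarrow> v x = 0"
    and v_int: "(\<integral>x. v x \<partial>lborel) = 0" and v_S: "(\<integral>x. v x * indicator \<Omega>s x \<partial>lborel) = measure lborel \<Omega>s"
    and v_grad: "\<And>\<phi>. \<phi> \<in> test_fields \<Omega>s \<Longrightarrow> dist_grad v \<phi> = 0"
    using v by (auto simp: representatives_def)
  obtain R where R: "\<And>x. x \<in> \<Omega> \<Longrightarrow> norm x \<le> R" using \<Omega> bounded_iff by metis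
  have v0: "v y = 0" if "norm y > R" for y using voff R[of y] that by force
  have [measurable]: "v \<in> borel_measurable borel" using iv by auto
  have [measurable]: "\<Omega>s \<in> sets borel" using \<Omega>s by auto
  note T0 = TV_bound_nonneg[OF T]
  define c where "c = measure lborel \<Omega>s"
  have c: "c > 0" using \<Omega>s by (simp add: c_def)
  obtain g where g: "integrable lborel g" "\<And>t. 0 \<le> g t" "(\<integral>t. g t \<partial>lborel) \<le> T"
    and gTV: "AE t in lborel. TV (layer t v) \<le> ereal (g t)"
    using coarea[OF iv v0 T] by blast
  let ?B = "cball (0::real^2) R"
  have ib: "integrable lborel (indicator ?B :: real^2 \<Rightarrow> real)"
    by (intro integrable_real_indicator emeasure_lborel_cball_finite) simp
  have lm[measurable]: "layer t v \<in> borel_measurable borel" for t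
    unfolding layer_def[abs_def] by measurable
  have il: "integrable lborel (layer t v)" for t
  proof (rule Bochner_Integration.integrable_bound[OF ib])
    have "norm (layer t v x) \<le> norm (indicator ?B x :: real)" for x
      using layer_at_zero[of v x t] v0[of x] by (cases "norm x > R") (auto simp: layer_def)
    then show "AE x in lborel. norm (layer t v x) \<le> norm (indicator ?B x :: real)" by simp
  qed simp
  define M where "M t = (\<integral>x. layer t v x \<partial>lborel)" for t
  define S where "S t = (\<integral>x. layer t v x * indicator \<Omega>s x \<partial>lborel)" for t
  have M: "integrable lborel M" "(\<integral>t. M t \<partial>lborel) = 0"
    using integral_layers[OF iv, of UNIV] v_int by (simp_all add: M_def[abs_def])
  have S: "integrable lborel S" "(\<integral>t. S t \<partial>lborel) = c"
    using integral_layers[OF iv, of \<Omega>s] v_S by (simp_all add: S_def[abs_def] c_def)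
  have M_pos: "0 \<le> M t" if "0 \<le> t" for t
    unfolding M_def using that by (intro Bochner_Integration.integral_nonneg) (auto simp: layer_def)
  have M_neg: "M t \<le> 0" if "t < 0" for t
  proof -
    have "0 \<le> (\<integral>x. - layer t v x \<partial>lborel)"
      using that by (intro Bochner_Integration.integral_nonneg) (auto simp: layer_def)
    then show ?thesis by (simp add: M_def)
  qed
  have S0: "S t = 0" if "M t = 0" for t
  proof -
    have "\<bar>S t\<bar> \<le> \<bar>M t\<bar>"
    proof -
      have "\<bar>S t\<bar> \<le> (\<integral>x. \<bar>layer t v x * indicator \<Omega>s x\<bar> \<partial>lborel)"
        unfolding S_def by (rule integral_abs_bound)
      also have "\<dots> \<le> (\<integral>x. \<bar>layer t v x\<bar> \<partial>lborel)"
        using il[of t] by (intro Bochner_Integration.integral_mono') (auto simp: integrable_abs_iff indicator_def)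
      also have "\<dots> = \<bar>M t\<bar>"
      proof (cases "0 \<le> t")
        case True
        then have "\<bar>layer t v x\<bar> = layer t v x" for x by (auto simp: layer_def)
        then show ?thesis using M_pos[OF True] by (simp add: M_def)
      next
        case False
        then have "\<bar>layer t v x\<bar> = - layer t v x" for x by (auto simp: layer_def)
        then show ?thesis using M_neg[of t] False by (simp add: M_def)
      qed
      finally show ?thesis .
    qed
    then show ?thesis using that by simp
  qed
  \<comment> \<open>\<open>T\<close> bounds the integral of \<open>g\<close> and \<open>c\<close> is the integral of \<open>S\<close>, so \<open>g - \<kappa> * S\<close> has nonpositive
    integral over all heights. Comparing with the mass \<open>M\<close>, separately on the heights \<open>t \<ge> 0\<close> and
    \<open>t < 0\<close>, whose layers carry the same mass \<open>m\<close>, selects one height of each sign.\<close>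
  define \<kappa> where "\<kappa> = T / c"
  have \<kappa>: "\<kappa> \<ge> 0" using T0 c by (simp add: \<kappa>_def)
  define P N :: "real \<Rightarrow> real" where "P = indicator {0..}" and "N = indicator {..<0}"
  have PN: "P t + N t = 1" "0 \<le> P t" "0 \<le> N t" "\<bar>P t\<bar> \<le> 1" "\<bar>N t\<bar> \<le> 1" for t
    by (auto simp: P_def N_def indicator_def)
  have [measurable]: "P \<in> borel_measurable borel" "N \<in> borel_measurable borel"
    by (auto simp: P_def N_def)
  have iM: "integrable lborel (\<lambda>t. M t * P t)" "integrable lborel (\<lambda>t. - M t * N t)"
    using integrable_mult_bounded[OF M(1) _ PN(4)] integrable_mult_bounded[OF M(1) _ PN(5)] by auto
  define L where "L t = g t - \<kappa> * S t" for t
  have L: "integrable lborel L" "(\<integral>t. L t \<partial>lborel) \<le> 0"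
    unfolding L_def[abs_def] using g S c by (simp_all add: \<kappa>_def)
  have iL: "integrable lborel (\<lambda>t. L t * P t)" "integrable lborel (\<lambda>t. L t * N t)"
    using integrable_mult_bounded[OF L(1) _ PN(4)] integrable_mult_bounded[OF L(1) _ PN(5)] by auto
  define m where "m = (\<integral>t. M t * P t \<partial>lborel)"
  have m': "(\<integral>t. - M t * N t \<partial>lborel) = m"
  proof -
    have "(\<integral>t. M t * P t - (- M t * N t) \<partial>lborel) = (\<integral>t. M t \<partial>lborel)"
      using PN(1) by (intro Bochner_Integration.integral_cong) (auto simp flip: distrib_left)
    then show ?thesis using iM M(2) by (simp add: m_def)
  qed
  have MP: "0 \<le> M t * P t" and MN: "0 \<le> - M t * N t" for t
    using M_pos[of t] M_neg[of t] by (auto simp: P_def N_def indicator_def)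
  have m: "0 < m"
  proof (rule ccontr)
    assume "\<not> 0 < m"
    moreover have "0 \<le> m" unfolding m_def using MP by simp
    ultimately have "m = 0" by simp
    then have "AE t in lborel. M t * P t = 0" "AE t in lborel. - M t * N t = 0"
      using integral_nonneg_eq_0_iff_AE[OF iM(1)] integral_nonneg_eq_0_iff_AE[OF iM(2)] MP MN m'
      by (simp_all add: m_def)
    then have "AE t in lborel. S t = 0"
    proof eventually_elim
      case (elim t)
      then have "M t = 0" using PN(1)[of t] by auto
      then show ?case by (rule S0)
    qed
    then have "c = 0" using S(2) integral_eq_zero_AE by metis
    with c show False by simp
  qed
  have L0: "0 \<le> L t" if "M t = 0" for t using S0[OF that] g(2)[of t] by (simp add: L_def)
  have "\<exists>t. TV (layer t v) \<le> ereal (g t) \<and> 0 < M t * P t \<and>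
      L t * P t * (\<integral>t. M t * P t \<partial>lborel) \<le> (\<integral>t. L t * P t \<partial>lborel) * (M t * P t)"
  proof (rule exists_le_average[OF iL(1) iM(1) MP _ gTV])
    show "0 < (\<integral>t. M t * P t \<partial>lborel)" using m by (simp add: m_def)
    show "0 \<le> L t * P t" if "M t * P t = 0" for t
      using that L0[of t] PN(2)[of t] by (cases "P t = 0") auto
  qed
  then obtain t where t: "TV (layer t v) \<le> ereal (g t)" "0 < M t * P t"
      "L t * P t * m \<le> (\<integral>t. L t * P t \<partial>lborel) * (M t * P t)"
    unfolding m_def by blast
  have "\<exists>s. TV (layer s v) \<le> ereal (g s) \<and> 0 < - M s * N s \<and>
      L s * N s * (\<integral>t. - M t * N t \<partial>lborel) \<le> (\<integral>t. L t * N t \<partial>lborel) * (- M s * N s)"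
  proof (rule exists_le_average[OF iL(2) iM(2) MN _ gTV])
    show "0 < (\<integral>t. - M t * N t \<partial>lborel)" using m m' by simp
    show "0 \<le> L t * N t" if "- M t * N t = 0" for t
      using that L0[of t] PN(3)[of t] by (cases "N t = 0") auto
  qed
  then obtain s where s: "TV (layer s v) \<le> ereal (g s)" "0 < - M s * N s"
      "L s * N s * m \<le> (\<integral>t. L t * N t \<partial>lborel) * (- M s * N s)"
    unfolding m' by blast
  have t0: "0 \<le> t" "P t = 1" "0 < M t" using t(2) by (cases "0 \<le> t"; simp add: P_def)+
  have s0: "s < 0" "N s = 1" "M s < 0" using s(2) by (cases "s < 0"; simp add: N_def)+
  define n where "n = - M s"
  have n: "0 < n" using s0 by (simp add: n_def)
  define I J where "I = (\<integral>t. L t * P t \<partial>lborel)" and "J = (\<integral>t. L t * N t \<partial>lborel)"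
  have "I + J = (\<integral>t. L t * P t + L t * N t \<partial>lborel)"
    using iL by (simp add: I_def J_def)
  also have "\<dots> = (\<integral>t. L t \<partial>lborel)"
    using PN(1) by (intro Bochner_Integration.integral_cong) (auto simp flip: distrib_left)
  finally have IJ: "I + J \<le> 0" using L(2) by simp
  have key: "n * g t + M t * g s \<le> \<kappa> * (n * S t + M t * S s)"
  proof -
    have 1: "L t * m \<le> I * M t" "L s * m \<le> J * n"
      using t(3) s(3) t0(2) s0(2) by (simp_all add: I_def J_def n_def)
    have "(n * L t + M t * L s) * m = n * (L t * m) + M t * (L s * m)" by (simp add: algebra_simps)
    also have "\<dots> \<le> n * (I * M t) + M t * (J * n)"
      using 1 n t0(3) by (intro add_mono mult_left_mono) auto
    also have "\<dots> = (I + J) * (n * M t)" by (simp add: algebra_simps)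
    also have "\<dots> \<le> 0" using IJ n t0(3) by (intro mult_nonpos_nonneg) auto
    finally have "n * L t + M t * L s \<le> 0" using m by (simp add: mult_le_0_iff)
    then show ?thesis by (simp add: L_def algebra_simps)
  qed
  define E F where "E = {x. t < v x}" and "F = {x. v x \<le> s}"
  have [measurable]: "E \<in> sets borel" "F \<in> sets borel" unfolding E_def F_def by measurable
  have lE: "layer t v = indicator E" and lF: "layer s v = (\<lambda>x. - indicator F x)"
    using t0(1) s0(1) by (auto simp: layer_def E_def F_def indicator_def fun_eq_iff)
  have "E \<subseteq> ?B" "F \<subseteq> ?B"
    using v0 t0(1) s0(1) by (force simp: E_def F_def not_less[symmetric])+
  have ME: "M t = measure lborel E" and nF: "n = measure lborel F"
    unfolding M_def n_def lE lF by simp_all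
  have "TV (indicator F) \<le> ereal (g s)"
    using TV_uminus_le[OF il s(1)] by (simp add: lF)
  then have iso: "M t \<le> 24 * (g t)\<^sup>2" "n \<le> 24 * (g s)\<^sup>2"
    using isoperimetric[OF _ \<open>E \<subseteq> ?B\<close>, of "g t"] isoperimetric[OF _ \<open>F \<subseteq> ?B\<close>, of "g s"] t(1)
    by (simp_all add: lE ME nF)
  \<comment> \<open>The layer at height \<open>t\<close> has positive mass, hence positive perimeter, which forces \<open>D > 0\<close> below.\<close>
  have gt: "0 < g t"
    using iso(1) t0(3) g(2)[of t] by (cases "g t = 0") auto
  define D where "D = n * S t + M t * S s"
  have "0 < n * g t + M t * g s"
    using n gt t0(3) g(2)[of s] by (intro add_pos_nonneg) auto
  with key have "0 < \<kappa> * D" by (simp add: D_def)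
  then have D: "0 < D" using \<kappa> by (simp add: zero_less_mult_iff)
  \<comment> \<open>The ratio of the weights \<open>a\<close> and \<open>b\<close> makes the integral of \<open>u\<close> zero, and the factor \<open>c / D\<close> normalises
    the integral over \<open>\<Omega>s\<close>.\<close>
  define a b where "a = c * n / D" and "b = c * M t / D"
  have ab: "0 < a" "0 < b" using c n t0(3) D by (simp_all add: a_def b_def)
  define u where "u x = a * layer t v x + b * layer s v x" for x
  have abg: "a * g t + b * g s \<le> T"
  proof -
    have "a * g t + b * g s = (c / D) * (n * g t + M t * g s)"
      by (simp add: a_def b_def distrib_left add_divide_distrib mult_ac)
    also have "\<dots> \<le> (c / D) * (\<kappa> * D)" using key c D by (intro mult_left_mono) (auto simp: D_def)
    also have "\<dots> = T" using c D by (simp add: \<kappa>_def)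
    finally show ?thesis .
  qed
  have TVu: "TV u \<le> ereal T"
  proof -
    have "TV u \<le> ereal (a * g t + b * g s)"
      unfolding u_def[abs_def] using ab by (intro TV_linear_le il t(1) s(1)) auto
    also have "\<dots> \<le> ereal T" using abg by simp
    finally show ?thesis .
  qed
  have EF: "E \<inter> F = {}" using t0 s0 by (auto simp: E_def F_def)
  have u_eq: "u x = a * indicator E x - b * indicator F x" for x
    by (simp add: u_def lE lF)
  have fin: "emeasure lborel E < \<infinity>" "emeasure lborel F < \<infinity>"
    using emeasure_mono[OF \<open>E \<subseteq> ?B\<close>, of lborel] emeasure_mono[OF \<open>F \<subseteq> ?B\<close>, of lborel]
      emeasure_lborel_cball_finite[of "0::real^2" R] by (auto intro: le_less_trans)
  have ils: "integrable lborel (\<lambda>x. layer t v x * indicator \<Omega>s x)" for t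
    by (rule integrable_mult_bounded[where B = 1, OF il]) (auto simp: indicator_def)
  have "u \<in> representatives \<Omega> \<Omega>s"
    unfolding representatives_def mem_Collect_eq
  proof (intro conjI allI impI ballI)
    show "integrable lborel u" unfolding u_def[abs_def] using il by simp
    show "u x = 0" if "x \<notin> \<Omega>" for x using layer_at_zero[of v x, OF voff[OF that]] by (simp add: u_def)
    show "TV u < \<infinity>" using TVu by (auto intro: le_less_trans)
    have "(\<integral>x. u x \<partial>lborel) = a * M t + b * M s" unfolding u_def using il by (simp add: M_def)
    also have "\<dots> = 0" using D by (simp add: a_def b_def n_def field_simps)
    finally show "(\<integral>x. u x \<partial>lborel) = 0" .
    have "(\<integral>x. u x * indicator \<Omega>s x \<partial>lborel) = a * S t + b * S s"
      unfolding u_def using ils by (simp add: S_def distrib_right mult.assoc)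
    also have "\<dots> = (c / D) * D" by (simp add: a_def b_def D_def distrib_left add_divide_distrib mult_ac)
    finally show "(\<integral>x. u x * indicator \<Omega>s x \<partial>lborel) = measure lborel \<Omega>s"
      using D by (simp add: c_def)
    show "dist_grad u \<phi> = 0" if "\<phi> \<in> test_fields \<Omega>s" for \<phi>
      unfolding u_def[abs_def] dist_grad_linear[OF il il that]
      using dist_grad_layer_zero[OF iv v0 T \<Omega>s(1) v_grad that] by simp
  qed
  moreover have "card (range u - {0}) = 2"
  proof -
    have "E \<noteq> {}" "F \<noteq> {}" using ME nF t0(3) n by auto
    then obtain x y where "x \<in> E" "y \<in> F" by blast
    then have "u x = a" "u y = - b" using EF by (auto simp: u_eq indicator_def)
    then have "a \<in> range u" "- b \<in> range u" by (metis rangeI)+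
    moreover have "u z \<in> {a, - b, 0}" for z
      using EF by (auto simp: u_eq indicator_def)
    ultimately have "range u - {0} = {a, - b}" using ab by auto
    then show ?thesis using ab by simp
  qed
  moreover have u2: "(u x)\<^sup>2 = a\<^sup>2 * indicator E x + b\<^sup>2 * indicator F x" for x
    using EF by (auto simp: u_eq indicator_def)
  have iu2: "integrable lborel (\<lambda>x. (u x)\<^sup>2)"
    unfolding u2 using fin by simp
  moreover have "(\<integral>x. (u x)\<^sup>2 \<partial>lborel) \<le> 24 * T\<^sup>2"
  proof -
    have "(\<integral>x. (u x)\<^sup>2 \<partial>lborel) = a\<^sup>2 * M t + b\<^sup>2 * n"
      unfolding u2 ME nF using fin by simp
    also have "\<dots> \<le> a\<^sup>2 * (24 * (g t)\<^sup>2) + b\<^sup>2 * (24 * (g s)\<^sup>2)"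
      using iso by (intro add_mono mult_left_mono) auto
    also have "\<dots> = 24 * ((a * g t)\<^sup>2 + (b * g s)\<^sup>2)" by (simp add: power_mult_distrib)
    also have "\<dots> \<le> 24 * (a * g t + b * g s)\<^sup>2"
      using ab g(2)[of t] g(2)[of s] by (simp add: power2_sum)
    also have "\<dots> \<le> 24 * T\<^sup>2"
      using abg ab g(2)[of t] g(2)[of s] by (intro mult_left_mono power_mono) auto
    finally show ?thesis .
  qed
  ultimately show ?thesis using TVu by blast
qed

section \<open>Existence of a minimizer\<close>

lemma mollify_eq_const:
  fixes f :: "real^2 \<Rightarrow> real"
  assumes r: "0 < r" and c: "\<And>y. y \<in> ball x r \<Longrightarrow> f y = c"
  shows "mollify r f x = c"
proof -
  have "mollifier r (x - y) *\<^sub>R f y = mollifier r (x - y) * c" for y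
    using c mollifier_zero[OF r, of "x - y"] by (cases "y \<in> ball x r") (auto simp: dist_norm)
  then show ?thesis
    using integral_mollifier_shift[OF r, of x] by (simp add: mollify_def del: real_scaleR_def)
qed

text \<open>
  The mollification of \<open>1\<^sub>A - \<gamma> * 1\<^sub>B\<close> is admissible, where \<open>A\<close> is a small neighbourhood of the closure of
  \<open>\<Omega>s\<close>, \<open>B\<close> is a small disc in the rest of \<open>\<Omega>\<close>, and \<open>\<gamma>\<close> makes the integral vanish.
\<close>

lemma representatives_nonempty:
  assumes \<Omega>: "open \<Omega>" "bounded \<Omega>" and \<Omega>s: "open \<Omega>s" "\<Omega>s \<noteq> {}" and sub: "closure \<Omega>s \<subseteq> \<Omega>"
  shows "representatives \<Omega> \<Omega>s \<noteq> {}"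
proof -
  let ?K = "closure \<Omega>s"
  have K: "compact ?K"
    using \<Omega>(2) sub by (meson bounded_subset closed_closure compact_eq_bounded_closed)
  obtain d where d: "d > 0" "(\<Union>x\<in>?K. ball x d) \<subseteq> \<Omega>"
    using compact_subset_open_imp_ball_epsilon_subset[OF K \<Omega>(1) sub] .
  \<comment> \<open>Otherwise \<open>\<Omega>\<close> would be open, closed, nonempty and bounded.\<close>
  have "\<not> \<Omega> \<subseteq> ?K"
  proof
    assume "\<Omega> \<subseteq> ?K"
    then have "closed \<Omega>" using sub by (metis closed_closure subset_antisym)
    then have "\<Omega> = {} \<or> \<Omega> = UNIV" using \<Omega>(1) clopen by blast
    then show False using \<Omega>(2) sub \<Omega>s(2) closure_subset[of \<Omega>s] not_bounded_UNIV by auto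
  qed
  then obtain p where p: "p \<in> \<Omega> - ?K" by blast
  have "open (\<Omega> - ?K)" using \<Omega>(1) by (intro open_Diff) auto
  then obtain q where q: "q > 0" "ball p q \<subseteq> \<Omega> - ?K" using p by (meson openE)
  define r where "r = min (d / 2) (q / 2)"
  have r: "0 < r" "2 * r \<le> d" "2 * r \<le> q" using d q by (auto simp: r_def)
  define A where "A = (\<Union>x\<in>?K. ball x r)"
  define B where "B = ball p r"
  have [measurable]: "A \<in> sets borel" "B \<in> sets borel" by (auto simp: A_def B_def intro!: borel_open)
  have near_A: "x \<in> \<Omega>" if "y \<in> A" "y \<in> ball x r" for x y
  proof -
    from that obtain k where k: "k \<in> ?K" "dist k y < r" by (auto simp: A_def)
    then have "dist k x < d" using that(2) r(2) dist_triangle[of k x y] by (simp add: dist_commute)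
    then have "x \<in> ball k d" by simp
    then show ?thesis using d(2) k(1) by blast
  qed
  have near_B: "x \<in> \<Omega> - ?K" if "y \<in> B" "y \<in> ball x r" for x y
  proof -
    have "dist p x < q" using that r(3) dist_triangle[of p x y] by (simp add: B_def dist_commute)
    then show ?thesis using q(2) by auto
  qed
  have AB: "A \<subseteq> \<Omega>" "B \<subseteq> \<Omega>" using near_A near_B r(1) by auto
  obtain R where R: "\<And>x. x \<in> \<Omega> \<Longrightarrow> norm x \<le> R" using \<Omega>(2) bounded_iff by metis
  have fin: "emeasure lborel A < \<infinity>" "emeasure lborel B < \<infinity>"
    using bounded_subset[OF \<Omega>(2) AB(1)] bounded_subset[OF \<Omega>(2) AB(2)] emeasure_bounded_finite by blast+
  have mB: "0 < measure lborel B" unfolding B_def by (rule content_ball_pos[OF r(1)])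
  define \<gamma> where "\<gamma> = measure lborel A / measure lborel B"
  define f :: "real^2 \<Rightarrow> real" where "f x = indicator A x - \<gamma> * indicator B x" for x
  have f: "integrable lborel f" "(\<integral>x. f x \<partial>lborel) = 0"
    unfolding f_def[abs_def] using fin mB by (simp_all add: \<gamma>_def)
  have f0: "f y = 0" if "norm y > R" for y
    using R[of y] that AB by (auto simp: f_def indicator_def)
  let ?v = "mollify r f"
  have v1: "?v x = 1" if "x \<in> ?K" for x
  proof (rule mollify_eq_const[OF r(1)])
    fix y assume "y \<in> ball x r"
    then show "f y = 1"
      using that near_B[of y x] by (auto simp: f_def A_def indicator_def)
  qed
  have iv: "integrable lborel ?v" using mollify_integrable(1)[OF r(1) f(1)] .
  have "?v \<in> representatives \<Omega> \<Omega>s"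
    unfolding representatives_def mem_Collect_eq
  proof (intro conjI allI impI ballI)
    show "integrable lborel ?v" by (rule iv)
    show "?v x = 0" if "x \<notin> \<Omega>" for x
    proof (rule mollify_zero[OF r(1)])
      show "f y = 0" if "y \<in> ball x r" for y
        using near_A[OF _ that] near_B[OF _ that] \<open>x \<notin> \<Omega>\<close> by (auto simp: f_def indicator_def)
    qed
    have "TV ?v \<le> ereal (\<integral>x. norm (mollify_grad r f x) \<partial>lborel)"
      by (intro TV_leI dist_grad_le_integral_norm[OF mollify_has_grad[OF r(1) f(1)]
            continuous_mollify_grad[OF r(1) f(1)] mollify_grad_integrable[OF r(1) f(1) f0]])
    then show "TV ?v < \<infinity>" by (auto intro: le_less_trans)
    show "(\<integral>x. ?v x \<partial>lborel) = 0" using mollify_integrable(2)[OF r(1) f(1)] f(2) by simp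
    have "(\<lambda>x. ?v x * indicator \<Omega>s x) = indicator \<Omega>s"
      using v1 closure_subset[of \<Omega>s] by (auto simp: indicator_def fun_eq_iff)
    then show "(\<integral>x. ?v x * indicator \<Omega>s x \<partial>lborel) = measure lborel \<Omega>s" by simp
    fix \<phi> assume \<phi>: "\<phi> \<in> test_fields \<Omega>s"
    obtain C where C: "compact C" "C \<subseteq> \<Omega>s" "\<And>x. x \<notin> C \<Longrightarrow> \<phi> x = 0"
      using test_fieldsD(4)[OF \<phi>] by blast
    have "?v x * divergence \<phi> x = divergence \<phi> x" for x
      using v1[of x] closure_subset[of \<Omega>s] C(2)
        divergence_zero_off[OF \<phi> compact_imp_closed[OF C(1)] C(3), of x] by (cases "x \<in> C") auto
    then have "(\<lambda>x. ?v x * divergence \<phi> x) = divergence \<phi>" by (rule ext)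
    then show "dist_grad ?v \<phi> = 0"
      using dist_grad_lborel[OF _ \<phi>, of ?v] iv integral_divergence_eq_0[OF \<phi>] by simp
  qed
  then show ?thesis by blast
qed

lemma representatives_convex:
  assumes f: "f \<in> representatives \<Omega> \<Omega>s" "TV f \<le> ereal T" and h: "h \<in> representatives \<Omega> \<Omega>s" "TV h \<le> ereal T"
    and \<Omega>s: "\<Omega>s \<in> sets borel"
  shows "(\<lambda>x. 1/2 * f x + 1/2 * h x) \<in> representatives \<Omega> \<Omega>s" "TV (\<lambda>x. 1/2 * f x + 1/2 * h x) \<le> ereal T"
proof -
  let ?u = "\<lambda>x. 1/2 * f x + 1/2 * h x"
  have i: "integrable lborel f" "integrable lborel h" using f h by (auto simp: representatives_def)
  have TVu: "TV ?u \<le> ereal (1/2 * T + 1/2 * T)"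
    by (rule TV_linear_le[OF i(1) f(2) i(2) h(2)]) auto
  then show "TV ?u \<le> ereal T" by simp
  have "integrable lborel (\<lambda>x. f x * indicator \<Omega>s x)" "integrable lborel (\<lambda>x. h x * indicator \<Omega>s x)"
    using \<Omega>s by (auto intro!: integrable_mult_bounded[where B = 1] i simp: indicator_def)
  then have "(\<integral>x. ?u x * indicator \<Omega>s x \<partial>lborel) = measure lborel \<Omega>s"
    using f(1) h(1) unfolding distrib_right mult.assoc by (simp add: representatives_def)
  moreover have "dist_grad ?u \<phi> = 0" if "\<phi> \<in> test_fields \<Omega>s" for \<phi>
    unfolding dist_grad_linear[OF i that] using f(1) h(1) that by (simp add: representatives_def)
  moreover have "TV ?u < \<infinity>" using TVu by (auto intro: le_less_trans)
  ultimately show "?u \<in> representatives \<Omega> \<Omega>s"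
    using f(1) h(1) i by (simp add: representatives_def)
qed

text \<open>
  \<open>L\<^sup>1\<close> is complete, in the form of a subsequence of a Cauchy sequence.
\<close>

lemma L1_cauchy_subsequence_limit:
  fixes w :: "nat \<Rightarrow> 'a \<Rightarrow> real"
  assumes w: "\<And>n. integrable M (w n)"
    and cauchy: "\<And>e. e > 0 \<Longrightarrow> \<exists>N. \<forall>i\<ge>N. \<forall>j\<ge>N. (\<integral>x. \<bar>w i x - w j x\<bar> \<partial>M) < e"
  obtains r W where "strict_mono r" "integrable M W" "(\<lambda>i. \<integral>x. \<bar>w (r i) x - W x\<bar> \<partial>M) \<longlonglongrightarrow> 0"
    "\<And>x. (\<And>n. w n x = 0) \<Longrightarrow> W x = 0"
proof -
  have [measurable]: "w n \<in> borel_measurable M" for n using w by auto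
  obtain r where r: "strict_mono r" and c: "AE x in M. Cauchy (\<lambda>i. w (r i) x)"
    by (rule cauchy_L1_AE_cauchy_subseq[of M w]) (use w cauchy in auto)
  define W where "W x = lim (\<lambda>i. w (r i) x)" for x
  have mW[measurable]: "W \<in> borel_measurable M" unfolding W_def[abs_def] by measurable
  have lim: "AE x in M. (\<lambda>i. w (r i) x) \<longlonglongrightarrow> W x"
    using c by eventually_elim (simp add: W_def convergent_LIMSEQ_iff Cauchy_convergent_iff)
  have bd: "(\<integral>\<^sup>+x. ennreal \<bar>w i x - W x\<bar> \<partial>M) \<le> ennreal e"
    if N: "\<forall>i\<ge>N. \<forall>j\<ge>N. (\<integral>x. \<bar>w i x - w j x\<bar> \<partial>M) < e" "i \<ge> N" for N i e
  proof -
    have "(\<integral>\<^sup>+x. ennreal \<bar>w i x - W x\<bar> \<partial>M) = (\<integral>\<^sup>+x. liminf (\<lambda>j. ennreal \<bar>w i x - w (r j) x\<bar>) \<partial>M)"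
    proof (rule nn_integral_cong_AE)
      show "AE x in M. ennreal \<bar>w i x - W x\<bar> = liminf (\<lambda>j. ennreal \<bar>w i x - w (r j) x\<bar>)"
        using lim
      proof eventually_elim
        case (elim x)
        then have "(\<lambda>j. ennreal \<bar>w i x - w (r j) x\<bar>) \<longlonglongrightarrow> ennreal \<bar>w i x - W x\<bar>"
          by (intro tendsto_ennrealI tendsto_rabs tendsto_diff tendsto_const)
        from lim_imp_Liminf[OF _ this] show ?case by simp
      qed
    qed
    also have "\<dots> \<le> liminf (\<lambda>j. \<integral>\<^sup>+x. ennreal \<bar>w i x - w (r j) x\<bar> \<partial>M)"
      by (rule nn_integral_liminf) measurable
    also have "\<dots> \<le> liminf (\<lambda>j::nat. ennreal e)"
    proof (intro Liminf_mono eventually_sequentiallyI)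
      fix j assume "N \<le> j"
      then have "N \<le> r j" using seq_suble[OF r, of j] by simp
      then have "(\<integral>x. \<bar>w i x - w (r j) x\<bar> \<partial>M) \<le> e" using N by (meson less_imp_le)
      moreover have "(\<integral>\<^sup>+x. ennreal \<bar>w i x - w (r j) x\<bar> \<partial>M) = ennreal (\<integral>x. \<bar>w i x - w (r j) x\<bar> \<partial>M)"
        using w by (subst nn_integral_eq_integral) auto
      ultimately show "(\<integral>\<^sup>+x. ennreal \<bar>w i x - w (r j) x\<bar> \<partial>M) \<le> ennreal e"
        by (simp add: ennreal_leI)
    qed
    finally show ?thesis by (simp add: Liminf_const)
  qed
  have diff: "integrable M (\<lambda>x. w i x - W x)" if "\<forall>i\<ge>N. \<forall>j\<ge>N. (\<integral>x. \<bar>w i x - w j x\<bar> \<partial>M) < e" "i \<ge> N" for N i e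
  proof (rule integrableI_bounded)
    show "(\<integral>\<^sup>+x. ennreal (norm (w i x - W x)) \<partial>M) < \<infinity>"
      using bd[OF that] by (auto intro: le_less_trans)
  qed simp
  have iW: "integrable M W"
  proof -
    obtain N where "\<forall>i\<ge>N. \<forall>j\<ge>N. (\<integral>x. \<bar>w i x - w j x\<bar> \<partial>M) < 1" using cauchy[of 1] by auto
    then have "integrable M (\<lambda>x. w N x - (w N x - W x))"
      by (intro Bochner_Integration.integrable_diff w diff[of N]) auto
    then show ?thesis by simp
  qed
  have "(\<lambda>i. \<integral>x. \<bar>w (r i) x - W x\<bar> \<partial>M) \<longlonglongrightarrow> 0"
  proof (rule LIMSEQ_I)
    fix e :: real assume e: "e > 0"
    then obtain N where N: "\<forall>i\<ge>N. \<forall>j\<ge>N. (\<integral>x. \<bar>w i x - w j x\<bar> \<partial>M) < e/2" using cauchy[of "e/2"] by auto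
    have "norm ((\<integral>x. \<bar>w (r i) x - W x\<bar> \<partial>M) - 0) < e" if "i \<ge> N" for i
    proof -
      have "N \<le> r i" using seq_suble[OF r, of i] that by simp
      have "ennreal (\<integral>x. \<bar>w (r i) x - W x\<bar> \<partial>M) = (\<integral>\<^sup>+x. ennreal \<bar>w (r i) x - W x\<bar> \<partial>M)"
        using w iW by (subst nn_integral_eq_integral) auto
      also have "\<dots> \<le> ennreal (e/2)" by (rule bd[OF N \<open>N \<le> r i\<close>])
      finally have "(\<integral>x. \<bar>w (r i) x - W x\<bar> \<partial>M) \<le> e/2" using e by (simp add: ennreal_le_iff)
      then show ?thesis using e by simp
    qed
    then show "\<exists>N. \<forall>i\<ge>N. norm ((\<integral>x. \<bar>w (r i) x - W x\<bar> \<partial>M) - 0) < e" by blast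
  qed
  moreover have "W x = 0" if "\<And>n. w n x = 0" for x
    using that by (simp add: W_def)
  ultimately show thesis using that r iW by blast
qed

lemma L1_tendsto_integral_mult:
  fixes w :: "nat \<Rightarrow> 'a::euclidean_space \<Rightarrow> real"
  assumes w: "\<And>i. integrable lborel (w i)" and W: "integrable lborel W"
    and lim: "(\<lambda>i. \<integral>x. \<bar>w i x - W x\<bar> \<partial>lborel) \<longlonglongrightarrow> 0"
    and h: "h \<in> borel_measurable borel" "\<And>x. \<bar>h x\<bar> \<le> B"
  shows "(\<lambda>i. \<integral>x. w i x * h x \<partial>lborel) \<longlonglongrightarrow> (\<integral>x. W x * h x \<partial>lborel)"
proof -
  have "(\<lambda>i. (\<integral>x. w i x * h x \<partial>lborel) - (\<integral>x. W x * h x \<partial>lborel)) \<longlonglongrightarrow> 0"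
  proof (rule Lim_null_comparison)
    have "\<bar>(\<integral>x. w i x * h x \<partial>lborel) - (\<integral>x. W x * h x \<partial>lborel)\<bar> \<le> B * (\<integral>x. \<bar>w i x - W x\<bar> \<partial>lborel)" for i
    proof -
      have B: "0 \<le> B" using h(2)[of 0] by linarith
      have i: "integrable lborel (\<lambda>x. w i x * h x)" "integrable lborel (\<lambda>x. W x * h x)"
        by (rule integrable_mult_bounded[OF w h], rule integrable_mult_bounded[OF W h])
      have "(\<integral>x. w i x * h x \<partial>lborel) - (\<integral>x. W x * h x \<partial>lborel) = (\<integral>x. (w i x - W x) * h x \<partial>lborel)"
        using i by (simp add: left_diff_distrib)
      also have "\<bar>\<dots>\<bar> \<le> (\<integral>x. \<bar>(w i x - W x) * h x\<bar> \<partial>lborel)" by (rule integral_abs_bound)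
      also have "\<dots> \<le> (\<integral>x. B * \<bar>w i x - W x\<bar> \<partial>lborel)"
      proof (rule Bochner_Integration.integral_mono')
        show "integrable lborel (\<lambda>x. B * \<bar>w i x - W x\<bar>)" using w W by simp
        show "\<bar>(w i x - W x) * h x\<bar> \<le> B * \<bar>w i x - W x\<bar>" for x
          using h(2)[of x] by (simp add: abs_mult mult.commute[of B] mult_left_mono)
      qed (use B in simp)
      also have "\<dots> = B * (\<integral>x. \<bar>w i x - W x\<bar> \<partial>lborel)" by simp
      finally show ?thesis .
    qed
    then show "\<forall>\<^sub>F i in sequentially. norm ((\<integral>x. w i x * h x \<partial>lborel) - (\<integral>x. W x * h x \<partial>lborel))
        \<le> B * (\<integral>x. \<bar>w i x - W x\<bar> \<partial>lborel)"
      by (intro always_eventually) simp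
    show "(\<lambda>i. B * (\<integral>x. \<bar>w i x - W x\<bar> \<partial>lborel)) \<longlonglongrightarrow> 0"
      using tendsto_mult[OF tendsto_const lim, of B] by simp
  qed
  then show ?thesis by (rule LIM_zero_cancel)
qed

lemma dist_grad_L1_tendsto:
  assumes w: "\<And>i. integrable lborel (w i)" and W: "integrable lborel W"
    and lim: "(\<lambda>i. \<integral>x. \<bar>w i x - W x\<bar> \<partial>lborel) \<longlonglongrightarrow> 0" and \<phi>: "\<phi> \<in> test_fields U"
  shows "(\<lambda>i. dist_grad (w i) \<phi>) \<longlonglongrightarrow> dist_grad W \<phi>"
proof -
  obtain B where B: "\<And>x. \<bar>divergence \<phi> x\<bar> \<le> B" using divergence_bounded[OF \<phi>] by blast
  have m: "w i \<in> borel_measurable borel" "W \<in> borel_measurable borel" for i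
    using borel_measurable_integrable[OF w] borel_measurable_integrable[OF W] by auto
  show ?thesis
    unfolding dist_grad_lborel[OF m(1) \<phi>] dist_grad_lborel[OF m(2) \<phi>]
    by (intro tendsto_minus L1_tendsto_integral_mult[OF w W lim borel_measurable_divergence[OF \<phi>] B])
qed

text \<open>
  The constraints are closed and the total variation is lower semicontinuous under \<open>L\<^sup>1\<close> convergence.
\<close>

lemma representatives_L1_closed:
  assumes w: "\<And>i. w i \<in> representatives \<Omega> \<Omega>s" and W: "integrable lborel W"
    and lim: "(\<lambda>i. \<integral>x. \<bar>w i x - W x\<bar> \<partial>lborel) \<longlonglongrightarrow> 0" and W0: "\<And>x. x \<notin> \<Omega> \<Longrightarrow> W x = 0"
    and T: "\<And>i. TV (w i) \<le> ereal (T i)" "T \<longlonglongrightarrow> T'" and \<Omega>s: "\<Omega>s \<in> sets borel"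
  shows "W \<in> representatives \<Omega> \<Omega>s" "TV W \<le> ereal T'"
proof -
  have iw: "integrable lborel (w i)" for i using w[of i] by (simp add: representatives_def)
  show TVW: "TV W \<le> ereal T'"
  proof (rule TV_leI)
    fix \<phi> assume \<phi>: "\<phi> \<in> test_fields UNIV" "\<And>x. norm (\<phi> x) \<le> 1"
    show "dist_grad W \<phi> \<le> T'"
      by (rule LIMSEQ_le[OF dist_grad_L1_tendsto[OF iw W lim \<phi>(1)] T(2)])
        (use TV_leD[OF T(1) \<phi>] in auto)
  qed
  have "(\<lambda>i. \<integral>x. w i x * 1 \<partial>lborel) \<longlonglongrightarrow> (\<integral>x. W x * 1 \<partial>lborel)"
    by (rule L1_tendsto_integral_mult[OF iw W lim, of _ 1]) auto
  then have 1: "(\<integral>x. W x \<partial>lborel) = 0"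
    using w by (simp add: representatives_def LIMSEQ_const_iff)
  have "(\<lambda>i. \<integral>x. w i x * indicator \<Omega>s x \<partial>lborel) \<longlonglongrightarrow> (\<integral>x. W x * indicator \<Omega>s x \<partial>lborel)"
    by (rule L1_tendsto_integral_mult[OF iw W lim, of _ 1]) (use \<Omega>s in \<open>auto simp: indicator_def\<close>)
  then have 2: "(\<integral>x. W x * indicator \<Omega>s x \<partial>lborel) = measure lborel \<Omega>s"
    using w by (simp add: representatives_def LIMSEQ_const_iff)
  have 3: "dist_grad W \<phi> = 0" if "\<phi> \<in> test_fields \<Omega>s" for \<phi>
  proof -
    have "dist_grad (w i) \<phi> = 0" for i using w[of i] that by (simp add: representatives_def)
    then show ?thesis using dist_grad_L1_tendsto[OF iw W lim that] by (simp add: LIMSEQ_const_iff)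
  qed
  have "TV W < \<infinity>" using TVW by (auto intro: le_less_trans)
  then show "W \<in> representatives \<Omega> \<Omega>s" using W W0 1 2 3 by (simp add: representatives_def)
qed

text \<open>
  The sets \<open>C n\<close> of square integrable competitors with total variation within \<open>\<delta> n\<close> of the infimum are
  convex, decreasing, and contain elements of uniformly bounded \<open>L\<^sup>2\<close> norm. Elements of almost minimal
  norm therefore form a Cauchy sequence in \<open>L\<^sup>2\<close>, by the parallelogram law, and its limit is a minimizer.
\<close>

lemma minimizer_exists:
  assumes ne: "representatives \<Omega> \<Omega>s \<noteq> {}"
    and \<Omega>: "open \<Omega>" "bounded \<Omega>" and \<Omega>s: "open \<Omega>s" "0 < measure lborel \<Omega>s"
  shows "\<exists>W \<in> representatives \<Omega> \<Omega>s. \<forall>v \<in> representatives \<Omega> \<Omega>s. TV W \<le> TV v"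
proof -
  let ?A = "representatives \<Omega> \<Omega>s"
  have [measurable]: "\<Omega> \<in> sets borel" "\<Omega>s \<in> sets borel" using \<Omega> \<Omega>s by auto
  define \<tau> where "\<tau> v = real_of_ereal (TV v)" for v
  have \<tau>: "TV v = ereal (\<tau> v)" if "v \<in> ?A" for v
    using that TV_nonneg[of v] unfolding \<tau>_def by (cases "TV v") (auto simp: representatives_def)
  have \<tau>0: "0 \<le> \<tau> v" for v using TV_nonneg[of v] by (simp add: \<tau>_def real_of_ereal_pos)
  define m where "m = Inf (\<tau> ` ?A)"
  have bb: "bdd_below (\<tau> ` ?A)" using \<tau>0 by (intro bdd_belowI[of _ 0]) auto
  have m_le: "m \<le> \<tau> v" if "v \<in> ?A" for v unfolding m_def by (rule cINF_lower[OF bb that])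
  define \<delta> where "\<delta> n = inverse (real (Suc n))" for n
  have \<delta>: "0 < \<delta> n" "\<delta> n \<le> 1" for n by (auto simp: \<delta>_def inverse_le_1_iff)
  have \<delta>_mono: "\<delta> k \<le> \<delta> n" if "n \<le> k" for n k using that by (simp add: \<delta>_def le_imp_inverse_le)
  have \<delta>_lim: "\<delta> \<longlonglongrightarrow> 0" unfolding \<delta>_def by (rule LIMSEQ_inverse_real_of_nat)
  define q where "q v = (\<integral>x. (v x)\<^sup>2 \<partial>lborel)" for v :: "real^2 \<Rightarrow> real"
  have q0: "0 \<le> q v" for v by (simp add: q_def)
  define C where "C n = {v \<in> ?A. TV v \<le> ereal (m + \<delta> n) \<and> integrable lborel (\<lambda>x. (v x)\<^sup>2)}" for n
  define Q where "Q = 24 * (m + 1)\<^sup>2"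
  have m0: "0 \<le> m" unfolding m_def using ne \<tau>0 by (intro cINF_greatest) auto
  have C_ne: "\<exists>u \<in> C n. q u \<le> Q" for n
  proof -
    have "Inf (\<tau> ` ?A) < m + \<delta> n" using \<delta>(1)[of n] by (simp add: m_def)
    then obtain v where v: "v \<in> ?A" "\<tau> v < m + \<delta> n"
      using cInf_lessD[of "\<tau> ` ?A"] ne by blast
    then have "TV v \<le> ereal (m + \<delta> n)" by (simp add: \<tau>)
    from two_level_competitor[OF v(1) this \<Omega>(2) \<Omega>s] obtain u where
      u: "u \<in> C n" "q u \<le> 24 * (m + \<delta> n)\<^sup>2" by (auto simp: C_def q_def)
    have "24 * (m + \<delta> n)\<^sup>2 \<le> Q"
      unfolding Q_def using m0 \<delta>[of n] by (intro mult_left_mono power_mono) auto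
    with u show ?thesis by (meson order_trans)
  qed
  have C_mono: "C k \<subseteq> C n" if "n \<le> k" for n k
  proof -
    have "ereal (m + \<delta> k) \<le> ereal (m + \<delta> n)" using \<delta>_mono[OF that] by simp
    then show ?thesis by (auto simp: C_def intro: order_trans)
  qed
  define d where "d n = Inf (q ` C n)" for n
  have bbq: "bdd_below (q ` C n)" for n using q0 by (intro bdd_belowI[of _ 0]) auto
  have d_le: "d n \<le> q u" if "u \<in> C n" for u n unfolding d_def by (rule cINF_lower[OF bbq that])
  have "C n \<noteq> {}" for n using C_ne[of n] by blast
  then have "incseq d"
    unfolding d_def incseq_def using C_mono bbq
    by (intro allI impI cInf_superset_mono image_mono) auto
  moreover have "d n \<le> Q" for n using C_ne[of n] d_le[of _ n] by (meson order_trans)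
  ultimately have "convergent d"
    by (meson incseq_convergent convergentI)
  then have d_cauchy: "Cauchy d" by (rule convergent_Cauchy)
  have "\<exists>u. u \<in> C n \<and> q u < d n + \<delta> n" for n
  proof -
    have "Inf (q ` C n) < d n + \<delta> n" using \<delta>(1)[of n] by (simp add: d_def)
    then show ?thesis using cInf_lessD[of "q ` C n"] C_ne[of n] by blast
  qed
  then obtain w where w: "\<And>n. w n \<in> C n" "\<And>n. q (w n) < d n + \<delta> n" by metis
  have wA: "w n \<in> ?A" and wT: "TV (w n) \<le> ereal (m + \<delta> n)" and w2: "integrable lborel (\<lambda>x. (w n x)\<^sup>2)"
    and wi: "integrable lborel (w n)" and woff: "x \<notin> \<Omega> \<Longrightarrow> w n x = 0" for n x
    using w(1)[of n] by (auto simp: C_def representatives_def)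
  have [measurable]: "w n \<in> borel_measurable borel" for n using borel_measurable_integrable[OF wi] by simp
  have sq: "integrable lborel (\<lambda>x. (w n x - w k x)\<^sup>2)" "integrable lborel (\<lambda>x. (1/2 * w n x + 1/2 * w k x)\<^sup>2)" for n k
  proof -
    have i: "integrable lborel (\<lambda>x. 2 * (w n x)\<^sup>2 + 2 * (w k x)\<^sup>2)" using w2 by simp
    have "(a - b)\<^sup>2 \<le> 2 * a\<^sup>2 + 2 * b\<^sup>2" "(1/2 * a + 1/2 * b)\<^sup>2 \<le> 2 * a\<^sup>2 + 2 * b\<^sup>2" for a b :: real
    proof -
      have "(a - b)\<^sup>2 + (a + b)\<^sup>2 = 2 * a\<^sup>2 + 2 * b\<^sup>2" "(1/2 * a + 1/2 * b)\<^sup>2 = (a + b)\<^sup>2 / 4"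
        by (simp_all add: power2_eq_square field_simps)
      then show "(a - b)\<^sup>2 \<le> 2 * a\<^sup>2 + 2 * b\<^sup>2" "(1/2 * a + 1/2 * b)\<^sup>2 \<le> 2 * a\<^sup>2 + 2 * b\<^sup>2"
        using zero_le_power2[of "a - b"] zero_le_power2[of "a + b"] by linarith+
    qed
    then show "integrable lborel (\<lambda>x. (w n x - w k x)\<^sup>2)" "integrable lborel (\<lambda>x. (1/2 * w n x + 1/2 * w k x)\<^sup>2)"
      by (auto intro!: Bochner_Integration.integrable_bound[OF i])
  qed
  have parallelogram: "(\<integral>x. (w n x - w k x)\<^sup>2 \<partial>lborel) \<le> 2 * (d k - d n) + 2 * \<delta> n + 2 * \<delta> k" if "n \<le> k" for n k
  proof -
    let ?h = "\<lambda>x. 1/2 * w n x + 1/2 * w k x"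
    have "TV (w k) \<le> ereal (m + \<delta> n)" using C_mono[OF that] w(1)[of k] by (auto simp: C_def)
    from representatives_convex[OF wA wT wA this] have "?h \<in> C n"
      using sq(2) by (simp add: C_def)
    define z where "z = q ?h"
    have "d n \<le> z" unfolding z_def by (rule d_le) fact
    have "(\<integral>x. (w n x - w k x)\<^sup>2 \<partial>lborel) = (\<integral>x. 2 * (w n x)\<^sup>2 + 2 * (w k x)\<^sup>2 - 4 * (?h x)\<^sup>2 \<partial>lborel)"
      by (intro Bochner_Integration.integral_cong) (auto simp: power2_eq_square algebra_simps)
    also have "\<dots> = 2 * q (w n) + 2 * q (w k) - 4 * z"
      using w2 sq(2)[of n k] by (simp add: q_def z_def)
    also have "\<dots> \<le> 2 * (d k - d n) + 2 * \<delta> n + 2 * \<delta> k"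
      using \<open>d n \<le> z\<close> w(2)[of n] w(2)[of k] by argo
    finally show ?thesis .
  qed
  have L2: "\<exists>N. \<forall>i\<ge>N. \<forall>j\<ge>N. (\<integral>x. (w i x - w j x)\<^sup>2 \<partial>lborel) < e" if e: "e > 0" for e
  proof -
    obtain N1 where N1: "\<forall>i\<ge>N1. \<forall>j\<ge>N1. dist (d i) (d j) < e / 8"
      using metric_CauchyD[OF d_cauchy, of "e/8"] e by auto
    obtain N2 where N2: "\<delta> N2 < e / 8"
      using reals_Archimedean[of "e/8"] e by (auto simp: \<delta>_def)
    have *: "(\<integral>x. (w i x - w j x)\<^sup>2 \<partial>lborel) < e" if "i \<ge> max N1 N2" "j \<ge> i" for i j
    proof -
      have "dist (d j) (d i) < e / 8" using N1 that by auto
      then have "d j - d i < e / 8" by (simp only: dist_real_def abs_less_iff)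
      moreover have "\<delta> i < e / 8" "\<delta> j < e / 8"
        using \<delta>_mono[of N2 i] \<delta>_mono[of N2 j] N2 that by auto
      ultimately show ?thesis using parallelogram[OF that(2)] e by argo
    qed
    have "(\<integral>x. (w i x - w j x)\<^sup>2 \<partial>lborel) < e" if "i \<ge> max N1 N2" "j \<ge> max N1 N2" for i j
      using *[of i j] *[of j i] that by (cases "i \<le> j") (auto simp: power2_commute)
    then show ?thesis by blast
  qed
  define a where "a = measure lborel \<Omega>"
  have fin: "emeasure lborel \<Omega> < \<infinity>" using emeasure_bounded_finite[OF \<Omega>(2)] .
  have L1: "\<exists>N. \<forall>i\<ge>N. \<forall>j\<ge>N. (\<integral>x. \<bar>w i x - w j x\<bar> \<partial>lborel) < e" if e: "e > 0" for e
  proof -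
    define \<eta> where "\<eta> = e / (a + 1)"
    have a: "0 \<le> a" by (simp add: a_def)
    have \<eta>: "0 < \<eta>" "\<eta> * a \<le> e" using e a by (auto simp: \<eta>_def field_simps)
    obtain N where N: "\<forall>i\<ge>N. \<forall>j\<ge>N. (\<integral>x. (w i x - w j x)\<^sup>2 \<partial>lborel) < \<eta> * e"
      using L2[of "\<eta> * e"] \<eta> e by auto
    have "(\<integral>x. \<bar>w i x - w j x\<bar> \<partial>lborel) < e" if "i \<ge> N" "j \<ge> N" for i j
    proof -
      have "(\<integral>x. \<bar>w i x - w j x\<bar> \<partial>lborel) \<le> (\<integral>x. \<eta> / 2 * indicator \<Omega> x + (w i x - w j x)\<^sup>2 / (2 * \<eta>) \<partial>lborel)"
      proof (rule integral_mono)
        show "integrable lborel (\<lambda>x. \<eta> / 2 * indicator \<Omega> x + (w i x - w j x)\<^sup>2 / (2 * \<eta>))"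
          using sq(1) fin by simp
        fix x
        \<comment> \<open>Young's inequality.\<close>
        have "2 * \<eta> * \<bar>w i x - w j x\<bar> \<le> \<eta>\<^sup>2 + (w i x - w j x)\<^sup>2"
          using sum_squares_bound[of \<eta> "\<bar>w i x - w j x\<bar>"] by simp
        then have "\<bar>w i x - w j x\<bar> \<le> \<eta> / 2 + (w i x - w j x)\<^sup>2 / (2 * \<eta>)"
          using \<eta>(1) by (simp add: field_simps power2_eq_square)
        then show "\<bar>w i x - w j x\<bar> \<le> \<eta> / 2 * indicator \<Omega> x + (w i x - w j x)\<^sup>2 / (2 * \<eta>)"
          using woff[of x] by (cases "x \<in> \<Omega>") auto
      qed (use wi in simp)
      also have "\<dots> = \<eta> / 2 * a + (\<integral>x. (w i x - w j x)\<^sup>2 \<partial>lborel) / (2 * \<eta>)"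
        using sq(1)[of i j] fin by (simp add: a_def)
      also have "\<dots> < e / 2 + (\<eta> * e) / (2 * \<eta>)"
        using N that \<eta> by (intro add_le_less_mono divide_strict_right_mono) auto
      also have "\<dots> = e" using \<eta>(1) by simp
      finally show ?thesis .
    qed
    then show ?thesis by blast
  qed
  obtain r W where r: "strict_mono r" and W: "integrable lborel W"
    and lim: "(\<lambda>i. \<integral>x. \<bar>w (r i) x - W x\<bar> \<partial>lborel) \<longlonglongrightarrow> 0" and W0: "\<And>x. (\<And>n. w n x = 0) \<Longrightarrow> W x = 0"
    using L1_cauchy_subsequence_limit[OF wi L1] by blast
  have "(\<lambda>i. m + \<delta> (r i)) \<longlonglongrightarrow> m + 0"
    using LIMSEQ_subseq_LIMSEQ[OF \<delta>_lim r] by (intro tendsto_add tendsto_const) (simp add: comp_def)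
  from representatives_L1_closed[OF wA W lim _ wT this] W0 woff
  have "W \<in> ?A" "TV W \<le> ereal m" by auto
  moreover have "ereal m \<le> TV v" if "v \<in> ?A" for v using m_le[OF that] \<tau>[OF that] by simp
  ultimately show ?thesis by (meson order_trans)
qed

section \<open>Passing between classes and representatives\<close>

lemma dist_grad_cong_AE:
  assumes "AE x in lebesgue. v x = w x" and "v \<in> borel_measurable lebesgue" "w \<in> borel_measurable lebesgue"
    and \<phi>: "\<phi> \<in> test_fields U"
  shows "dist_grad v \<phi> = dist_grad w \<phi>"
proof -
  have [measurable]: "divergence \<phi> \<in> borel_measurable lebesgue"
    using borel_measurable_divergence[OF \<phi>] by (intro measurable_completion) simp
  note [measurable] = assms(2,3)
  have "(\<integral>x. v x * divergence \<phi> x \<partial>lebesgue) = (\<integral>x. w x * divergence \<phi> x \<partial>lebesgue)"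
    using assms(1) by (intro integral_cong_AE) auto
  then show ?thesis by (simp add: dist_grad_def)
qed

lemma TV_cong_AE:
  assumes "AE x in lebesgue. v x = w x" and "v \<in> borel_measurable lebesgue" "w \<in> borel_measurable lebesgue"
  shows "TV v = TV w"
  unfolding TV_def by (intro SUP_cong refl) (use dist_grad_cong_AE[OF assms] in auto)

lemma representatives_subset_BV_diamond:
  assumes v: "v \<in> representatives \<Omega> \<Omega>s" and \<Omega>: "open \<Omega>" and \<Omega>s: "open \<Omega>s" "0 < measure lborel \<Omega>s"
  shows "v \<in> BV_diamond \<Omega> \<Omega>s"
proof -
  have iv: "integrable lborel v" and voff: "\<And>x. x \<notin> \<Omega> \<Longrightarrow> v x = 0" using v by (auto simp: representatives_def)
  have [measurable]: "v \<in> borel_measurable borel" "\<Omega> \<in> sets borel" "\<Omega>s \<in> sets borel" using iv \<Omega> \<Omega>s by auto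
  have "integrable lebesgue v" using iv by (simp add: integrable_completion)
  moreover have "(LINT x:\<Omega>|lebesgue. v x) = (\<integral>x. v x \<partial>lborel)"
  proof -
    have "(\<lambda>x. indicator \<Omega> x *\<^sub>R v x) = v" using voff by (auto simp: indicator_def fun_eq_iff)
    then show ?thesis by (simp add: set_lebesgue_integral_def integral_completion)
  qed
  moreover have "(LINT x:\<Omega>s|lebesgue. v x) = (\<integral>x. v x * indicator \<Omega>s x \<partial>lborel)"
    by (simp add: set_lebesgue_integral_def integral_completion mult.commute)
  moreover have "measure lebesgue \<Omega>s = measure lborel \<Omega>s" by simp
  ultimately show ?thesis
    using v \<Omega>s(2) voff by (simp add: BV_diamond_def BV_def representatives_def)
qed

lemma BV_diamond_representative:
  assumes w: "w \<in> BV_diamond \<Omega> \<Omega>s" and \<Omega>: "open \<Omega>" and \<Omega>s: "open \<Omega>s" "0 < measure lborel \<Omega>s"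
  shows "\<exists>v \<in> representatives \<Omega> \<Omega>s. TV v = TV w"
proof -
  have iw: "integrable lebesgue w" and TVw: "TV w < \<infinity>" and w1: "(LINT x:\<Omega>|lebesgue. w x) = 0"
    and w2: "1 / measure lebesgue \<Omega>s * (LINT x:\<Omega>s|lebesgue. w x) = 1"
    and w3: "\<And>\<phi>. \<phi> \<in> test_fields \<Omega>s \<Longrightarrow> dist_grad w \<phi> = 0" and w4: "AE x in lebesgue. x \<notin> \<Omega> \<longrightarrow> w x = 0"
    using w by (auto simp: BV_diamond_def BV_def)
  have mw[measurable]: "w \<in> borel_measurable lebesgue" using iw by auto
  have [measurable]: "\<Omega> \<in> sets borel" "\<Omega>s \<in> sets borel" using \<Omega> \<Omega>s by auto
  obtain w' where [measurable]: "w' \<in> borel_measurable lborel" and w': "AE x in lborel. w x = w' x"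
    using completion_ex_borel_measurable_real[OF mw] by blast
  define v where "v x = indicator \<Omega> x * w' x" for x
  have mv[measurable]: "v \<in> borel_measurable borel" unfolding v_def[abs_def] by measurable
  have mv'[measurable]: "v \<in> borel_measurable lebesgue" by (intro measurable_completion) simp
  have "AE x in lebesgue. w x = w' x" using w' by (rule AE_completion)
  then have eq: "AE x in lebesgue. v x = w x"
    using w4 by eventually_elim (auto simp: v_def indicator_def)
  have "integrable lebesgue v"
    using eq iw by (subst integrable_cong_AE[where g = w]) auto
  then have iv: "integrable lborel v" by (simp add: integrable_completion)
  have TVeq: "TV v = TV w" by (rule TV_cong_AE[OF eq mv' mw])
  have set_eq: "(LINT x:S|lebesgue. w x) = (\<integral>x. v x * indicator S x \<partial>lborel)" if [measurable]: "S \<in> sets borel" for S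
  proof -
    have [measurable]: "S \<in> sets lebesgue" using that by (simp add: sets_completionI_sets)
    have "(LINT x:S|lebesgue. w x) = (\<integral>x. v x * indicator S x \<partial>lebesgue)"
      unfolding set_lebesgue_integral_def using eq by (intro integral_cong_AE) (auto simp: mult.commute)
    then show ?thesis by (simp add: integral_completion)
  qed
  have "v \<in> representatives \<Omega> \<Omega>s"
    unfolding representatives_def mem_Collect_eq
  proof (intro conjI allI impI ballI)
    show "v x = 0" if "x \<notin> \<Omega>" for x using that by (simp add: v_def)
    show "TV v < \<infinity>" using TVw TVeq by simp
    have "(\<lambda>x. v x * indicator \<Omega> x) = v" by (auto simp: v_def indicator_def fun_eq_iff)
    then show "(\<integral>x. v x \<partial>lborel) = 0" using w1 set_eq[of \<Omega>] by simp
    show "(\<integral>x. v x * indicator \<Omega>s x \<partial>lborel) = measure lborel \<Omega>s"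
      using w2 set_eq[of \<Omega>s] \<Omega>s(2) by (simp add: field_simps)
    show "dist_grad v \<phi> = 0" if "\<phi> \<in> test_fields \<Omega>s" for \<phi>
      using dist_grad_cong_AE[OF eq mv' mw that] w3[OF that] by simp
  qed (rule iv)
  with TVeq show ?thesis by blast
qed

theorem theorem5:
  fixes \<Omega> \<Omega>\<^sub>s :: "(real ^ 2) set"
  assumes "open \<Omega>" and "bounded \<Omega>" and "strongly_lipschitz \<Omega>"
    and "open \<Omega>\<^sub>s" and "bounded \<Omega>\<^sub>s" and "strongly_lipschitz \<Omega>\<^sub>s"
    and "\<Omega>\<^sub>s \<noteq> {}"
    and "\<Omega>\<^sub>s \<subseteq> \<Omega>"
    and "frontier \<Omega>\<^sub>s \<inter> frontier \<Omega> = {}"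
    and "finite (components \<Omega>\<^sub>s)"
  shows "\<exists>v \<in> BV_diamond \<Omega> \<Omega>\<^sub>s.
           (\<forall>w \<in> BV_diamond \<Omega> \<Omega>\<^sub>s. TV v \<le> TV w) \<and> card (range v - {0}) = 2"
proof -
  note \<Omega> = assms(1,2) and \<Omega>s = assms(4)
  \<comment> \<open>This is where the disjointness of the two boundaries enters.\<close>
  have "closure \<Omega>\<^sub>s \<subseteq> \<Omega>"
  proof
    fix x assume x: "x \<in> closure \<Omega>\<^sub>s"
    show "x \<in> \<Omega>"
    proof (cases "x \<in> \<Omega>\<^sub>s")
      case False
      then have "x \<in> frontier \<Omega>\<^sub>s" using x \<Omega>s by (simp add: frontier_def interior_open)
      then have "x \<notin> frontier \<Omega>" using assms(9) by blast
      moreover have "x \<in> closure \<Omega>" using x closure_mono[OF assms(8)] by blast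
      ultimately show ?thesis using \<Omega> by (simp add: frontier_def interior_open)
    qed (use assms(8) in blast)
  qed
  then have ne: "representatives \<Omega> \<Omega>\<^sub>s \<noteq> {}"
    by (rule representatives_nonempty[OF \<Omega> \<Omega>s assms(7)])
  have pos: "0 < measure lborel \<Omega>\<^sub>s"
  proof -
    obtain p e where "e > 0" "ball p e \<subseteq> \<Omega>\<^sub>s" using \<Omega>s assms(7) by (metis openE ex_in_conv)
    moreover have "measure lborel (ball p e) \<le> measure lborel \<Omega>\<^sub>s"
      using \<Omega>s \<open>ball p e \<subseteq> \<Omega>\<^sub>s\<close> emeasure_bounded_finite[OF assms(5)]
      by (intro measure_mono_fmeasurable) (auto simp: fmeasurable_def)
    ultimately show ?thesis using content_ball_pos[of e p] by linarith
  qed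
  obtain W where W: "W \<in> representatives \<Omega> \<Omega>\<^sub>s" "\<And>v. v \<in> representatives \<Omega> \<Omega>\<^sub>s \<Longrightarrow> TV W \<le> TV v"
    using minimizer_exists[OF ne \<Omega> \<Omega>s pos] by blast
  have "TV W = ereal (real_of_ereal (TV W))"
    using W(1) TV_nonneg[of W] by (cases "TV W") (auto simp: representatives_def)
  then obtain u where u: "u \<in> representatives \<Omega> \<Omega>\<^sub>s" "TV u \<le> TV W" "card (range u - {0}) = 2"
    using two_level_competitor[OF W(1) _ \<Omega>(2) \<Omega>s pos, of "real_of_ereal (TV W)"] by auto
  have "TV u \<le> TV w" if "w \<in> BV_diamond \<Omega> \<Omega>\<^sub>s" for w
    using BV_diamond_representative[OF that \<Omega>(1) \<Omega>s pos] u(2) W(2) by (metis order_trans)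
  with u representatives_subset_BV_diamond[OF u(1) \<Omega>(1) \<Omega>s pos] show ?thesis by blast
qed

end
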